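(* There is an absolute constant $C>0$ such that the following holds. Let $\mathcal W$ be a finite dictionary containing the special words BOS and COPY, with at least one other word, let $V\ge 1$ be an integer, and let $\epsilon>0$. Then there exist an SSM $\hat F\in\mathcal S(M,U,D,L,W,S,B)$ with $$M=2,\qquad U=V,\qquad D,\;L,\;W,\;S,\;\log B\;\le\; C\,\log^{37}(\epsilon^{-1})\,\log^{42}(V)\,\log^{8}(|\mathcal W|),$$ and a decoding layer with matrix $W_{\mathrm{dec}}\in\mathbb R^{D\times|\mathcal W|}$, $\|W_{\mathrm{dec}}\|_\infty\le 1$, such that for the input copying task $$\sup_{V'\in\{1,\dots,V\}}\mathrm{err}_{V'}\le\epsilon .$$
   Context: Norms: for a vector or matrix $A$, $\|A\|_\infty$ is the largest absolute value of an entry and $\|A\|_0$ is the number of nonzero entries. FNNs: an FNN of depth $L$ and width $W$ is $f(x)=(A_L\eta(\cdot)+b_L)\circ\cdots\circ(A_2\eta(\cdot)+b_2)\circ(A_1x+b_1)$, with $\eta$ the entrywise ReLU, $A_i\in\mathbb R^{d_{i+1}\times d_i}$, $b_i\in\mathbb R^{d_{i+1}}$, $\max_i d_i\le W$. $\Psi(L,W,S,B)$ is the set of such $f$ with $\|A_i\|_\infty,\|b_i\|_\infty\le B$ for all $i$ and $\sum_{i=1}^L(\|A_i\|_0+\|b_i\|_0)\le S$. FNNs act on sequences token by token. Convolution layers: $\mathcal C(U,D,B)$ is the set of maps $g(X)=H*(W_gX)$ on sequences of tokens in $\mathbb R^D$, where $W_g\in\mathbb R^{D\times D}$ acts token-wise,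 $H\in\mathbb R^{D\times(U+1)}$ has entries $H_{k,j}=c_{1,k}\cos\!\big(\tfrac{2\pi j a_{1,k}}{U+1}\big)+c_{2,k}\sin\!\big(\tfrac{2\pi j a_{2,k}}{U+1}\big)$ ($k=1,\dots,D$, $j=0,\dots,U$) with $c_1,c_2,a_1,a_2\in\mathbb R^D$, the convolution is $(H*Y)_{k,t}=\sum_{j=0}^{U}H_{k,j}Y_{k,t-j}$ (the sum runs only over positions $t-j$ present in the sequence), and $\|W_g\|_\infty,\|a_1\|_\infty,\|a_2\|_\infty,\|c_1\|_\infty,\|c_2\|_\infty\le B$. SSMs: $\mathcal S(M,U,D,L,W,S,B)$ is the set of maps $f_M\circ g_M\circ\cdots\circ f_1\circ g_1\circ\mathrm{Emb}$ with $f_i\in\Psi(L,W,S,B)$, $g_i\in\mathcal C(U,D,B)$, and $\mathrm{Emb}$ the token-wise map $x\mapsto E_1x+E_2$ from the input token space to $\mathbb R^D$ with $\|E_1\|_\infty,\|E_2\|_\infty\le B$. Word sequences: a sequence of words of $\mathcal W$ is converted into the sequence of $|\mathcal W|$-dimensional one-hot vectors and fed to the SSM. The last output token $z\in\mathbb R^D$ is sent by the decoding layer to $W_{\mathrm{dec}}^\top z\in\mathbb R^{|\mathcal W|}$; the model's next-word prediction is the word corresponding to the largest component. Generation is autoregressive: each predicted word is appended to the sequence, which is fed in again. Input copying: the input is "BOS $x_1\,x_2\cdots x_{V'}$ COPY" with $x_1,\dots,x_{V'}$ independent and uniform on $\mathcal W\setminus\{\mathrm{BOS},\mathrm{COPY}\}$.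 If $y_1,\dots,y_{V'}$ are the first $V'$ words generated autoregressively, then $\mathrm{err}_{V'}:=\mathbb P[(y_1,\dots,y_{V'})\ne(x_1,\dots,x_{V'})]$. The same SSM and decoding layer are used for all $V'$. Asymptotic convention: in the size bound, each logarithm $\log z$ is read as $\max\{1,\log z\}$. *)

theory Defs
  imports "HOL-Probability.Probability" "Jordan_Normal_Form.Matrix"
begin

(* The dollar sign below is vector indexing of Jordan_Normal_Form. *)
unbundle no vec_syntax

(* Inserting 0 only fixes the value for objects without entries. *)

definition vec_inf_norm :: "real vec \<Rightarrow> real" where
  "vec_inf_norm v = Max (insert 0 {\<bar>v $ i\<bar> | i. i < dim_vec v})"

definition mat_inf_norm :: "real mat \<Rightarrow> real" where
  "mat_inf_norm A = Max (insert 0 {\<bar>A $$ (i, j)\<bar> | i j. i < dim_row A \<and> j < dim_col A})"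

definition vec_l0 :: "real vec \<Rightarrow> nat" where
  "vec_l0 v = card {i. i < dim_vec v \<and> v $ i \<noteq> 0}"

definition mat_l0 :: "real mat \<Rightarrow> nat" where
  "mat_l0 A = card {(i, j). i < dim_row A \<and> j < dim_col A \<and> A $$ (i, j) \<noteq> 0}"

definition relu :: "real vec \<Rightarrow> real vec" where
  "relu = map_vec (max 0)"

(* The layer list is [(A_1, b_1), ..., (A_L, b_L)]; no activation precedes the first layer. *)
fun fnn_eval :: "(real mat \<times> real vec) list \<Rightarrow> real vec \<Rightarrow> real vec" where
  "fnn_eval [] x = x"
| "fnn_eval ((A, b) # ls) x = foldl (\<lambda>y (A', b'). A' *\<^sub>v relu y + b') (A *\<^sub>v x + b) ls"

(* d i is the paper's d_(i+1): layer number i (from 0) maps R^(d i) to R^(d (i+1)).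
   The input and output dimensions, implicit in Psi(L,W,S,B), are explicit parameters,
   because membership of a token in R^D is not visible in its type. *)
definition fnn_class ::
  "nat \<Rightarrow> nat \<Rightarrow> nat \<Rightarrow> nat \<Rightarrow> nat \<Rightarrow> real \<Rightarrow> (real vec \<Rightarrow> real vec) set" where
  "fnn_class din dout L W S B = {fnn_eval ls | ls.
     length ls = L \<and> 1 \<le> L \<and>
     (\<exists>d. d 0 = din \<and> d L = dout \<and> (\<forall>i\<le>L. 1 \<le> d i \<and> d i \<le> W) \<and>
        (\<forall>i<L. fst (ls ! i) \<in> carrier_mat (d (Suc i)) (d i) \<and>
               snd (ls ! i) \<in> carrier_vec (d (Suc i)))) \<and>
     (\<forall>(A, b)\<in>set ls. mat_inf_norm A \<le> B \<and> vec_inf_norm b \<le> B) \<and>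
     (\<Sum>(A, b)\<leftarrow>ls. mat_l0 A + vec_l0 b) \<le> S}"

definition conv_filter ::
  "nat \<Rightarrow> nat \<Rightarrow> real vec \<Rightarrow> real vec \<Rightarrow> real vec \<Rightarrow> real vec \<Rightarrow> real mat" where
  "conv_filter U D c1 c2 a1 a2 = mat D (U + 1) (\<lambda>(k, j).
     c1 $ k * cos (2 * pi * real j * a1 $ k / real (U + 1)) +
     c2 $ k * sin (2 * pi * real j * a2 $ k / real (U + 1)))"

(* A sequence of tokens is a list of vectors, oldest token first. *)
definition convolve :: "real mat \<Rightarrow> real vec list \<Rightarrow> real vec list" where
  "convolve H Y = map (\<lambda>t. vec (dim_row H) (\<lambda>k.
     \<Sum>j | j < dim_col H \<and> j \<le> t. H $$ (k, j) * (Y ! (t - j)) $ k)) [0..<length Y]"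

definition conv_class :: "nat \<Rightarrow> nat \<Rightarrow> real \<Rightarrow> (real vec list \<Rightarrow> real vec list) set" where
  "conv_class U D B =
     {(\<lambda>X. convolve (conv_filter U D c1 c2 a1 a2) (map (\<lambda>x. Wg *\<^sub>v x) X)) | Wg c1 c2 a1 a2.
        Wg \<in> carrier_mat D D \<and> c1 \<in> carrier_vec D \<and> c2 \<in> carrier_vec D \<and>
        a1 \<in> carrier_vec D \<and> a2 \<in> carrier_vec D \<and>
        mat_inf_norm Wg \<le> B \<and> vec_inf_norm a1 \<le> B \<and> vec_inf_norm a2 \<le> B \<and>
        vec_inf_norm c1 \<le> B \<and> vec_inf_norm c2 \<le> B}"

(* N is the dimension of the input tokens. *)
definition emb_class :: "nat \<Rightarrow> nat \<Rightarrow> real \<Rightarrow> (real vec list \<Rightarrow> real vec list) set" where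
  "emb_class N D B = {map (\<lambda>x. E1 *\<^sub>v x + E2) | E1 E2.
     E1 \<in> carrier_mat D N \<and> E2 \<in> carrier_vec D \<and> mat_inf_norm E1 \<le> B \<and> vec_inf_norm E2 \<le> B}"

(* The list gfs is [(g_1, f_1), ..., (g_M, f_M)]; g_1 is applied first. *)
definition ssm_class ::
  "nat \<Rightarrow> nat \<Rightarrow> nat \<Rightarrow> nat \<Rightarrow> nat \<Rightarrow> nat \<Rightarrow> nat \<Rightarrow> real \<Rightarrow> (real vec list \<Rightarrow> real vec list) set" where
  "ssm_class N M U D L W S B =
     {(\<lambda>X. foldl (\<lambda>Y (g, f). map f (g Y)) (emb X) gfs) | emb gfs.
        emb \<in> emb_class N D B \<and> length gfs = M \<and>
        set gfs \<subseteq> conv_class U D B \<times> fnn_class D D L W S B}"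

(* The dictionary with N words is {..<N}, a word being its coordinate in the one-hot encoding.
   If several components are largest, arg_max selects one of them in a fixed but unspecified way. *)
definition next_word :: "nat \<Rightarrow> (real vec list \<Rightarrow> real vec list) \<Rightarrow> real mat \<Rightarrow> nat list \<Rightarrow> nat" where
  "next_word N F Wdec ws =
     arg_max (\<lambda>w. (transpose_mat Wdec *\<^sub>v last (F (map (unit_vec N) ws))) $ w) (\<lambda>w. w < N)"

fun generate :: "('w list \<Rightarrow> 'w) \<Rightarrow> nat \<Rightarrow> 'w list \<Rightarrow> 'w list" where
  "generate predict 0 ws = []"
| "generate predict (Suc n) ws = predict ws # generate predict n (ws @ [predict ws])"

(* replicate_pmf n p is the law of a list of n independent draws from p. *)
definition copy_err :: "nat \<Rightarrow> nat \<Rightarrow> nat \<Rightarrow> (nat list \<Rightarrow> nat) \<Rightarrow> nat \<Rightarrow> real" where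
  "copy_err N BOS COPY predict V' =
     measure_pmf.prob (replicate_pmf V' (pmf_of_set ({..<N} - {BOS, COPY})))
       {x. generate predict V' (BOS # x @ [COPY]) \<noteq> x}"

(* The logarithm of the size bound. *)
definition log1 :: "real \<Rightarrow> real" where
  "log1 z = max 1 (ln z)"

end

theory Submission
  imports Defs
begin

text \<open>
  All computations are in exact real arithmetic, and weights may be arbitrarily small. Hence a single
  real number can hold the whole word sequence as digits in a large base: the model copies with
  error 0.

  A layer has no skip connection and sees only window sums. The kernel
  \<open>ck V l = cos (\<pi> l / (2 (V + 1)))\<close> vanishes at \<open>l = V + 1\<close>, so the window sums
  \<open>A s = (\<Sum>l\<le>V. ck V l * z (s - l))\<close> and \<open>B s = (\<Sum>l\<le>V. ck V (l + 1) * z (s - l))\<close>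
  satisfy \<open>z (s + 1) = A (s + 1) - B s\<close> exactly, even when tokens leave the window. By summation by
  parts, a second layer that adds up \<open>f s * A s - f (s + 1) * B s\<close> obtains \<open>\<Sum>s. f s * z s\<close> up to
  boundary terms, although the first network, which multiplies \<open>A\<close> and \<open>B\<close> by clock-dependent
  factors, cannot see the single token \<open>z s\<close>.

  To predict word \<open>I\<close> of the prompt, the prompt is encoded with weights \<open>\<eta> ^ s\<close>, and the words already
  generated must be subtracted, except those whose originals have left the window of the prompt sum.
  Let \<open>E\<close> be the left end of the window, and let \<open>k\<close> be the highest bit in which \<open>E\<close> and \<open>I\<close> differ.
  Among the prompt positions in the window and up to \<open>I\<close>, those with bit \<open>k\<close> set form the block from
  the multiple of \<open>2 ^ k\<close> below \<open>I\<close> up to \<open>I\<close>, and all earlier positions with bit \<open>k\<close> set have left the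
  window. So for each \<open>k\<close> one channel sums the prompt over positions with bit \<open>k\<close> set. In the channel
  of the generated words no term ever leaves the window, so there the weights grow from block to block,
  and the earlier blocks are negligible. The boundary term at the right end is removed by a further
  channel whose weights grow so fast that its last term dominates. If \<open>E = I\<close>, the wanted word
  itself is at the left boundary, and the boundary term there is recovered from two more channels.
\<close>

section \<open>Straight-line ReLU programs and feedforward networks\<close>

definition agrees :: "'a set \<Rightarrow> ('a \<Rightarrow> real) list \<Rightarrow> ('a \<Rightarrow> real) \<Rightarrow> bool" where
  "agrees X gs h \<longleftrightarrow> (\<exists>g\<in>set gs. \<forall>a\<in>X. g a = h a)"

text \<open>Each step appends one register. The earlier registers are nonnegative, hence not changed by
  the activation, so that one step is one layer.\<close>

inductive slp :: "'a set \<Rightarrow> real \<Rightarrow> ('a \<Rightarrow> real) list \<Rightarrow> ('a \<Rightarrow> real) list \<Rightarrow> bool"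
  for X B gs0 where
  base: "slp X B gs0 gs0"
| step: "slp X B gs0 gs \<Longrightarrow> \<bar>b\<bar> \<le> B \<Longrightarrow> (\<And>c. \<bar>w c\<bar> \<le> B) \<Longrightarrow>
    slp X B gs0 (gs @ [\<lambda>a. max 0 (b + (\<Sum>c<length gs. w c * (gs ! c) a))])"

lemma slp_trans: "slp X B gs1 gs2 \<Longrightarrow> slp X B gs0 gs1 \<Longrightarrow> slp X B gs0 gs2"
  by (induction rule: slp.induct) (auto intro: slp.step)

lemma slp_prefix: "slp X B gs0 gs \<Longrightarrow> \<exists>hs. gs = gs0 @ hs"
  by (induction rule: slp.induct) auto

text \<open>Every program that already provides the functions in \<open>G\<close> can be extended by at most \<open>n\<close>
  assignments so that it also provides those in \<open>H\<close>. Functions only matter on the inputs in \<open>X\<close>, and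
  \<open>B\<close> bounds the weights.\<close>

definition computes :: "'a set \<Rightarrow> real \<Rightarrow> ('a \<Rightarrow> real) set \<Rightarrow> nat \<Rightarrow> ('a \<Rightarrow> real) set \<Rightarrow> bool" where
  "computes X B G n H \<longleftrightarrow> (\<forall>gs. (\<forall>g\<in>G. agrees X gs g) \<longrightarrow>
     (\<exists>gs'. slp X B gs gs' \<and> length gs' \<le> length gs + n \<and> (\<forall>h\<in>H. agrees X gs' h)))"

lemma agrees_slp: "slp X B gs gs' \<Longrightarrow> agrees X gs g \<Longrightarrow> agrees X gs' g"
  using slp_prefix[of X B gs gs'] by (auto simp: agrees_def)

lemma computes_comp:
  assumes "computes X B G n H" "computes X B (G \<union> H) m H'"
  shows "computes X B G (n + m) (H \<union> H')"
  unfolding computes_def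
proof (intro allI impI)
  fix gs assume gs: "\<forall>g\<in>G. agrees X gs g"
  then obtain gs1 where 1: "slp X B gs gs1" "length gs1 \<le> length gs + n" "\<forall>h\<in>H. agrees X gs1 h"
    using assms(1) unfolding computes_def by blast
  have "\<forall>g\<in>G \<union> H. agrees X gs1 g" using 1 gs agrees_slp by blast
  then obtain gs2 where 2: "slp X B gs1 gs2" "length gs2 \<le> length gs1 + m" "\<forall>h\<in>H'. agrees X gs2 h"
    using assms(2) unfolding computes_def by blast
  have "\<forall>h\<in>H \<union> H'. agrees X gs2 h" using 1 2 agrees_slp by blast
  moreover have "slp X B gs gs2" using 1 2 slp_trans by blast
  ultimately show "\<exists>gs'. slp X B gs gs' \<and> length gs' \<le> length gs + (n + m) \<and>
      (\<forall>h\<in>H \<union> H'. agrees X gs' h)"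
    using 1 2 by (intro exI[of _ gs2]) auto
qed

lemma computes_mono: "computes X B G n H \<Longrightarrow> G \<subseteq> G' \<Longrightarrow> n \<le> n' \<Longrightarrow> H' \<subseteq> H \<Longrightarrow> computes X B G' n' H'"
  unfolding computes_def by (meson add_left_mono le_trans subset_iff)

lemma computes_refl: "H \<subseteq> G \<Longrightarrow> computes X B G 0 H"
  unfolding computes_def by (auto intro!: exI slp.base)

lemma computes_cong: "computes X B G n {h} \<Longrightarrow> (\<And>a. a \<in> X \<Longrightarrow> h a = h' a) \<Longrightarrow> computes X B G n {h'}"
  unfolding computes_def agrees_def by fastforce

lemma computes_then:
  assumes "computes X B G n H" "computes X B (G \<union> H) m H'"
  shows "computes X B G (n + m) H'"
  using computes_mono[OF computes_comp[OF assms]] by auto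

lemma computes_Un:
  assumes "computes X B G n H" "computes X B G m H'"
  shows "computes X B G (n + m) (H \<union> H')"
  by (rule computes_comp[OF assms(1)], rule computes_mono[OF assms(2)]) auto

lemma computes_UN:
  assumes "\<And>i. i < k \<Longrightarrow> computes X B G n (H i)"
  shows "computes X B G (k * n) (\<Union>i<k. H i)"
  using assms
proof (induction k)
  case 0
  show ?case by (simp add: computes_refl)
next
  case (Suc k)
  have "computes X B G (k * n + n) ((\<Union>i<k. H i) \<union> H k)"
    by (rule computes_Un) (use Suc in auto)
  then show ?case by (simp add: lessThan_Suc Un_commute add.commute)
qed

text \<open>Several entries of \<open>ps\<close> may be found in the same register, so the weight of
  a register is the sum of all coefficients that point to it. Hence the sum of the absolute values
  is bounded and not only each coefficient.\<close>

lemma computes_step: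
  assumes G: "\<And>q h. (q, h) \<in> set ps \<Longrightarrow> h \<in> G"
    and B: "(\<Sum>(q, h)\<leftarrow>ps. \<bar>q\<bar>) \<le> B" "\<bar>b\<bar> \<le> B"
    and g: "\<And>a. a \<in> X \<Longrightarrow> g a = max 0 (b + (\<Sum>(q, h)\<leftarrow>ps. q * h a))"
  shows "computes X B G 1 {g}"
  unfolding computes_def
proof (intro allI impI)
  fix gs assume "\<forall>g\<in>G. agrees X gs g"
  then have "\<forall>g\<in>G. \<exists>c<length gs. \<forall>a\<in>X. (gs ! c) a = g a"
    unfolding agrees_def by (metis in_set_conv_nth)
  then obtain idx where idx: "\<And>h. h \<in> G \<Longrightarrow> idx h < length gs"
      "\<And>h a. h \<in> G \<Longrightarrow> a \<in> X \<Longrightarrow> (gs ! idx h) a = h a" by metis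
  define w where "w ps c = (\<Sum>(q, h)\<leftarrow>ps. if idx h = c then q else 0 :: real)" for ps c
  have w_le: "\<bar>w ps c\<bar> \<le> (\<Sum>(q, h)\<leftarrow>ps. \<bar>q\<bar>)" for ps c
    unfolding w_def by (induction ps) (auto split: if_splits)
  have w_sum: "(\<Sum>c<length gs. w ps c * (gs ! c) a) = (\<Sum>(q, h)\<leftarrow>ps. q * h a)"
    if "a \<in> X" "\<And>q h. (q, h) \<in> set ps \<Longrightarrow> h \<in> G" for a ps
    using that(2)
  proof (induction ps)
    case Nil
    then show ?case by (simp add: w_def)
  next
    case (Cons p ps)
    obtain q h where p: "p = (q, h)" by force
    have h: "h \<in> G" using Cons.prems p by auto
    have "(\<Sum>c<length gs. w (p # ps) c * (gs ! c) a)
        = (\<Sum>c<length gs. (if c = idx h then q * (gs ! c) a else 0)) + (\<Sum>c<length gs. w ps c * (gs ! c) a)"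
      unfolding p w_def sum.distrib[symmetric] by (intro sum.cong) (auto simp: algebra_simps)
    also have "\<dots> = q * h a + (\<Sum>(q, h)\<leftarrow>ps. q * h a)"
      using Cons idx[OF h] that(1) by (auto simp: sum.delta)
    finally show ?case by (simp add: p)
  qed
  let ?g = "\<lambda>a. max 0 (b + (\<Sum>c<length gs. w ps c * (gs ! c) a))"
  have "slp X B gs (gs @ [?g])"
    by (rule slp.step[OF slp.base B(2)]) (rule order_trans[OF w_le B(1)])
  moreover have "agrees X (gs @ [?g]) g"
    unfolding agrees_def using w_sum G g by (intro bexI[of _ ?g]) auto
  ultimately show "\<exists>gs'. slp X B gs gs' \<and> length gs' \<le> length gs + 1 \<and> (\<forall>h\<in>{g}. agrees X gs' h)"
    by (intro exI[of _ "gs @ [?g]"]) auto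
qed

section \<open>Short programs: linear forms, gates, powers, binary digits\<close>

lemma computes_lin1:
  assumes "h1 \<in> G" "\<bar>q1\<bar> \<le> B" "\<bar>b\<bar> \<le> B" "\<And>a. a \<in> X \<Longrightarrow> g a = max 0 (b + q1 * h1 a)"
  shows "computes X B G 1 {g}"
  by (rule computes_step[where ps = "[(q1, h1)]" and b = b]) (use assms in auto)

lemma computes_lin2:
  assumes "h1 \<in> G" "h2 \<in> G" "\<bar>q1\<bar> + \<bar>q2\<bar> \<le> B" "\<bar>b\<bar> \<le> B"
    "\<And>a. a \<in> X \<Longrightarrow> g a = max 0 (b + q1 * h1 a + q2 * h2 a)"
  shows "computes X B G 1 {g}"
  by (rule computes_step[where ps = "[(q1, h1), (q2, h2)]" and b = b]) (use assms in auto)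

lemma computes_lin3:
  assumes "h1 \<in> G" "h2 \<in> G" "h3 \<in> G" "\<bar>q1\<bar> + \<bar>q2\<bar> + \<bar>q3\<bar> \<le> B" "\<bar>b\<bar> \<le> B"
    "\<And>a. a \<in> X \<Longrightarrow> g a = max 0 (b + q1 * h1 a + q2 * h2 a + q3 * h3 a)"
  shows "computes X B G 1 {g}"
  by (rule computes_step[where ps = "[(q1, h1), (q2, h2), (q3, h3)]" and b = b]) (use assms in auto)

text \<open>Since \<open>v\<close> is at most \<open>M\<close>, the form
  \<open>v + M * p - M\<close> is \<open>v\<close> when the indicator is 1 and at most 0 when it is
  0, so the activation does the selection.\<close>

lemma computes_gate:
  assumes "v \<in> G" "(\<lambda>a. of_bool (p a)) \<in> G" "\<And>a. a \<in> X \<Longrightarrow> 0 \<le> v a \<and> v a \<le> M" "0 \<le> M" "M + 1 \<le> B"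
    and "\<And>a. a \<in> X \<Longrightarrow> g a = (if p a then v a else 0)"
  shows "computes X B G 1 {g}"
  by (rule computes_lin2[where b = "-M" and ?q1.0 = 1 and ?q2.0 = M, OF assms(1,2)]) (use assms in force)+

lemma computes_gate_not:
  assumes "v \<in> G" "(\<lambda>a. of_bool (p a)) \<in> G" "\<And>a. a \<in> X \<Longrightarrow> 0 \<le> v a \<and> v a \<le> M" "0 \<le> M" "M + 1 \<le> B"
    and "\<And>a. a \<in> X \<Longrightarrow> g a = (if p a then 0 else v a)"
  shows "computes X B G 1 {g}"
  by (rule computes_lin2[where b = 0 and ?q1.0 = 1 and ?q2.0 = "-M", OF assms(1,2)]) (use assms in force)+

lemma computes_not:
  assumes "(\<lambda>a. of_bool (p a)) \<in> G" "1 \<le> B"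
  shows "computes X B G 1 {\<lambda>a. of_bool (\<not> p a)}"
  by (rule computes_lin1[where b = 1 and ?q1.0 = "-1", OF assms(1)]) (use assms in auto)

text \<open>Registers cannot be multiplied, but the factor takes only two values: \<open>v\<close>
  is split by \<open>p\<close> into two registers, which are added again with the fixed weights
  \<open>y\<close> and 1.\<close>

lemma computes_pow1:
  fixes y :: real
  assumes "v \<in> G" "(\<lambda>a. of_bool (p a)) \<in> G" "\<And>a. a \<in> X \<Longrightarrow> 0 \<le> v a \<and> v a \<le> M" "0 \<le> M" "M + 2 \<le> B"
    "0 \<le> y" "y \<le> 1"
  shows "computes X B G 3 {\<lambda>a. v a * (if p a then y else 1)}"
proof -
  let ?t = "\<lambda>a. if p a then v a else 0" and ?f = "\<lambda>a. if p a then 0 else v a"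
  have t: "computes X B G 1 {?t}" by (rule computes_gate[OF assms(1-4)]) (use assms in auto)
  have f: "computes X B G 1 {?f}" by (rule computes_gate_not[OF assms(1-4)]) (use assms in auto)
  have "computes X B G ((1 + 1) + 1) {\<lambda>a. v a * (if p a then y else 1)}"
    by (rule computes_then[OF computes_Un[OF t f]], rule computes_lin2[where ?h1.0="?t" and ?h2.0="?f" and b=0 and ?q1.0=y and ?q2.0=1])
      (use assms in \<open>auto simp: mult.commute\<close>)
  then show ?thesis by (simp add: numeral_eq_Suc)
qed

text \<open>One factor is applied per indicator. The powers of \<eta> enter as weights in [0, 1]:
  however small they are, they respect the weight bound, and intermediate values stay below
  \<open>M\<close>.\<close>

lemma computes_pow:
  fixes \<eta> :: real and P :: "nat \<Rightarrow> 'a \<Rightarrow> bool"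
  assumes "v \<in> G" "\<And>b. b < n \<Longrightarrow> (\<lambda>a. of_bool (P b a)) \<in> G"
    "\<And>a. a \<in> X \<Longrightarrow> 0 \<le> v a \<and> v a \<le> M" "0 \<le> M" "M + 2 \<le> B" "0 \<le> \<eta>" "\<eta> \<le> 1"
  shows "computes X B G (n * 3) {\<lambda>a. v a * \<eta> ^ (\<Sum>b<n. if P b a then c b else 0)}"
  using assms(2)
proof (induction n)
  case 0
  show ?case by (simp add: computes_refl assms(1))
next
  case (Suc n)
  let ?w = "\<lambda>n a. v a * \<eta> ^ (\<Sum>b<n. if P b a then c b else 0)"
  have le: "\<eta> ^ k \<le> 1" for k using assms by (simp add: power_le_one)
  have w: "0 \<le> ?w n a \<and> ?w n a \<le> M" if "a \<in> X" for a
    using assms(3)[OF that] le[of "\<Sum>b<n. if P b a then c b else 0"] assms(6)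
    by (auto intro: order_trans[OF mult_left_le])
  have "computes X B (G \<union> {?w n}) 3 {\<lambda>a. ?w n a * (if P n a then \<eta> ^ c n else 1)}"
    by (rule computes_pow1[where M = M]) (use Suc.prems w assms le in auto)
  then have "computes X B (G \<union> {?w n}) 3 {?w (Suc n)}"
    by (rule computes_cong) (auto simp: power_add)
  with Suc have "computes X B G (n * 3 + 3) {?w (Suc n)}"
    by (intro computes_then[of X B G "n*3" "{?w n}"]) auto
  then show ?case by (simp add: add.commute)
qed

lemma mod_2_pow_Suc: "n mod 2 ^ Suc b = 2 ^ b * of_bool (bit n b) + n mod 2 ^ b" for n :: nat
  using take_bit_Suc_from_most[of b n] by (simp add: take_bit_eq_mod)

text \<open>Digits are read from the top, keeping a register \<open>r\<close> with the part not yet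
  read. Only exact digits are subtracted, so the initial error, at most 1/4 downwards, does not
  grow.\<close>

lemma computes_bits:
  fixes n :: "'a \<Rightarrow> nat"
  assumes "\<rho> \<in> G" "4 * 2 ^ nb + 5 \<le> B"
    and n: "\<And>a. a \<in> X \<Longrightarrow> n a < 2 ^ nb \<and> real (n a) - 1 / 4 \<le> \<rho> a \<and> \<rho> a \<le> real (n a)"
  shows "computes X B G (nb * 4) ((\<lambda>b a. of_bool (bit (n a) b)) ` {..<nb})"
proof -
  let ?bit = "\<lambda>b a. of_bool (bit (n a) b) :: real"
  have "\<exists>r. computes X B G (k * 4) ({r} \<union> ?bit ` {nb - k..<nb}) \<and>
      (\<forall>a\<in>X. real (n a mod 2 ^ (nb - k)) - 1 / 4 \<le> r a \<and> r a \<le> real (n a mod 2 ^ (nb - k)))"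
    if "k \<le> nb" for k
    using that
  proof (induction k)
    case 0
    show ?case by (rule exI[of _ \<rho>]) (use assms in \<open>auto intro: computes_refl\<close>)
  next
    case (Suc k)
    then obtain r where r: "computes X B G (k * 4) ({r} \<union> ?bit ` {nb - k..<nb})"
      and r2: "\<And>a. a \<in> X \<Longrightarrow> real (n a mod 2 ^ (nb - k)) - 1 / 4 \<le> r a \<and> r a \<le> real (n a mod 2 ^ (nb - k))"
      by auto
    define b where "b = nb - Suc k"
    have b: "nb - k = Suc b" "b < nb" using Suc.prems by (auto simp: b_def)
    have "(2::real) ^ b \<le> 2 ^ nb" using b by (intro power_increasing) auto
    then have B: "4 * 2 ^ b + 5 \<le> B" "(0::real) \<le> 2 ^ b" using assms(2) by (linarith, simp)
    then have B2: "2 \<le> B" "0 \<le> B" "2 ^ b \<le> B" by linarith+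
    let ?t = "\<lambda>c a. max 0 ((c - 4 * 2 ^ b) + 4 * r a)"
    let ?r = "\<lambda>a. max 0 (r a - 2 ^ b * ?bit b a)"
    have m: "real (n a mod 2 ^ Suc b) = 2 ^ b * ?bit b a + real (n a mod 2 ^ b)"
      "real (n a mod 2 ^ b) + 1 \<le> 2 ^ b" for a
    proof -
      show "real (n a mod 2 ^ Suc b) = 2 ^ b * ?bit b a + real (n a mod 2 ^ b)"
        unfolding mod_2_pow_Suc by simp
      have "n a mod 2 ^ b + 1 \<le> 2 ^ b" by (simp add: Suc_leI)
      then have "real (n a mod 2 ^ b + 1) \<le> real (2 ^ b)" by (rule of_nat_mono)
      then show "real (n a mod 2 ^ b) + 1 \<le> 2 ^ b" by simp
    qed
    have t: "computes X B {r} 1 {?t c}" if "0 \<le> c" "c \<le> 2" for c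
    proof (rule computes_lin1[where b = "c - 4 * 2 ^ b" and ?q1.0 = 4])
      show "\<bar>4\<bar> \<le> B" using B by linarith
      show "\<bar>c - 4 * 2 ^ b\<bar> \<le> B" using that B by linarith
    qed auto
    \<comment> \<open>If the digit is 1, then \<open>r\<close> is at least
      \<open>2 ^ b - 1 / 4\<close> and the two ramps differ by exactly 1; if it is 0, then
      \<open>r\<close> is at most \<open>2 ^ b - 1\<close> and both ramps vanish.\<close>
    have bit: "?bit b a = max 0 (0 + 1 * ?t 2 a + (- 1) * ?t 1 a)" if "a \<in> X" for a
      using r2[OF that] m[of a] unfolding b by (cases "bit (n a) b") (auto simp: max_def)
    have "computes X B {r} ((1 + 1) + 1) {?bit b}"
      by (rule computes_then[OF computes_Un[OF t[of 2] t[of 1]]],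
          (simp; fail), (simp; fail), (simp; fail), (simp; fail),
          rule computes_lin2[where ?h1.0 = "?t 2" and ?h2.0 = "?t 1" and b = 0 and ?q1.0 = 1 and ?q2.0 = "-1"])
        (use B2 bit in auto)
    moreover have "computes X B ({r} \<union> {?bit b}) 1 {?r}"
      by (rule computes_lin2[where ?h1.0 = r and ?h2.0 = "?bit b" and b = 0 and ?q1.0 = 1 and ?q2.0 = "- (2 ^ b)"])
        (use B B2 in auto)
    ultimately have "computes X B {r} (((1 + 1) + 1) + 1) ({?bit b} \<union> {?r})" by (rule computes_comp)
    then have "computes X B (G \<union> ({r} \<union> ?bit ` {nb - k..<nb})) 4 ({?bit b} \<union> {?r})"
      by (rule computes_mono) auto
    then have "computes X B G (k * 4 + 4) (({r} \<union> ?bit ` {nb - k..<nb}) \<union> ({?bit b} \<union> {?r}))"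
      by (rule computes_comp[OF r])
    moreover have "{nb - Suc k..<nb} = insert b {nb - k..<nb}" using b unfolding b_def by auto
    ultimately have "computes X B G (Suc k * 4) ({?r} \<union> ?bit ` {nb - Suc k..<nb})"
      by (elim computes_mono) auto
    moreover have "real (n a mod 2 ^ b) - 1 / 4 \<le> ?r a \<and> ?r a \<le> real (n a mod 2 ^ b)" if "a \<in> X" for a
      using r2[OF that] m[of a] unfolding b by (auto simp: max_def)
    ultimately show ?case unfolding b_def by blast
  qed
  from this[of nb] obtain r where "computes X B G (nb * 4) ({r} \<union> ?bit ` {nb - nb..<nb})" by blast
  then show ?thesis by (rule computes_mono) (auto simp: lessThan_atLeast0)
qed

section \<open>Networks with square layers that run a program\<close>

definition layers :: "nat \<Rightarrow> real \<Rightarrow> (real mat \<times> real vec) list \<Rightarrow> bool" where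
  "layers D B ls \<longleftrightarrow> (\<forall>(A, b)\<in>set ls. A \<in> carrier_mat D D \<and> b \<in> carrier_vec D \<and>
     mat_inf_norm A \<le> B \<and> vec_inf_norm b \<le> B)"

lemma mat_inf_norm_le:
  assumes "A \<in> carrier_mat n m" "0 \<le> B" "\<And>i j. i < n \<Longrightarrow> j < m \<Longrightarrow> \<bar>A $$ (i, j)\<bar> \<le> B"
  shows "mat_inf_norm A \<le> B"
proof -
  have "{\<bar>A $$ (i, j)\<bar> | i j. i < n \<and> j < m} = (\<lambda>(i, j). \<bar>A $$ (i, j)\<bar>) ` ({..<n} \<times> {..<m})" by auto
  then have "finite {\<bar>A $$ (i, j)\<bar> | i j. i < n \<and> j < m}" by (simp only:) blast
  then show ?thesis unfolding mat_inf_norm_def using assms by (subst Max_le_iff) auto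
qed

lemma vec_inf_norm_le:
  assumes "v \<in> carrier_vec n" "0 \<le> B" "\<And>i. i < n \<Longrightarrow> \<bar>v $ i\<bar> \<le> B"
  shows "vec_inf_norm v \<le> B"
  unfolding vec_inf_norm_def using assms by (subst Max_le_iff) auto

lemma mat_l0_le: "A \<in> carrier_mat n m \<Longrightarrow> mat_l0 A \<le> n * m"
proof -
  assume "A \<in> carrier_mat n m"
  then have "mat_l0 A \<le> card ({..<n} \<times> {..<m})"
    unfolding mat_l0_def by (intro card_mono) auto
  then show ?thesis by simp
qed

lemma vec_l0_le: "v \<in> carrier_vec n \<Longrightarrow> vec_l0 v \<le> n"
proof -
  assume "v \<in> carrier_vec n"
  then have "vec_l0 v \<le> card {..<n}" unfolding vec_l0_def by (intro card_mono) auto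
  then show ?thesis by simp
qed

definition relu_layer :: "real vec \<Rightarrow> real mat \<times> real vec \<Rightarrow> real vec" where
  "relu_layer y l = fst l *\<^sub>v relu y + snd l"

lemma fnn_eval_relu_layer: "fnn_eval ((A, b) # ls) x = foldl relu_layer (A *\<^sub>v x + b) ls"
proof -
  have "relu_layer = (\<lambda>y (A', b'). A' *\<^sub>v relu y + b')" by (auto simp: fun_eq_iff relu_layer_def)
  then show ?thesis by simp
qed

lemma relu_layer_carrier:
  "layers D B [l] \<Longrightarrow> y \<in> carrier_vec D \<Longrightarrow> relu_layer y l \<in> carrier_vec D"
  by (cases l) (auto simp: layers_def relu_layer_def relu_def)

lemma relu_layers_carrier:
  "layers D B ls \<Longrightarrow> y \<in> carrier_vec D \<Longrightarrow> foldl relu_layer y ls \<in> carrier_vec D"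
proof (induction ls arbitrary: y)
  case (Cons l ls)
  have "layers D B [l]" "layers D B ls" using Cons.prems by (auto simp: layers_def)
  with Cons relu_layer_carrier show ?case by simp
qed simp

lemma relu_layer_index:
  assumes "A \<in> carrier_mat D D" "b \<in> carrier_vec D" "y \<in> carrier_vec D" "i < D"
  shows "relu_layer y (A, b) $ i = (\<Sum>c<D. A $$ (i, c) * max 0 (y $ c)) + b $ i"
  using assms by (auto simp: relu_layer_def relu_def scalar_prod_def lessThan_atLeast0 intro!: sum.cong)

text \<open>The layer that appends register \<open>r\<close> is the identity outside row
  \<open>r\<close>. Coordinates that hold no register yet have weight 0 in that row and may contain
  anything. Values are compared after \<open>max 0\<close> because no activation follows the last
  layer.\<close>

lemma slp_relu_layers:
  assumes "slp X B gs0 gs" "1 \<le> B" "length gs \<le> D"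
    and inp: "\<And>a. a \<in> X \<Longrightarrow> inp a \<in> carrier_vec D"
      "\<And>a c. a \<in> X \<Longrightarrow> c < length gs0 \<Longrightarrow> inp a $ c = (gs0 ! c) a \<and> 0 \<le> (gs0 ! c) a"
  shows "\<exists>ls. layers D B ls \<and> length ls + length gs0 = length gs \<and>
    (\<forall>a\<in>X. \<forall>c<length gs. max 0 (foldl relu_layer (inp a) ls $ c) = (gs ! c) a)"
  using assms(1,3)
proof (induction rule: slp.induct)
  case base
  show ?case by (rule exI[of _ "[]"]) (use inp in \<open>auto simp: layers_def\<close>)
next
  case (step gs b w)
  then obtain ls where ls: "layers D B ls" "length ls + length gs0 = length gs"
    "\<And>a c. a \<in> X \<Longrightarrow> c < length gs \<Longrightarrow> max 0 (foldl relu_layer (inp a) ls $ c) = (gs ! c) a"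
    by auto
  define r where "r = length gs"
  have r: "r < D" using step.prems by (auto simp: r_def)
  define A where "A = mat D D (\<lambda>(i, c). if i = r then (if c < r then w c else 0) else of_bool (i = c))"
  define v where "v = vec D (\<lambda>i. if i = r then b else 0)"
  have A: "A \<in> carrier_mat D D" "v \<in> carrier_vec D" by (auto simp: A_def v_def)
  have "layers D B (ls @ [(A, v)])"
    using ls(1) A step.hyps assms(2)
    by (auto simp: layers_def A_def v_def intro!: mat_inf_norm_le vec_inf_norm_le)
  moreover have "max 0 (foldl relu_layer (inp a) (ls @ [(A, v)]) $ c) =
      ((gs @ [\<lambda>a. max 0 (b + (\<Sum>c<length gs. w c * (gs ! c) a))]) ! c) a"
    if a: "a \<in> X" and c: "c < Suc r" for a c
  proof -
    define y where "y = foldl relu_layer (inp a) ls"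
    have y: "y \<in> carrier_vec D" unfolding y_def by (rule relu_layers_carrier[OF ls(1) inp(1)[OF a]])
    have yc: "max 0 (y $ c) = (gs ! c) a" if "c < r" for c
      using ls(3)[OF a] that by (simp add: y_def r_def)
    have cD: "c < D" using c r by simp
    have idx: "relu_layer y (A, v) $ c = (\<Sum>j<D. A $$ (c, j) * max 0 (y $ j)) + v $ c"
      by (rule relu_layer_index[OF A y cD])
    show ?thesis
    proof (cases "c = r")
      case True
      have "(\<Sum>j<D. A $$ (c, j) * max 0 (y $ j)) = (\<Sum>j<r. A $$ (c, j) * max 0 (y $ j))"
        by (rule sum.mono_neutral_right) (use True r in \<open>auto simp: A_def\<close>)
      also have "\<dots> = (\<Sum>j<r. w j * (gs ! j) a)"
        by (rule sum.cong) (use True r yc in \<open>auto simp: A_def\<close>)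
      finally show ?thesis using idx True r by (simp add: y_def v_def nth_append r_def)
    next
      case False
      have "(\<Sum>j<D. A $$ (c, j) * max 0 (y $ j)) = (\<Sum>j<D. if j = c then max 0 (y $ j) else 0)"
        by (rule sum.cong) (use False cD in \<open>auto simp: A_def\<close>)
      also have "\<dots> = (gs ! c) a" using cD yc[of c] False c by (simp add: sum.delta)
      finally show ?thesis using idx False cD c yc[of c] by (auto simp: y_def v_def nth_append r_def max_def split: if_splits)
    qed
  qed
  ultimately show ?case using ls(2) by (intro exI[of _ "ls @ [(A, v)]"]) (auto simp: r_def)
qed

lemma layers_one: "1 \<le> B \<Longrightarrow> layers D B [(1\<^sub>m D, 0\<^sub>v D)]"
  by (auto simp: layers_def intro!: mat_inf_norm_le[of _ D D] vec_inf_norm_le[of _ D])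

lemma relu_layer_one: "y \<in> carrier_vec D \<Longrightarrow> relu_layer y (1\<^sub>m D, 0\<^sub>v D) = relu y"
  by (simp add: relu_layer_def relu_def)

text \<open>The activation is idempotent, so identity layers can pad a network to a prescribed
  depth. At least one of them is present and supplies the activation missing after the last program
  layer.\<close>

lemma relu_layers_id:
  assumes "y \<in> carrier_vec D"
  shows "foldl relu_layer y (replicate (Suc n) (1\<^sub>m D, 0\<^sub>v D)) = relu y"
proof (induction n)
  case 0
  show ?case using assms by (simp add: relu_layer_one)
next
  case (Suc n)
  have "relu y \<in> carrier_vec D" "relu (relu y) = relu y" using assms by (auto simp: relu_def)
  then have "relu_layer (relu y) (1\<^sub>m D, 0\<^sub>v D) = relu y" by (simp add: relu_layer_one)
  then show ?case unfolding replicate.simps(2)[of "Suc n"] replicate_append_same[symmetric] foldl_append Suc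
    by simp
qed

lemma fnn_classI:
  assumes "layers D B ls" "1 \<le> length ls" "1 \<le> D"
  shows "fnn_eval ls \<in> fnn_class D D (length ls) D (length ls * (D * D + D)) B"
proof -
  have "(\<Sum>(A, b)\<leftarrow>ls. mat_l0 A + vec_l0 b) \<le> length ls * (D * D + D)"
    using assms(1)
  proof (induction ls)
    case (Cons l ls)
    obtain A b where l: "l = (A, b)" by force
    have "mat_l0 A \<le> D * D" "vec_l0 b \<le> D"
      using Cons.prems mat_l0_le vec_l0_le by (auto simp: l layers_def)
    then show ?case using Cons by (auto simp: l layers_def)
  qed simp
  moreover have "fst (ls ! i) \<in> carrier_mat D D \<and> snd (ls ! i) \<in> carrier_vec D" if "i < length ls" for i
    using assms(1) nth_mem[OF that] by (auto simp: layers_def split_beta)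
  moreover have "\<forall>(A, b)\<in>set ls. mat_inf_norm A \<le> B \<and> vec_inf_norm b \<le> B"
    using assms(1) by (auto simp: layers_def)
  ultimately show ?thesis unfolding fnn_class_def using assms(2,3)
    by (intro CollectI exI[of _ ls]) (auto intro!: exI[of _ "\<lambda>_. D"])
qed

text \<open>An identity layer comes first because the activation precedes only the later layers;
  identity layers at the end bring the depth to \<open>D + 2\<close>, independently of the program
  length.\<close>

lemma slp_fnn:
  assumes "slp X B gs0 gs" "1 \<le> B" "length gs \<le> D" "1 \<le> D"
    and inp: "\<And>a. a \<in> X \<Longrightarrow> inp a \<in> carrier_vec D"
      "\<And>a c. a \<in> X \<Longrightarrow> c < length gs0 \<Longrightarrow> inp a $ c = (gs0 ! c) a \<and> 0 \<le> (gs0 ! c) a"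
  shows "\<exists>f\<in>fnn_class D D (D + 2) D ((D + 2) * (D * D + D)) B.
    (\<forall>y\<in>carrier_vec D. f y \<in> carrier_vec D) \<and> (\<forall>a\<in>X. \<forall>c<length gs. f (inp a) $ c = (gs ! c) a)"
proof -
  obtain ls where ls: "layers D B ls" "length ls + length gs0 = length gs"
    "\<And>a c. a \<in> X \<Longrightarrow> c < length gs \<Longrightarrow> max 0 (foldl relu_layer (inp a) ls $ c) = (gs ! c) a"
    using slp_relu_layers[OF assms(1-3) inp] by blast
  let ?I = "(1\<^sub>m D, 0\<^sub>v D) :: real mat \<times> real vec"
  define n where "n = D - length ls"
  define ks where "ks = ls @ replicate (Suc n) ?I"
  have len: "length (?I # ks) = D + 2" using ls(2) assms(3) by (simp add: ks_def n_def)
  have ks: "layers D B (?I # ks)"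
    using ls(1) layers_one[of B D] assms(2) by (auto simp: layers_def ks_def)
  have ev: "fnn_eval (?I # ks) y = foldl relu_layer y ks" if "y \<in> carrier_vec D" for y
    unfolding fnn_eval_relu_layer using that by simp
  have "fnn_eval (?I # ks) \<in> fnn_class D D (D + 2) D ((D + 2) * (D * D + D)) B"
    using fnn_classI[OF ks _ assms(4)] unfolding len by simp
  moreover have "fnn_eval (?I # ks) y \<in> carrier_vec D" if "y \<in> carrier_vec D" for y
    unfolding ev[OF that] using ks that by (intro relu_layers_carrier[of D B]) (auto simp: layers_def)
  moreover have "fnn_eval (?I # ks) (inp a) $ c = (gs ! c) a" if "a \<in> X" "c < length gs" for a c
  proof -
    have "foldl relu_layer (inp a) ls \<in> carrier_vec D"
      using ls(1) inp(1)[OF that(1)] by (rule relu_layers_carrier)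
    then show ?thesis unfolding ev[OF inp(1)[OF that(1)]] unfolding ks_def foldl_append
      using relu_layers_id[of _ D n] ls(3)[OF that] that assms(3) by (simp add: relu_def del: replicate.simps)
  qed
  ultimately show ?thesis by blast
qed

section \<open>Convolution layers\<close>

fun kern :: "nat \<Rightarrow> real \<times> real \<times> real \<times> real \<Rightarrow> nat \<Rightarrow> real" where
  "kern U (c1, c2, a1, a2) l =
     c1 * cos (2 * pi * real l * a1 / real (U + 1)) + c2 * sin (2 * pi * real l * a2 / real (U + 1))"

definition wsum :: "nat \<Rightarrow> (nat \<Rightarrow> real) \<Rightarrow> (nat \<Rightarrow> real) \<Rightarrow> nat \<Rightarrow> real" where
  "wsum U \<kappa> h s = (\<Sum>l | l \<le> U \<and> l \<le> s. \<kappa> l * h (s - l))"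

fun filter_bound :: "real \<Rightarrow> real \<times> real \<times> real \<times> real \<Rightarrow> bool" where
  "filter_bound B (c1, c2, a1, a2) \<longleftrightarrow> \<bar>c1\<bar> \<le> B \<and> \<bar>c2\<bar> \<le> B \<and> \<bar>a1\<bar> \<le> B \<and> \<bar>a2\<bar> \<le> B"

text \<open>\<open>Wg\<close> is a selection matrix: row \<open>k\<close> picks coordinate
  \<open>reg k\<close>. Hence one coordinate of the input can feed several channels with different
  kernels; the coordinates from \<open>n\<close> on are set to zero.\<close>

lemma conv_channels:
  assumes B: "1 \<le> B" and n: "n \<le> D"
    and reg: "\<And>k. k < n \<Longrightarrow> reg k < D" and p: "\<And>k. k < n \<Longrightarrow> filter_bound B (p k)"
  shows "\<exists>g\<in>conv_class U D B. \<forall>X. length (g X) = length X \<and>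
    (\<forall>s<length X. g X ! s \<in> carrier_vec D) \<and>
    ((\<forall>s<length X. X ! s \<in> carrier_vec D) \<longrightarrow>
      (\<forall>s<length X. \<forall>k<n. g X ! s $ k = wsum U (kern U (p k)) (\<lambda>s'. X ! s' $ reg k) s))"
proof -
  define Wg :: "real mat" where "Wg = mat D D (\<lambda>(k, c). of_bool (k < n \<and> c = reg k))"
  define prm where "prm f = vec D (\<lambda>k. if k < n then f (p k) else 0 :: real)" for f
  define c1 c2 a1 a2 where c12: "c1 = prm fst" "c2 = prm (fst \<circ> snd)" "a1 = prm (fst \<circ> snd \<circ> snd)"
    "a2 = prm (snd \<circ> snd \<circ> snd)"
  have car: "Wg \<in> carrier_mat D D" "c1 \<in> carrier_vec D" "c2 \<in> carrier_vec D"
    "a1 \<in> carrier_vec D" "a2 \<in> carrier_vec D"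
    by (auto simp: Wg_def c12 prm_def)
  have p': "\<bar>fst (p k)\<bar> \<le> B \<and> \<bar>fst (snd (p k))\<bar> \<le> B \<and> \<bar>fst (snd (snd (p k)))\<bar> \<le> B \<and> \<bar>snd (snd (snd (p k)))\<bar> \<le> B"
    if "k < n" for k using p[OF that] by (cases "p k") auto
  have bnd: "mat_inf_norm Wg \<le> B" "vec_inf_norm a1 \<le> B" "vec_inf_norm a2 \<le> B"
    "vec_inf_norm c1 \<le> B" "vec_inf_norm c2 \<le> B"
    using B p' by (auto simp: Wg_def c12 prm_def intro!: mat_inf_norm_le[of _ D D] vec_inf_norm_le[of _ D])
  define g where "g X = convolve (conv_filter U D c1 c2 a1 a2) (map (\<lambda>x. Wg *\<^sub>v x) X)" for X
  have "g \<in> conv_class U D B"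
    unfolding conv_class_def g_def using car bnd by blast
  moreover have "length (g X) = length X" for X by (simp add: g_def convolve_def)
  moreover have "g X ! s \<in> carrier_vec D" if "s < length X" for X s
    using that by (simp add: g_def convolve_def conv_filter_def)
  moreover have "g X ! s $ k = wsum U (kern U (p k)) (\<lambda>s'. X ! s' $ reg k) s"
    if X: "\<forall>s<length X. X ! s \<in> carrier_vec D" and s: "s < length X" and k: "k < n" for X s k
  proof -
    have kD: "k < D" using k n by simp
    have W: "(Wg *\<^sub>v x) $ k = x $ reg k" if "x \<in> carrier_vec D" for x
    proof -
      have "(Wg *\<^sub>v x) $ k = (\<Sum>c\<in>{0..<D}. of_bool (c = reg k) * x $ c)"
        using that kD k by (simp add: Wg_def scalar_prod_def)
      also have "\<dots> = (\<Sum>c\<in>{0..<D}. if c = reg k then x $ c else 0)" by (intro sum.cong) auto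
      also have "\<dots> = x $ reg k" using reg[OF k] by (simp add: sum.delta)
      finally show ?thesis .
    qed
    have F: "conv_filter U D c1 c2 a1 a2 $$ (k, l) = kern U (p k) l" if "l < U + 1" for l
      using that kD k by (cases "p k") (simp add: conv_filter_def c12 prm_def mult.assoc)
    have "g X ! s $ k = (\<Sum>l | l < U + 1 \<and> l \<le> s. conv_filter U D c1 c2 a1 a2 $$ (k, l) *
        (map (\<lambda>x. Wg *\<^sub>v x) X ! (s - l)) $ k)"
      using s kD by (simp add: g_def convolve_def conv_filter_def)
    also have "\<dots> = wsum U (kern U (p k)) (\<lambda>s'. X ! s' $ reg k) s"
      unfolding wsum_def by (rule sum.cong) (use s X F W in auto)
    finally show ?thesis .
  qed
  ultimately show ?thesis by blast
qed

text \<open>On one-hot tokens a matrix acts as a lookup table, whose column \<open>w\<close> is the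
  embedding of word \<open>w\<close>.\<close>

lemma emb_channels:
  assumes "0 \<le> B" "\<And>k w. \<bar>E k w\<bar> \<le> B"
  shows "\<exists>emb\<in>emb_class N D B. \<forall>ws. set ws \<subseteq> {..<N} \<longrightarrow>
    length (emb (map (unit_vec N) ws)) = length ws \<and>
    (\<forall>s<length ws. emb (map (unit_vec N) ws) ! s \<in> carrier_vec D \<and>
       (\<forall>k<D. emb (map (unit_vec N) ws) ! s $ k = E k (ws ! s)))"
proof -
  define E1 :: "real mat" where "E1 = mat D N (\<lambda>(k, w). E k w)"
  have "map (\<lambda>x. E1 *\<^sub>v x + 0\<^sub>v D) \<in> emb_class N D B"
    unfolding emb_class_def using assms
    by (intro CollectI exI[of _ E1] exI[of _ "0\<^sub>v D"])
       (auto simp: E1_def intro!: mat_inf_norm_le[of _ D N] vec_inf_norm_le[of _ D])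
  moreover have val: "(E1 *\<^sub>v unit_vec N w + 0\<^sub>v D) $ k = E k w" if "k < D" "w < N" for k w
  proof -
    have "(E1 *\<^sub>v unit_vec N w + 0\<^sub>v D) $ k = (\<Sum>c\<in>{0..<N}. E k c * (if c = w then 1 else 0))"
      using that by (simp add: E1_def scalar_prod_def unit_vec_def)
    also have "\<dots> = (\<Sum>c\<in>{0..<N}. if c = w then E k c else 0)" by (intro sum.cong) auto
    also have "\<dots> = E k w" using that by simp
    finally show ?thesis .
  qed
  moreover have car: "E1 *\<^sub>v x + 0\<^sub>v D \<in> carrier_vec D" for x by (rule carrier_vecI) (simp only: index_add_vec index_zero_vec)
  moreover have "map (\<lambda>x. E1 *\<^sub>v x + 0\<^sub>v D) (map (unit_vec N) ws) ! s = E1 *\<^sub>v unit_vec N (ws ! s) + 0\<^sub>v D"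
    if "s < length ws" for ws s using that by (simp only: nth_map length_map)
  moreover have "ws ! s < N" if "set ws \<subseteq> {..<N}" "s < length ws" for ws s
    using that nth_mem by blast
  ultimately show ?thesis
    by (intro bexI[of _ "map (\<lambda>x. E1 *\<^sub>v x + 0\<^sub>v D)"] allI impI conjI) (simp_all only: length_map)
qed

text \<open>Reduces one convolution followed by one network to a statement about programs. Functions
  live on pairs of an input and a position; \<open>chs\<close> lists the source and the kernel of
  each channel. The network has to be correct only on \<open>Z\<close>, which for the last layer
  contains just the final positions. Channels are nonnegative on \<open>Z\<close> so that they are
  legitimate registers.\<close>

lemma ssm_layer:
  fixes X :: "'a \<Rightarrow> real vec list"
  assumes B: "1 \<le> B" and D: "1 \<le> D"
    and X: "\<And>a. a \<in> S \<Longrightarrow> length (X a) = len a"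
      "\<And>a s. a \<in> S \<Longrightarrow> s < len a \<Longrightarrow> X a ! s \<in> carrier_vec D"
    and src: "\<And>h p. (h, p) \<in> set chs \<Longrightarrow>
      filter_bound B p \<and> (\<exists>r<D. \<forall>a\<in>S. \<forall>s<len a. X a ! s $ r = h (a, s))"
    and Z: "\<And>a s. (a, s) \<in> Z \<Longrightarrow> a \<in> S \<and> s < len a"
    and computes: "computes Z B ((\<lambda>(h, p) (a, s). wsum U (kern U p) (\<lambda>s'. h (a, s')) s) ` set chs) n H"
    and nonneg: "\<And>h p a s. (h, p) \<in> set chs \<Longrightarrow> (a, s) \<in> Z \<Longrightarrow>
      0 \<le> wsum U (kern U p) (\<lambda>s'. h (a, s')) s"
    and len: "length chs + n \<le> D"
  shows "\<exists>g\<in>conv_class U D B. \<exists>f\<in>fnn_class D D (D + 2) D ((D + 2) * (D * D + D)) B.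
    (\<forall>a\<in>S. length (map f (g (X a))) = len a \<and> (\<forall>s<len a. map f (g (X a)) ! s \<in> carrier_vec D)) \<and>
    (\<forall>h\<in>H. \<exists>r<D. \<forall>(a, s)\<in>Z. map f (g (X a)) ! s $ r = h (a, s))"
proof -
  define chan where "chan = (\<lambda>(h :: 'a \<times> nat \<Rightarrow> real, p) (a, s). wsum U (kern U p) (\<lambda>s'. h (a, s')) s)"
  define gs0 where "gs0 = map chan chs"
  have "\<forall>g\<in>chan ` set chs. agrees Z gs0 g" by (auto simp: agrees_def gs0_def)
  then obtain gs where gs: "slp Z B gs0 gs" "length gs \<le> length gs0 + n" "\<forall>h\<in>H. agrees Z gs h"
    using computes unfolding computes_def chan_def by blast
  have "\<forall>k. \<exists>r. k < length chs \<longrightarrow> r < D \<and> (\<forall>a\<in>S. \<forall>s<len a. X a ! s $ r = fst (chs ! k) (a, s))"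
    using src by (metis nth_mem surjective_pairing)
  then obtain reg where reg: "\<And>k. k < length chs \<Longrightarrow> reg k < D"
    "\<And>k a s. k < length chs \<Longrightarrow> a \<in> S \<Longrightarrow> s < len a \<Longrightarrow> X a ! s $ reg k = fst (chs ! k) (a, s)"
    by metis
  have "filter_bound B (snd (chs ! k))" if "k < length chs" for k
    using src[of "fst (chs ! k)" "snd (chs ! k)"] nth_mem[OF that] by simp
  then obtain g where g: "g \<in> conv_class U D B" "\<And>X. length (g X) = length X"
    "\<And>X s. s < length X \<Longrightarrow> g X ! s \<in> carrier_vec D"
    "\<And>X s k. \<lbrakk>\<forall>s<length X. X ! s \<in> carrier_vec D; s < length X; k < length chs\<rbrakk> \<Longrightarrow>
       g X ! s $ k = wsum U (kern U (snd (chs ! k))) (\<lambda>s'. X ! s' $ reg k) s"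
    using conv_channels[of B "length chs" D reg "\<lambda>k. snd (chs ! k)" U] B len reg(1) by force
  have val: "g (X a) ! s $ k = (gs0 ! k) (a, s)" if "a \<in> S" "s < len a" "k < length chs" for a s k
  proof -
    have "g (X a) ! s $ k = wsum U (kern U (snd (chs ! k))) (\<lambda>s'. X a ! s' $ reg k) s"
      by (rule g(4)) (use that X in auto)
    also have "\<dots> = wsum U (kern U (snd (chs ! k))) (\<lambda>s'. fst (chs ! k) (a, s')) s"
      unfolding wsum_def by (rule sum.cong) (use that reg(2) in auto)
    finally show ?thesis using that by (simp add: gs0_def chan_def split_beta)
  qed
  have "\<exists>f\<in>fnn_class D D (D + 2) D ((D + 2) * (D * D + D)) B.
    (\<forall>y\<in>carrier_vec D. f y \<in> carrier_vec D) \<and>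
    (\<forall>a\<in>Z. \<forall>c<length gs. f ((\<lambda>(a, s). g (X a) ! s) a) $ c = (gs ! c) a)"
  proof (rule slp_fnn[OF gs(1) B _ D])
    show "length gs \<le> D" using gs(2) len by (simp add: gs0_def)
    fix z assume "z \<in> Z"
    obtain a s where z: "z = (a, s)" by force
    have as: "a \<in> S" "s < len a" using Z[of a s] \<open>z \<in> Z\<close> z by auto
    show "(case z of (a, s) \<Rightarrow> g (X a) ! s) \<in> carrier_vec D"
      using g(3) X(1) as by (simp add: z)
    fix c assume "c < length gs0"
    then have c: "c < length chs" by (simp add: gs0_def)
    have "0 \<le> (gs0 ! c) z"
      using nonneg[of "fst (chs ! c)" "snd (chs ! c)" a s] \<open>z \<in> Z\<close> nth_mem[OF c] c
      by (simp add: z gs0_def chan_def split_beta)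
    then show "(case z of (a, s) \<Rightarrow> g (X a) ! s) $ c = (gs0 ! c) z \<and> 0 \<le> (gs0 ! c) z"
      using val[OF as c] by (simp add: z)
  qed
  then obtain f where f: "f \<in> fnn_class D D (D + 2) D ((D + 2) * (D * D + D)) B"
    "\<forall>y\<in>carrier_vec D. f y \<in> carrier_vec D"
    and f3: "\<forall>a\<in>Z. \<forall>c<length gs. f ((\<lambda>(a, s). g (X a) ! s) a) $ c = (gs ! c) a"
    by (elim bexE conjE) (rule that)
  have f3': "f (g (X a) ! s) $ c = (gs ! c) (a, s)" if "(a, s) \<in> Z" "c < length gs" for a s c
    using bspec[OF f3 that(1)] that(2) by simp
  have "\<exists>r<D. \<forall>(a, s)\<in>Z. map f (g (X a)) ! s $ r = h (a, s)" if hH: "h \<in> H" for h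
  proof -
    obtain g0 where "g0 \<in> set gs" and g0: "\<forall>a\<in>Z. g0 a = h a"
      using bspec[OF gs(3) hH] unfolding agrees_def by blast
    then obtain r where r0: "r < length gs" "gs ! r = g0" by (auto simp: in_set_conv_nth)
    then have r: "r < length gs" "\<forall>a\<in>Z. (gs ! r) a = h a" using g0 by auto
    have "r < D" using r gs(2) len by (simp add: gs0_def)
    moreover have "map f (g (X a)) ! s $ r = h (a, s)" if "(a, s) \<in> Z" for a s
      proof -
      have "s < length (g (X a))" using Z[OF that] g(2) X(1) by simp
      then show ?thesis using f3'[OF that r(1)] bspec[OF r(2) that] by (simp only: nth_map)
    qed
    ultimately show ?thesis by (intro exI[of _ r]) blast
  qed
  moreover have "\<forall>a\<in>S. length (map f (g (X a))) = len a \<and> (\<forall>s<len a. map f (g (X a)) ! s \<in> carrier_vec D)"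
    using g(2,3) f(2) X by simp
  ultimately show ?thesis using g(1) f(1) by blast
qed

section \<open>Telescoping kernels and binary digits\<close>

text \<open>A quarter of a cosine period: frequency 1/4 in a filter with \<open>U = V\<close>. Its
  first zero lies just outside the window.\<close>

definition ck :: "nat \<Rightarrow> nat \<Rightarrow> real" where
  "ck V l = cos (pi * real l / (2 * real (V + 1)))"

lemma ck_0 [simp]: "ck V 0 = 1"
  by (simp add: ck_def)

lemma ck_Suc_window: "ck V (Suc V) = 0"
proof -
  have "pi * real (Suc V) / (2 * real (V + 1)) = pi / 2" by (simp add: field_simps)
  then show ?thesis unfolding ck_def by (simp only: cos_pi_half)
qed

lemma ck_bounds: "l \<le> Suc V \<Longrightarrow> 0 \<le> ck V l \<and> ck V l \<le> 1"
proof -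
  assume "l \<le> Suc V"
  then have "pi * real l / (2 * real (V + 1)) \<le> pi * real (V + 1) / (2 * real (V + 1))"
    by (intro divide_right_mono mult_left_mono) auto
  also have "\<dots> = pi / 2" by (simp add: field_simps)
  finally have "pi * real l / (2 * real (V + 1)) \<le> pi / 2" .
  then have "0 \<le> ck V l" unfolding ck_def by (intro cos_ge_zero) (auto intro: order_trans[of _ 0])
  then show ?thesis by (simp add: ck_def)
qed

text \<open>Passing to the next position shifts the kernel by one. The oldest term, at distance
  \<open>V\<close>, then leaves the window, but its weight would have been
  \<open>ck V (V + 1) = 0\<close>, so nothing is lost.\<close>

lemma wsum_ck_Suc:
  "wsum V (ck V) z (Suc s) = z (Suc s) + wsum V (\<lambda>l. ck V (Suc l)) z s"
proof -
  let ?L = "{l. Suc l \<le> V \<and> l \<le> s}"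
  have fin: "finite ?L" "finite {l. l \<le> V \<and> l \<le> s}" by (auto intro: finite_subset[of _ "{..s}"])
  have "{l. l \<le> V \<and> l \<le> Suc s} = insert 0 (Suc ` ?L)"
    by (auto simp: image_iff) (metis Suc_le_D Suc_le_mono not0_implies_Suc)
  then have "wsum V (ck V) z (Suc s) = z (Suc s) + (\<Sum>l\<in>Suc ` ?L. ck V l * z (Suc s - l))"
    unfolding wsum_def using fin by simp
  also have "(\<Sum>l\<in>Suc ` ?L. ck V l * z (Suc s - l)) = (\<Sum>l\<in>?L. ck V (Suc l) * z (s - l))"
    by (simp add: sum.reindex)
  also have "\<dots> = (\<Sum>l | l \<le> V \<and> l \<le> s. ck V (Suc l) * z (s - l))"
  proof (rule sum.mono_neutral_left[OF fin(2)])
    show "\<forall>l\<in>{l. l \<le> V \<and> l \<le> s} - ?L. ck V (Suc l) * z (s - l) = 0"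
    proof
      fix l assume "l \<in> {l. l \<le> V \<and> l \<le> s} - ?L"
      then have "l = V" by auto
      then show "ck V (Suc l) * z (s - l) = 0" by (simp add: ck_Suc_window)
    qed
  qed auto
  finally show ?thesis by (simp add: wsum_def)
qed

section \<open>Window sums and summation by parts\<close>

lemma wsum_bounds:
  assumes "\<And>l. l \<le> V \<Longrightarrow> 0 \<le> \<kappa> l \<and> \<kappa> l \<le> 1" "\<And>s. 0 \<le> z s \<and> z s \<le> M"
  shows "0 \<le> wsum V \<kappa> z s \<and> wsum V \<kappa> z s \<le> real (V + 1) * M"
proof -
  have M: "0 \<le> M" using assms(2) order_trans by blast
  have "wsum V \<kappa> z s \<le> (\<Sum>l | l \<le> V \<and> l \<le> s. M)" unfolding wsum_def
  proof (rule sum_mono)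
    fix l assume l: "l \<in> {l. l \<le> V \<and> l \<le> s}"
    have "\<kappa> l * z (s - l) \<le> 1 * M" by (rule mult_mono) (use assms l in auto)
    then show "\<kappa> l * z (s - l) \<le> M" by simp
  qed
  also have "\<dots> = real (card {l. l \<le> V \<and> l \<le> s}) * M" by simp
  also have "\<dots> \<le> real (V + 1) * M"
  proof (rule mult_right_mono[OF _ M])
    have "card {l. l \<le> V \<and> l \<le> s} \<le> card {..V}" by (rule card_mono) auto
    then show "real (card {l. l \<le> V \<and> l \<le> s}) \<le> real (V + 1)" by simp
  qed
  finally show ?thesis using assms by (auto simp: wsum_def intro!: sum_nonneg)
qed

lemma wsum_window: "wsum V \<kappa> h t = (\<Sum>s = t - V..t. \<kappa> (t - s) * h s)"
  unfolding wsum_def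
  by (rule sum.reindex_bij_witness[of _ "\<lambda>s. t - s" "\<lambda>l. t - l"]) auto

text \<open>The window still contains COPY at \<open>p + 1\<close>, so it truncates only the prompt.
  The remaining positions are indexed by their distance \<open>j\<close> from COPY.\<close>

lemma wsum_split:
  assumes "t = p + 1 + i" "t - V \<le> p + 1"
  shows "wsum V \<kappa> h t = (\<Sum>s = t - V..p. \<kappa> (t - s) * h s) + (\<Sum>j = 0..i. \<kappa> (i - j) * h (p + 1 + j))"
proof -
  have "(\<Sum>s = t - V..t. \<kappa> (t - s) * h s) =
      (\<Sum>s = t - V..p. \<kappa> (t - s) * h s) + (\<Sum>s = p + 1..t. \<kappa> (t - s) * h s)"
  proof -
    have "{t - V..t} = {t - V..p} \<union> {p + 1..t}" using assms by auto
    then show ?thesis by (simp only:) (rule sum.union_disjoint, auto)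
  qed
  also have "(\<Sum>s = p + 1..t. \<kappa> (t - s) * h s) = (\<Sum>j = 0..i. \<kappa> (i - j) * h (p + 1 + j))"
    by (rule sum.reindex_bij_witness[of _ "\<lambda>j. p + 1 + j" "\<lambda>s. s - (p + 1)"]) (auto simp: assms(1) add_ac)
  finally show ?thesis by (simp add: wsum_window)
qed

text \<open>Each new term \<open>f (Suc n) * A (Suc n)\<close> contributes
  \<open>f (Suc n) * z (Suc n)\<close> and cancels the previous right boundary term
  \<open>f (Suc n) * B n\<close>.\<close>

lemma telescope:
  fixes f A B z :: "nat \<Rightarrow> real"
  assumes "\<And>s. m \<le> s \<Longrightarrow> s < n \<Longrightarrow> A (Suc s) = z (Suc s) + B s" "m \<le> n"
  shows "(\<Sum>s = m..n. f s * A s) - (\<Sum>s = m..n. f (Suc s) * B s)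
    = f m * A m + (\<Sum>s = Suc m..n. f s * z s) - f (Suc n) * B n"
  using assms(2,1)
proof (induction n rule: dec_induct)
  case (step n)
  then show ?case by (simp add: algebra_simps)
qed simp

text \<open>The exponent \<open>hi nb k q\<close> decreases by \<open>2 ^ (k + 1)\<close> when the binary prefix of \<open>q\<close> above bit \<open>k\<close>
  grows by one. So \<open>\<eta> ^ hi nb k q\<close> with small \<open>\<eta>\<close> is much larger on later blocks.\<close>

definition hi :: "nat \<Rightarrow> nat \<Rightarrow> nat \<Rightarrow> nat" where
  "hi nb k q = (\<Sum>b<nb. if \<not> bit q b then (if k < b then 2 ^ b else 0) else 0)"

text \<open>The nested conditionals have the shape of the exponent in \<open>computes_pow\<close>,
  which can thus produce powers with exponent \<open>c * (q mod 2 ^ k)\<close>.\<close>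

lemma sum_low_bits: "k \<le> nb \<Longrightarrow>
  (\<Sum>b<nb. if bit q b then (if b < k then c * 2 ^ b else 0) else 0) = c * (q mod 2 ^ k)" for q :: nat
proof (induction nb rule: dec_induct)
  case base
  show ?case
  proof (induction k)
    case (Suc k)
    have "(\<Sum>b<Suc k. if bit q b then (if b < Suc k then c * 2 ^ b else 0) else 0)
      = (\<Sum>b<k. if bit q b then (if b < k then c * 2 ^ b else 0) else 0) + (if bit q k then c * 2 ^ k else 0)"
      by (auto intro!: sum.cong)
    then show ?case using Suc by (auto simp: mod_2_pow_Suc algebra_simps simp del: power_Suc)
  qed simp
qed simp

text \<open>\<open>hi\<close> adds up the zero digits above \<open>k\<close>; with the one digits
  above \<open>k\<close> this gives all powers from \<open>2 ^ Suc k\<close> to below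
  \<open>2 ^ nb\<close>. The additive form avoids truncated subtraction.\<close>

lemma hi_eq:
  assumes "k < nb" "q < 2 ^ nb"
  shows "hi nb k q + 2 ^ Suc k * (q div 2 ^ Suc k) + 2 ^ Suc k = 2 ^ nb"
proof -
  have "hi nb k q + (\<Sum>b<nb. if bit q b then (if k < b then 2 ^ b else 0) else 0)
      = (\<Sum>b<nb. if k < b then 2 ^ b else 0)"
    unfolding hi_def sum.distrib[symmetric] by (intro sum.cong) auto
  moreover have "(\<Sum>b<nb. if bit q b then (if k < b then 2 ^ b else 0) else 0) + q mod 2 ^ Suc k = q"
  proof -
    have "(\<Sum>b<nb. if bit q b then (if k < b then 2 ^ b else 0) else 0)
        + (\<Sum>b<nb. if bit q b then (if b < Suc k then 1 * 2 ^ b else 0) else 0)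
        = (\<Sum>b<nb. if bit q b then (if b < nb then 1 * 2 ^ b else 0 :: nat) else 0)"
      unfolding sum.distrib[symmetric] by (intro sum.cong) auto
    then show ?thesis using assms sum_low_bits[of "Suc k" nb q 1] sum_low_bits[of nb nb q 1] by simp
  qed
  moreover have "(\<Sum>b<nb. if k < b then 2 ^ b else 0) + 2 ^ Suc k = (2 ^ nb :: nat)"
    using assms(1)
  proof (induction nb)
    case (Suc nb)
    show ?case
    proof (cases "k < nb")
      case True
      then show ?thesis using Suc.IH by simp
    next
      case False
      then have "k = nb" using Suc.prems by simp
      moreover have "(\<Sum>b<nb. if nb < b then 2 ^ b else 0) = (0::nat)" by (rule sum.neutral) auto
      ultimately show ?thesis by simp
    qed
  qed simp
  moreover have "2 ^ Suc k * (q div 2 ^ Suc k) + q mod 2 ^ Suc k = q" by simp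
  ultimately show ?thesis by linarith
qed

text \<open>If bit \<open>k\<close> is set, then \<open>hi nb k q + q\<close> depends on
  \<open>q\<close> only through \<open>q mod 2 ^ k\<close>. This matches the exponents of the prompt
  and of the generated words.\<close>

lemma hi_bit:
  assumes "k < nb" "q < 2 ^ nb" "bit q k"
  shows "hi nb k q + q + 2 ^ k = 2 ^ nb + q mod 2 ^ k"
proof -
  have "q mod 2 ^ Suc k = 2 ^ k + q mod 2 ^ k" using assms(3) by (simp add: mod_2_pow_Suc del: power_Suc)
  moreover have "2 ^ Suc k * (q div 2 ^ Suc k) + q mod 2 ^ Suc k = q" by simp
  ultimately show ?thesis using hi_eq[OF assms(1,2)] by simp
qed

text \<open>For \<open>e < n\<close> this says that \<open>k\<close> is the highest bit in which \<open>e\<close> and \<open>n\<close> differ.\<close>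

definition splits :: "nat \<Rightarrow> nat \<Rightarrow> nat \<Rightarrow> bool" where
  "splits k e n \<longleftrightarrow> e div 2 ^ Suc k = n div 2 ^ Suc k \<and> bit n k \<and> \<not> bit e k"

text \<open>Take the least \<open>m\<close> for which shifting by \<open>m\<close> digits makes
  \<open>e\<close> and \<open>n\<close> equal. It is positive, and at digit \<open>k = m - 1\<close>
  the order of \<open>e\<close> and \<open>n\<close> forces 0 in \<open>e\<close> and 1 in
  \<open>n\<close>.\<close>

lemma splits_ex:
  assumes "e < n" "n < 2 ^ nb"
  shows "\<exists>k<nb. splits k e n"
proof -
  define m where "m = (LEAST m. e div 2 ^ m = n div 2 ^ m)"
  have nb: "e div 2 ^ nb = n div 2 ^ nb" using assms by simp
  have m: "e div 2 ^ m = n div 2 ^ m" unfolding m_def by (rule LeastI[of _ nb]) (rule nb)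
  have "m \<le> nb" unfolding m_def by (rule Least_le) (rule nb)
  moreover have "m \<noteq> 0" using m assms by (auto intro: gr0I)
  ultimately obtain k where k: "m = Suc k" "k < nb" by (cases m) auto
  have ne: "e div 2 ^ k \<noteq> n div 2 ^ k"
    using not_less_Least[of k "\<lambda>m. e div 2 ^ m = n div 2 ^ m"] k m_def by auto
  have le: "e div 2 ^ k \<le> n div 2 ^ k" using assms by (simp add: div_le_mono)
  have half: "(e div 2 ^ k) div 2 = (n div 2 ^ k) div 2"
    using m k by (simp add: div_mult2_eq[symmetric] mult.commute)
  have "x div 2 = y div 2 \<Longrightarrow> x \<noteq> y \<Longrightarrow> x \<le> y \<Longrightarrow> odd y \<and> even x" for x y :: nat by presburger
  from this[OF half ne le] have "odd (n div 2 ^ k) \<and> even (e div 2 ^ k)" .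
  then have "splits k e n" using m k by (simp add: splits_def bit_iff_odd)
  then show ?thesis using k by blast
qed

text \<open>All digits above a splitting digit agree, so no second splitting digit can lie above
  it.\<close>

lemma splits_unique:
  assumes "splits k e n" "splits k' e n" shows "k = k'"
proof -
  have "bit q b = bit (q div 2 ^ Suc k) (b - Suc k)" if "k < b" for q b k :: nat
  proof -
    have "2 ^ b = 2 ^ Suc k * (2 :: nat) ^ (b - Suc k)" using that by (metis Suc_leI le_add_diff_inverse power_add)
    then show ?thesis by (simp add: bit_iff_odd div_mult2_eq)
  qed
  then have "\<not> splits b e n" if "splits k e n" "k < b" for k b
    using that unfolding splits_def by metis
  then show ?thesis using assms by (metis linorder_neqE_nat)
qed

lemma splits_between:
  assumes "splits k e n" "e \<le> q" "q \<le> n"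
  shows "q div 2 ^ Suc k = n div 2 ^ Suc k"
  using assms div_le_mono[of e q "2 ^ Suc k"] div_le_mono[of q n "2 ^ Suc k"] by (auto simp: splits_def)

text \<open>In the block of \<open>e\<close>, bit \<open>k\<close> is clear at \<open>e\<close>, so
  the positions of that block with bit \<open>k\<close> set come after \<open>e\<close>. A position
  up to \<open>e\<close> with bit \<open>k\<close> set thus lies in an earlier block.\<close>

lemma splits_below:
  assumes "splits k e n" "q \<le> e" "bit q k"
  shows "q div 2 ^ Suc k < n div 2 ^ Suc k"
proof -
  have "q div 2 ^ Suc k \<le> e div 2 ^ Suc k" using assms(2) by (rule div_le_mono)
  moreover have "q div 2 ^ Suc k \<noteq> e div 2 ^ Suc k"
  proof
    assume eq: "q div 2 ^ Suc k = e div 2 ^ Suc k"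
    have "q mod 2 ^ Suc k \<ge> 2 ^ k" using assms(3) by (simp add: mod_2_pow_Suc del: power_Suc)
    moreover have "e mod 2 ^ Suc k < 2 ^ k" using assms(1) by (simp add: mod_2_pow_Suc splits_def del: power_Suc)
    ultimately show False
      using assms(2) div_mult_mod_eq[of q "2 ^ Suc k", unfolded eq] div_mult_mod_eq[of e "2 ^ Suc k"] by linarith
  qed
  ultimately show ?thesis using assms(1) by (simp add: splits_def)
qed

section \<open>Decoding from exact window sums\<close>

text \<open>Inside a block with bit \<open>k\<close> set this is proportional to
  \<open>\<eta> ^ q\<close>, like the prompt weight; \<open>hi\<close> makes later blocks dominate
  earlier ones.\<close>

definition gw :: "nat \<Rightarrow> real \<Rightarrow> nat \<Rightarrow> nat \<Rightarrow> real" where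
  "gw nb \<eta> k q = \<eta> ^ (q mod 2 ^ k + hi nb k q)"

text \<open>The values that the first network emits at position \<open>s\<close>, where COPY is at position \<open>p + 1\<close>:
  \<open>P\<close> for the prompt, \<open>Q\<close> for the generated words, each with a positive part (\<open>p\<close>, from \<open>A\<close>) and a
  negative part (\<open>m\<close>, from \<open>B\<close>) of the summation by parts; \<open>W\<close> for the boundary term at the right
  end; \<open>F\<close> for the boundary term at the left end. The clock of a generated word is \<open>s - p - 1\<close>.\<close>

definition emPp :: "nat \<Rightarrow> real \<Rightarrow> nat \<Rightarrow> (nat \<Rightarrow> real) \<Rightarrow> nat \<Rightarrow> real" where
  "emPp p \<eta> k A s = (if s \<le> p \<and> bit s k then \<eta> ^ s * A s else 0)"
definition emPm :: "nat \<Rightarrow> real \<Rightarrow> nat \<Rightarrow> (nat \<Rightarrow> real) \<Rightarrow> nat \<Rightarrow> real" where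
  "emPm p \<eta> k B s = (if s \<le> p \<and> bit (Suc s) k then \<eta> ^ Suc s * B s else 0)"
definition emQp :: "nat \<Rightarrow> nat \<Rightarrow> real \<Rightarrow> nat \<Rightarrow> (nat \<Rightarrow> real) \<Rightarrow> nat \<Rightarrow> real" where
  "emQp nb p \<eta> k A s = (if p < s \<and> bit (s - p - 1) k then gw nb \<eta> k (s - p - 1) * A s else 0)"
definition emQm :: "nat \<Rightarrow> nat \<Rightarrow> real \<Rightarrow> nat \<Rightarrow> (nat \<Rightarrow> real) \<Rightarrow> nat \<Rightarrow> real" where
  "emQm nb p \<eta> k B s = (if p < s \<and> bit (s - p) k then gw nb \<eta> k (s - p) * B s else 0)"
definition emW :: "nat \<Rightarrow> nat \<Rightarrow> real \<Rightarrow> (nat \<Rightarrow> real) \<Rightarrow> nat \<Rightarrow> real" where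
  "emW nb p \<eta> B s = (if p < s then \<eta> ^ (2 ^ nb - 1 - (s - p)) * B s else 0)"
definition emFp :: "nat \<Rightarrow> (nat \<Rightarrow> real) \<Rightarrow> nat \<Rightarrow> real" where
  "emFp p B s = (if p < s then B s else 0)"
definition emFm :: "nat \<Rightarrow> (nat \<Rightarrow> real) \<Rightarrow> nat \<Rightarrow> real" where
  "emFm p A s = (if Suc p < s then A s else 0)"

text \<open>\<open>z s\<close> is the number encoding the word at position \<open>s\<close>, with 0
  for BOS and COPY; \<open>p\<close> is the prompt length and \<open>i\<close> the number of words
  already copied. The case \<open>j = 0\<close> of the copying assumption says that COPY has value
  0. The bound on \<eta> keeps the total decoding error below 1/2.\<close>

locale copy_seq =
  fixes V p i nb :: nat and N \<eta> :: real and z :: "nat \<Rightarrow> real"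
  assumes p: "i < p" "p \<le> V"
    and z: "\<And>s. 0 \<le> z s \<and> z s \<le> N" "z 0 = 0" "\<And>j. j \<le> i \<Longrightarrow> z (p + 1 + j) = z j"
    and N: "1 \<le> N"
    and nb: "V + 2 \<le> 2 ^ nb"
    and \<eta>: "0 < \<eta>" "\<eta> * (12 * real (V + 1) ^ 2 * N) < 1"
begin

definition "A = wsum V (ck V) z"
definition "B = wsum V (\<lambda>l. ck V (Suc l)) z"
definition "t = p + 1 + i"
text \<open>The subtraction is truncated: \<open>E = 0\<close> as long as nothing has left the
  window. \<open>E = I\<close> happens exactly when \<open>p = V\<close>.\<close>

definition "E = t - V"
definition "I = Suc i"
definition "E' = E - of_bool (E = I)"  \<comment> \<open>so that \<open>E' < I\<close> always holds\<close>

abbreviation one_ker :: "nat \<Rightarrow> real" where "one_ker \<equiv> \<lambda>_. 1"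

lemma A_Suc: "A (Suc s) = z (Suc s) + B s"
  unfolding A_def B_def by (rule wsum_ck_Suc)

lemma AB_bounds: "0 \<le> A s \<and> A s \<le> real (V + 1) * N" "0 \<le> B s \<and> B s \<le> real (V + 1) * N"
proof -
  show "0 \<le> A s \<and> A s \<le> real (V + 1) * N"
    unfolding A_def by (rule wsum_bounds) (use z(1) ck_bounds in auto)
  show "0 \<le> B s \<and> B s \<le> real (V + 1) * N"
    unfolding B_def by (rule wsum_bounds) (use z(1) ck_bounds in auto)
qed

lemma E_le: "E \<le> I" "I \<le> p"
  using p by (auto simp: E_def t_def I_def)

lemma E'_less: "E' < I" "E' \<le> E" "E < I \<Longrightarrow> E' = E"
  using E_le by (auto simp: E'_def I_def)

lemma I_less: "I < 2 ^ nb"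
  using p nb by (simp add: I_def)

lemma \<eta>1: "\<eta> \<le> 1" "\<eta> ^ n \<le> 1"
proof -
  have "1 * 1 \<le> real (V + 1) ^ 2 * N" using N by (intro mult_mono one_le_power) auto
  then have "1 \<le> 12 * real (V + 1) ^ 2 * N" by simp
  then have "\<eta> * 1 \<le> \<eta> * (12 * real (V + 1) ^ 2 * N)" using \<eta>(1) by (intro mult_left_mono) auto
  then show "\<eta> \<le> 1" using \<eta>(2) by simp
  then show "\<eta> ^ n \<le> 1" using \<eta>(1) by (simp add: power_le_one)
qed

lemma split_window:
  "wsum V \<kappa> h t = (\<Sum>s = E..p. \<kappa> (t - s) * h s) + (\<Sum>j = 0..i. \<kappa> (i - j) * h (p + 1 + j))"
  unfolding E_def by (rule wsum_split) (use E_le in \<open>auto simp: t_def E_def\<close>)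

text \<open>The left boundary term \<open>f k E * A E\<close> remains because \<open>A E\<close>
  still contains words from before the window at \<open>t\<close>.\<close>

lemma sum_P:
  defines "f \<equiv> \<lambda>k s. if bit s k then \<eta> ^ s else 0"
  shows "wsum V one_ker (emPp p \<eta> k A) t - wsum V one_ker (emPm p \<eta> k B) t
    = f k E * A E + (\<Sum>s = Suc E..p. f k s * z s) - f k (Suc p) * B p"
proof -
  have "wsum V one_ker (emPp p \<eta> k A) t = (\<Sum>s = E..p. f k s * A s)"
    unfolding split_window by (simp add: emPp_def f_def) (intro sum.cong, auto)
  moreover have "wsum V one_ker (emPm p \<eta> k B) t = (\<Sum>s = E..p. f k (Suc s) * B s)"
    unfolding split_window by (simp add: emPm_def f_def) (intro sum.cong, auto)
  moreover have "E \<le> p" using E_le by simp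
  ultimately show ?thesis using telescope[of E p A z B "f k"] A_Suc by simp
qed

text \<open>The clock starts with 0 at COPY, and 0 has no digit set, so there is no left boundary
  term. Only the one at the right end, with \<open>B t\<close>, remains.\<close>

lemma sum_Q:
  defines "f \<equiv> \<lambda>k j. if bit j k then gw nb \<eta> k j else 0"
  shows "wsum V one_ker (emQp nb p \<eta> k A) t - wsum V one_ker (emQm nb p \<eta> k B) t
    = (\<Sum>j = Suc 0..i. f k j * z j) - f k I * B t"
proof -
  have "wsum V one_ker (emQp nb p \<eta> k A) t = (\<Sum>j = 0..i. f k j * A (p + 1 + j))"
    unfolding split_window by (simp add: emQp_def f_def) (intro sum.cong, auto)
  moreover have "wsum V one_ker (emQm nb p \<eta> k B) t = (\<Sum>j = 0..i. f k (Suc j) * B (p + 1 + j))"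
    unfolding split_window by (simp add: emQm_def f_def) (intro sum.cong, auto)
  moreover have "A (p + 1 + Suc j) = z (Suc j) + B (p + 1 + j)" if "j < i" for j
    using A_Suc[of "p + 1 + j"] z(3)[of "Suc j"] that by simp
  ultimately show ?thesis
    using telescope[of 0 i "\<lambda>j. A (p + 1 + j)" z "\<lambda>j. B (p + 1 + j)" "f k"]
    by (simp add: f_def t_def I_def)
qed

lemma sum_W:
  "wsum V one_ker (emW nb p \<eta> B) t = (\<Sum>j = 0..i. \<eta> ^ (2 ^ nb - 1 - Suc j) * B (p + 1 + j))"
  unfolding split_window by (simp add: emW_def)

text \<open>Here the kernel itself provides the coefficients of the summation by parts, with the
  roles of \<open>A\<close> and \<open>B\<close> exchanged. Omitting COPY from the channel of
  \<open>A\<close> removes the left boundary term. The generated words repeat the prompt, so the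
  remaining sum is \<open>B i\<close>, the unwanted part of \<open>A I = z I + B i\<close> when
  \<open>E = I\<close>.\<close>

lemma sum_F:
  "wsum V (ck V) (emFp p B) t - wsum V (\<lambda>l. ck V (Suc l)) (emFm p A) t = B t - B i"
proof -
  let ?f = "\<lambda>j. ck V (Suc i - j)"
  have "wsum V (ck V) (emFp p B) t = (\<Sum>j = 0..i. ?f (Suc j) * B (p + 1 + j))"
    unfolding split_window by (simp add: emFp_def)
  moreover have "wsum V (\<lambda>l. ck V (Suc l)) (emFm p A) t = (\<Sum>j = 0..i. if j = 0 then 0 else ?f j * A (p + 1 + j))"
    unfolding split_window by (simp add: emFm_def) (intro sum.cong, auto simp: Suc_diff_le)
  moreover have "(\<Sum>j = 0..i. ?f j * A (p + 1 + j)) =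
      ?f 0 * A (p + 1) + (\<Sum>j = 0..i. if j = 0 then 0 else ?f j * A (p + 1 + j))"
    by (simp add: sum.atLeast_Suc_atMost)
  moreover have "A (p + 1 + Suc j) = z (Suc j) + B (p + 1 + j)" if "j < i" for j
    using A_Suc[of "p + 1 + j"] z(3)[of "Suc j"] that by simp
  then have "(\<Sum>j = 0..i. ?f j * A (p + 1 + j)) - (\<Sum>j = 0..i. ?f (Suc j) * B (p + 1 + j))
      = ?f 0 * A (p + 1) + (\<Sum>j = Suc 0..i. ?f j * z j) - ck V 0 * B t"
    using telescope[of 0 i "\<lambda>j. A (p + 1 + j)" z "\<lambda>j. B (p + 1 + j)" ?f] by (simp add: t_def)
  moreover have "B i = (\<Sum>j = Suc 0..i. ?f j * z j)"
  proof -
    have "B i = (\<Sum>s = 0..i. ck V (Suc (i - s)) * z s)"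
      unfolding B_def wsum_window using p by simp
    also have "\<dots> = (\<Sum>s = 0..i. ?f s * z s)" by (intro sum.cong) (auto simp: Suc_diff_le)
    also have "\<dots> = (\<Sum>j = Suc 0..i. ?f j * z j)" by (simp add: sum.atLeast_Suc_atMost z(2))
    finally show ?thesis .
  qed
  ultimately show ?thesis by simp
qed

section \<open>Scales and error bounds for a fixed splitting digit\<close>

context
  fixes k assumes k: "k < nb" "splits k E' I"
begin

text \<open>\<open>unit\<close> is the factor with which the wanted word appears in the decoded
  number. \<open>\<kappa>w\<close> and \<open>\<mu>w\<close> bring the channels of the generated
  words and of the right boundary term to this scale.\<close>

definition "unit = \<eta> ^ (2 * hi nb k I + I)"
definition "\<kappa>w = \<eta> ^ (2 ^ nb - 2 ^ k)"
definition "\<mu>w = \<eta> ^ (2 * (I mod 2 ^ k) + (2 ^ nb - 2 ^ Suc k + 1))"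

lemma bit_I: "bit I k" using k by (simp add: splits_def)

lemma two_k: "2 ^ Suc k \<le> (2 ^ nb :: nat)" "2 ^ k \<le> (2 ^ nb :: nat)"
  using k(1) by (auto intro: power_increasing simp del: power_Suc)

text \<open>One of the two copies of \<open>hi\<close> turns the exponent \<open>j\<close> into a
  constant plus \<open>j mod 2 ^ k\<close>, by \<open>hi_bit\<close>; the other one is the
  \<open>hi\<close> inside \<open>gw\<close>, which is constant on the block.\<close>

lemma same_block:
  assumes "E' \<le> j" "j \<le> I" "bit j k"
  shows "\<eta> ^ (2 * hi nb k I) * \<eta> ^ j = \<kappa>w * gw nb \<eta> k j"
proof -
  have j: "j < 2 ^ nb" using assms I_less by simp
  have "hi nb k j = hi nb k I"
    using hi_eq[OF k(1) j] hi_eq[OF k(1) I_less] splits_between[OF k(2) assms(1,2)] by simp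
  then have "2 * hi nb k I + j = (2 ^ nb - 2 ^ k) + (j mod 2 ^ k + hi nb k j)"
    using hi_bit[OF k(1) j assms(3)] two_k by linarith
  then show ?thesis unfolding \<kappa>w_def gw_def by (simp flip: power_add)
qed

lemma unit_gw: "\<kappa>w * gw nb \<eta> k I = unit" "unit = \<eta> ^ (2 * hi nb k I) * \<eta> ^ I"
  using same_block[of I] bit_I E'_less by (auto simp: unit_def power_add)

lemma unit_pos: "0 < unit" using \<eta> by (simp add: unit_def)

text \<open>Moving to an earlier block raises \<open>hi\<close> by at least
  \<open>2 ^ Suc k\<close>, more than the low digits of \<open>I\<close> can compensate, so at least
  one factor \<eta> is gained.\<close>

lemma earlier_block:
  assumes "j \<le> E'" "bit j k"
  shows "\<kappa>w * gw nb \<eta> k j \<le> unit * \<eta>"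
proof -
  have j: "j < 2 ^ nb" using assms I_less E'_less by simp
  have "Suc (j div 2 ^ Suc k) \<le> I div 2 ^ Suc k" using splits_below[OF k(2) assms] by simp
  then have "2 ^ Suc k * Suc (j div 2 ^ Suc k) \<le> 2 ^ Suc k * (I div 2 ^ Suc k)" by (rule mult_le_mono2)
  then have "hi nb k I + 2 ^ Suc k \<le> hi nb k j"
    using hi_eq[OF k(1) j] hi_eq[OF k(1) I_less] by simp
  moreover have "I mod 2 ^ k < 2 ^ k" by simp
  ultimately have "(I mod 2 ^ k + hi nb k I) + 1 \<le> j mod 2 ^ k + hi nb k j"
    unfolding power_Suc by linarith
  then have "gw nb \<eta> k j \<le> \<eta> ^ ((I mod 2 ^ k + hi nb k I) + 1)"
    unfolding gw_def using \<eta> \<eta>1 by (intro power_decreasing) auto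
  then have "gw nb \<eta> k j \<le> gw nb \<eta> k I * \<eta>" by (simp add: gw_def mult.commute)
  then have "\<kappa>w * gw nb \<eta> k j \<le> \<kappa>w * (gw nb \<eta> k I * \<eta>)"
    using \<eta> by (intro mult_left_mono) (auto simp: \<kappa>w_def)
  then show ?thesis using unit_gw(1) by (simp only: mult.assoc[symmetric])
qed

lemma later_pos:
  assumes "I < s"
  shows "\<eta> ^ (2 * hi nb k I) * \<eta> ^ s \<le> unit * \<eta>"
proof -
  have "\<eta> ^ s \<le> \<eta> ^ Suc I" using assms \<eta> \<eta>1 by (intro power_decreasing) auto
  then have "\<eta> ^ (2 * hi nb k I) * \<eta> ^ s \<le> \<eta> ^ (2 * hi nb k I) * \<eta> ^ Suc I"
    using \<eta> by (intro mult_left_mono) auto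
  then show ?thesis using unit_gw by (simp add: mult_ac)
qed

text \<open>Twice \<open>hi_bit\<close> at \<open>I\<close> gives the exponent. At
  \<open>j = i\<close> the factor is exactly \<open>unit\<close>; earlier \<open>j\<close> carry
  additional factors \<eta>.\<close>

lemma growth:
  assumes "j \<le> i"
  shows "\<mu>w * \<eta> ^ (2 ^ nb - 1 - Suc j) = unit * \<eta> ^ (i - j)"
proof -
  have "Suc j < 2 ^ nb" using assms I_less by (simp add: I_def)
  then have "2 * (I mod 2 ^ k) + (2 ^ nb - 2 ^ Suc k + 1) + (2 ^ nb - 1 - Suc j)
      = 2 * hi nb k I + I + (i - j)"
    using hi_bit[OF k(1) I_less bit_I] two_k assms by (simp add: I_def)
  then show ?thesis unfolding \<mu>w_def unit_def by (simp only: power_add[symmetric])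
qed

text \<open>Registers are nonnegative, so the decoded number is a difference of two registers. The
  term with \<open>emW\<close> counts twice if \<open>E = I\<close>, because then both the generated
  words and the left boundary correction contribute \<open>B t\<close>.\<close>

definition "Rpos = \<eta> ^ (2 * hi nb k I) * wsum V one_ker (emPp p \<eta> k A) t
  + \<kappa>w * wsum V one_ker (emQm nb p \<eta> k B) t
  + of_bool (E = I) * (unit * wsum V (ck V) (emFp p B) t)"

definition "Rneg = \<eta> ^ (2 * hi nb k I) * wsum V one_ker (emPm p \<eta> k B) t
  + \<kappa>w * wsum V one_ker (emQp nb p \<eta> k A) t
  + (1 + of_bool (E = I)) * (\<mu>w * wsum V one_ker (emW nb p \<eta> B) t)
  + of_bool (E = I) * (unit * wsum V (\<lambda>l. ck V (Suc l)) (emFm p A) t)"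

text \<open>The error consists of the prompt words after \<open>I\<close> and of the right boundary
  term, all smaller than \<open>unit\<close> by a factor \<eta>. The words strictly between
  \<open>E'\<close> and \<open>I\<close> remain as a sum to be cancelled by the generated
  words.\<close>

lemma P_part:
  "\<exists>\<delta>. \<eta> ^ (2 * hi nb k I) * (wsum V one_ker (emPp p \<eta> k A) t - wsum V one_ker (emPm p \<eta> k B) t)
     = unit * (z I + of_bool (E = I) * B i + \<delta>)
       + (\<Sum>s = Suc E'..i. \<kappa>w * (if bit s k then gw nb \<eta> k s else 0) * z s)
   \<and> \<bar>\<delta>\<bar> \<le> 2 * (real (V + 1) * N * \<eta>)"
proof -
  let ?f = "\<lambda>s. if bit s k then \<eta> ^ s else 0" and ?l = "\<eta> ^ (2 * hi nb k I)"
  define \<delta>1 where "\<delta>1 = (\<Sum>s = Suc I..p. ?l * ?f s * z s)"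
  define \<delta>2 where "\<delta>2 = ?l * ?f (Suc p) * B p"
  have l: "0 \<le> ?l" "0 \<le> ?f s" for s using \<eta> by auto
  have le: "?l * ?f s \<le> unit * \<eta>" if "I < s" for s
    using later_pos[OF that] unit_pos \<eta> by auto
  have u\<eta>: "0 \<le> unit * \<eta>" using unit_pos \<eta> by simp
  then have uN: "0 \<le> unit * \<eta> * N" using N by simp
  have d1: "0 \<le> \<delta>1" "\<delta>1 \<le> unit * (real (V + 1) * N * \<eta>)"
  proof -
    show "0 \<le> \<delta>1" unfolding \<delta>1_def using l z(1) by (intro sum_nonneg mult_nonneg_nonneg) auto
    have "\<delta>1 \<le> (\<Sum>s = Suc I..p. unit * \<eta> * N)"
      unfolding \<delta>1_def
    proof (intro sum_mono)
      fix s assume "s \<in> {Suc I..p}"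
      then show "?l * ?f s * z s \<le> unit * \<eta> * N"
        by (intro mult_mono le) (use z(1) u\<eta> in auto)
    qed
    also have "\<dots> = real (p - I) * (unit * \<eta> * N)" by simp
    also have "\<dots> \<le> real (V + 1) * (unit * \<eta> * N)" using p uN by (intro mult_right_mono) auto
    finally show "\<delta>1 \<le> unit * (real (V + 1) * N * \<eta>)" by (simp add: mult_ac)
  qed
  have d2: "0 \<le> \<delta>2" "\<delta>2 \<le> unit * (real (V + 1) * N * \<eta>)"
  proof -
    show "0 \<le> \<delta>2" unfolding \<delta>2_def using l AB_bounds by (intro mult_nonneg_nonneg) auto
    have "\<delta>2 \<le> (unit * \<eta>) * (real (V + 1) * N)"
      unfolding \<delta>2_def
    proof (rule mult_mono[OF le _ u\<eta>])
      show "I < Suc p" using E_le by simp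
    qed (use AB_bounds in auto)
    then show "\<delta>2 \<le> unit * (real (V + 1) * N * \<eta>)" by (simp add: mult_ac)
  qed
  \<comment> \<open>If \<open>E = I\<close>, the boundary term supplies the wanted word through
    \<open>A I = z I + B i\<close>. Otherwise bit \<open>k\<close> of \<open>E\<close> is clear and
    the boundary term is zero.\<close>
  have "?f E * A E + (\<Sum>s = Suc E..p. ?f s * z s)
      = of_bool (E = I) * (\<eta> ^ I * B i) + (\<Sum>s = Suc E'..p. ?f s * z s)"
  proof (cases "E = I")
    case True
    then have "E' = i" "E = Suc i" by (auto simp: E'_def I_def)
    moreover have "(\<Sum>s = Suc i..p. ?f s * z s) = ?f (Suc i) * z (Suc i) + (\<Sum>s = Suc (Suc i)..p. ?f s * z s)"
      using p by (intro sum.atLeast_Suc_atMost) simp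
    ultimately show ?thesis using bit_I A_Suc[of i] True by (simp add: I_def algebra_simps)
  next
    case False
    then have "E' = E" using E'_less E_le by simp
    moreover have "\<not> bit E k" using k(2) calculation by (simp add: splits_def)
    ultimately show ?thesis using False by simp
  qed
  moreover have "(\<Sum>s = Suc E'..p. ?f s * z s) = (\<Sum>s = Suc E'..i. ?f s * z s) + \<eta> ^ I * z I + (\<Sum>s = Suc I..p. ?f s * z s)"
  proof -
    have "{Suc E'..p} = {Suc E'..i} \<union> ({I} \<union> {Suc I..p})" using E_le E'_less by (auto simp: I_def)
    also have "(\<Sum>s\<in>\<dots>. ?f s * z s) = (\<Sum>s = Suc E'..i. ?f s * z s) + (\<Sum>s\<in>{I} \<union> {Suc I..p}. ?f s * z s)"
      by (intro sum.union_disjoint) (auto simp: I_def)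
    also have "(\<Sum>s\<in>{I} \<union> {Suc I..p}. ?f s * z s) = \<eta> ^ I * z I + (\<Sum>s = Suc I..p. ?f s * z s)"
      using bit_I by simp
    finally show ?thesis by (simp only: add.assoc)
  qed
  moreover have "?l * (\<Sum>s = Suc E'..i. ?f s * z s) = (\<Sum>s = Suc E'..i. \<kappa>w * (if bit s k then gw nb \<eta> k s else 0) * z s)"
    unfolding sum_distrib_left using same_block by (intro sum.cong) (auto simp: I_def)
  moreover have "?l * (\<Sum>s = Suc I..p. ?f s * z s) = \<delta>1"
    unfolding \<delta>1_def sum_distrib_left by (simp add: mult.assoc)
  ultimately have "?l * (wsum V one_ker (emPp p \<eta> k A) t - wsum V one_ker (emPm p \<eta> k B) t)
     = unit * (z I + of_bool (E = I) * B i) + \<delta>1 - \<delta>2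
       + (\<Sum>s = Suc E'..i. \<kappa>w * (if bit s k then gw nb \<eta> k s else 0) * z s)"
    unfolding sum_P by (simp only:) (simp add: unit_gw(2) \<delta>2_def algebra_simps)
  moreover have "\<delta>1 - \<delta>2 = unit * ((\<delta>1 - \<delta>2) / unit)" using unit_pos by simp
  moreover have "\<bar>(\<delta>1 - \<delta>2) / unit\<bar> \<le> 2 * (real (V + 1) * N * \<eta>)"
    using d1 d2 unit_pos by (auto simp: abs_le_iff field_simps)
  ultimately show ?thesis
    by (intro exI[of _ "(\<delta>1 - \<delta>2) / unit"]) (simp add: distrib_left)
qed

text \<open>Generated words whose originals are at positions up to \<open>E'\<close> are not
  cancelled by the prompt sum, but they belong to earlier blocks and form the error.\<close>

lemma Q_part:
  "\<exists>\<delta>. \<kappa>w * (wsum V one_ker (emQp nb p \<eta> k A) t - wsum V one_ker (emQm nb p \<eta> k B) t)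
     = (\<Sum>s = Suc E'..i. \<kappa>w * (if bit s k then gw nb \<eta> k s else 0) * z s) + unit * (\<delta> - B t)
   \<and> \<bar>\<delta>\<bar> \<le> real (V + 1) * N * \<eta>"
proof -
  let ?f = "\<lambda>s. if bit s k then gw nb \<eta> k s else 0"
  define \<delta> where "\<delta> = (\<Sum>j = Suc 0..E'. \<kappa>w * ?f j * z j)"
  have g: "0 \<le> \<kappa>w" "0 \<le> gw nb \<eta> k s" for s using \<eta> by (auto simp: \<kappa>w_def gw_def)
  have d0: "0 \<le> \<delta>" unfolding \<delta>_def using g z(1) by (intro sum_nonneg mult_nonneg_nonneg) auto
  have u\<eta>: "0 \<le> unit * \<eta>" using unit_pos \<eta> by simp
  have le: "\<kappa>w * ?f j \<le> unit * \<eta>" if "j \<le> E'" for j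
    using earlier_block[OF that] u\<eta> by auto
  have "\<delta> \<le> (\<Sum>j = Suc 0..E'. unit * \<eta> * N)"
    unfolding \<delta>_def
  proof (intro sum_mono)
    fix j assume "j \<in> {Suc 0..E'}"
    then have "\<kappa>w * ?f j \<le> unit * \<eta>" using le by simp
    then show "\<kappa>w * ?f j * z j \<le> unit * \<eta> * N" by (rule mult_mono) (use z(1) u\<eta> in auto)
  qed
  also have "\<dots> = real E' * (unit * \<eta> * N)" by simp
  also have "\<dots> \<le> real (V + 1) * (unit * \<eta> * N)"
    using E'_less(1) E_le p unit_pos \<eta> N by (intro mult_right_mono) auto
  finally have d: "\<delta> \<le> unit * (real (V + 1) * N * \<eta>)" by (simp add: mult_ac)
  have "{Suc 0..i} = {Suc 0..E'} \<union> {Suc E'..i}" using E'_less by (auto simp: I_def)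
  then have "(\<Sum>j = Suc 0..i. \<kappa>w * ?f j * z j) = \<delta> + (\<Sum>s = Suc E'..i. \<kappa>w * ?f s * z s)"
    unfolding \<delta>_def by (simp only:) (rule sum.union_disjoint, auto)
  then have "\<kappa>w * (wsum V one_ker (emQp nb p \<eta> k A) t - wsum V one_ker (emQm nb p \<eta> k B) t)
      = \<delta> + (\<Sum>s = Suc E'..i. \<kappa>w * ?f s * z s) - unit * B t"
    unfolding sum_Q right_diff_distrib sum_distrib_left using bit_I
    by (simp add: mult.assoc unit_gw(1)[symmetric])
  moreover have "\<delta> = unit * (\<delta> / unit)" using unit_pos by simp
  moreover have "\<bar>\<delta> / unit\<bar> \<le> real (V + 1) * N * \<eta>"
    using d d0 unit_pos by (auto simp: abs_le_iff field_simps)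
  ultimately show ?thesis by (intro exI[of _ "\<delta> / unit"]) (simp add: right_diff_distrib)
qed

text \<open>The weights grow towards the end, so the last summand isolates \<open>B t\<close> and
  all others carry a factor \<eta>.\<close>

lemma W_part:
  "\<exists>\<delta>. \<mu>w * wsum V one_ker (emW nb p \<eta> B) t = unit * (B t + \<delta>)
     \<and> \<bar>\<delta>\<bar> \<le> real (V + 1) * (real (V + 1) * N * \<eta>)"
proof -
  define \<delta> where "\<delta> = (\<Sum>j<i. \<eta> ^ (i - j) * B (p + 1 + j))"
  have "\<mu>w * wsum V one_ker (emW nb p \<eta> B) t = (\<Sum>j = 0..i. unit * (\<eta> ^ (i - j) * B (p + 1 + j)))"
    unfolding sum_W sum_distrib_left using growth by (intro sum.cong) (auto simp flip: mult.assoc)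
  also have "\<dots> = unit * (\<Sum>j = 0..i. \<eta> ^ (i - j) * B (p + 1 + j))" by (simp add: sum_distrib_left)
  also have "(\<Sum>j = 0..i. \<eta> ^ (i - j) * B (p + 1 + j)) = \<delta> + B t"
    unfolding \<delta>_def by (simp add: t_def atLeast0AtMost lessThan_Suc_atMost[symmetric])
  finally have 1: "\<mu>w * wsum V one_ker (emW nb p \<eta> B) t = unit * (B t + \<delta>)" by (simp add: add.commute)
  have "0 \<le> \<delta>" unfolding \<delta>_def using \<eta> AB_bounds by (intro sum_nonneg mult_nonneg_nonneg) auto
  moreover have "\<delta> \<le> (\<Sum>j<i. \<eta> * (real (V + 1) * N))"
    unfolding \<delta>_def
  proof (intro sum_mono mult_mono)
    fix j assume "j \<in> {..<i}"
    then have "\<eta> ^ (i - j) \<le> \<eta> ^ 1" using \<eta> \<eta>1 by (intro power_decreasing) auto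
    then show "\<eta> ^ (i - j) \<le> \<eta>" by simp
  qed (use \<eta> AB_bounds in auto)
  moreover have "\<dots> = real i * (real (V + 1) * N * \<eta>)" by simp
  moreover have "\<dots> \<le> real (V + 1) * (real (V + 1) * N * \<eta>)"
    using p \<eta> N by (intro mult_right_mono) auto
  ultimately have "\<bar>\<delta>\<bar> \<le> real (V + 1) * (real (V + 1) * N * \<eta>)" by linarith
  with 1 show ?thesis by blast
qed

text \<open>The sums over the words between \<open>E'\<close> and \<open>I\<close> cancel, as do all
  multiples of \<open>B t\<close> and \<open>B i\<close>. The errors add up to at most five times
  \<open>real (V + 1) * X\<close>, which is below 1/12 by the choice of \<eta>.\<close>

lemma decode: "\<bar>Rpos - Rneg - unit * z I\<bar> < unit / 2"
proof -
  define c :: real where "c = of_bool (E = I)"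
  have c: "0 \<le> c" "c \<le> 1" by (auto simp: c_def)
  define X where "X = real (V + 1) * N * \<eta>"
  have X: "0 \<le> X" using N \<eta> by (simp add: X_def)
  obtain \<delta>1 where 1: "\<eta> ^ (2 * hi nb k I) * (wsum V one_ker (emPp p \<eta> k A) t - wsum V one_ker (emPm p \<eta> k B) t)
     = unit * (z I + c * B i + \<delta>1)
       + (\<Sum>s = Suc E'..i. \<kappa>w * (if bit s k then gw nb \<eta> k s else 0) * z s)" "\<bar>\<delta>1\<bar> \<le> 2 * X"
    using P_part unfolding c_def X_def by blast
  obtain \<delta>2 where 2: "\<kappa>w * (wsum V one_ker (emQp nb p \<eta> k A) t - wsum V one_ker (emQm nb p \<eta> k B) t)
     = (\<Sum>s = Suc E'..i. \<kappa>w * (if bit s k then gw nb \<eta> k s else 0) * z s) + unit * (\<delta>2 - B t)" "\<bar>\<delta>2\<bar> \<le> X"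
    using Q_part unfolding X_def by blast
  obtain \<delta>3 where 3: "\<mu>w * wsum V one_ker (emW nb p \<eta> B) t = unit * (B t + \<delta>3)" "\<bar>\<delta>3\<bar> \<le> real (V + 1) * X"
    using W_part unfolding X_def by blast
  have "Rpos - Rneg = \<eta> ^ (2 * hi nb k I) * (wsum V one_ker (emPp p \<eta> k A) t - wsum V one_ker (emPm p \<eta> k B) t)
      - \<kappa>w * (wsum V one_ker (emQp nb p \<eta> k A) t - wsum V one_ker (emQm nb p \<eta> k B) t)
      - (1 + c) * (\<mu>w * wsum V one_ker (emW nb p \<eta> B) t)
      + c * (unit * (wsum V (ck V) (emFp p B) t - wsum V (\<lambda>l. ck V (Suc l)) (emFm p A) t))"
    unfolding Rpos_def Rneg_def c_def by (simp add: algebra_simps)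
  also have "\<dots> = unit * (z I + (\<delta>1 - \<delta>2 - (1 + c) * \<delta>3))"
    unfolding 1(1) 2(1) 3(1) sum_F by (simp add: algebra_simps)
  finally have R: "Rpos - Rneg - unit * z I = unit * (\<delta>1 - \<delta>2 - (1 + c) * \<delta>3)" by (simp add: algebra_simps)
  have "\<bar>(1 + c) * \<delta>3\<bar> \<le> 2 * (real (V + 1) * X)"
    unfolding abs_mult using c 3(2) by (intro mult_mono) auto
  then have "\<bar>\<delta>1 - \<delta>2 - (1 + c) * \<delta>3\<bar> \<le> 3 * X + 2 * (real (V + 1) * X)"
    using 1(2) 2(2) by linarith
  also have "\<dots> \<le> 5 * (real (V + 1) * X)"
  proof -
    have "1 * X \<le> real (V + 1) * X" by (rule mult_right_mono[OF _ X]) simp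
    then show ?thesis by linarith
  qed
  also have "\<dots> < 1 / 2"
  proof -
    have "12 * (real (V + 1) * X) = \<eta> * (12 * real (V + 1) ^ 2 * N)"
      by (simp only: X_def power2_eq_square mult_ac)
    then have "12 * (real (V + 1) * X) < 1" using \<eta>(2) by simp
    then show ?thesis by linarith
  qed
  finally have "\<bar>unit * (\<delta>1 - \<delta>2 - (1 + c) * \<delta>3)\<bar> < unit * (1 / 2)"
    unfolding abs_mult using unit_pos by simp
  then show ?thesis unfolding R by simp
qed

end

end

section \<open>The programs of the two networks\<close>

lemma computes_image:
  assumes "\<And>k. k < m \<Longrightarrow> computes X B G n {f k}"
  shows "computes X B G (m * n) (f ` {..<m})"
  using computes_UN[of m X B G n "\<lambda>k. {f k}", OF assms] by (simp add: UNION_singleton_eq_range)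

section \<open>Position-dependent weights and the first network\<close>

lemma sum_compl_bits:
  assumes "q < 2 ^ nb"
  shows "(\<Sum>b<nb. if \<not> bit q b then 2 ^ b else 0) = 2 ^ nb - 1 - (q :: nat)"
proof -
  have "(\<Sum>b<nb. if \<not> bit q b then 2 ^ b else 0) + (\<Sum>b<nb. if bit q b then (if b < nb then 1 * 2 ^ b else 0) else 0)
      = (\<Sum>b<nb. 2 ^ b :: nat)"
    unfolding sum.distrib[symmetric] by (intro sum.cong) auto
  also have "\<dots> = 2 ^ nb - 1" by (induction nb) auto
  finally show ?thesis using sum_low_bits[of nb nb q 1] assms by simp
qed

text \<open>The exponent has two parts, read from the set digits below \<open>k\<close> and from the
  clear digits above \<open>k\<close>; each takes one pass of \<open>computes_pow\<close>.\<close>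

lemma computes_gw:
  fixes q :: "'a \<Rightarrow> nat"
  assumes "v \<in> G" and bits: "\<And>b. b < nb \<Longrightarrow> (\<lambda>a. of_bool (bit (q a) b)) \<in> G"
    "\<And>b. b < nb \<Longrightarrow> (\<lambda>a. of_bool (\<not> bit (q a) b)) \<in> G"
    and v: "\<And>a. a \<in> X \<Longrightarrow> 0 \<le> v a \<and> v a \<le> M" and M: "0 \<le> M" "M + 2 \<le> B" and \<eta>: "0 \<le> \<eta>" "\<eta> \<le> 1"
    and k: "k < nb"
  shows "computes X B G (nb * 3 + nb * 3) {\<lambda>a. v a * gw nb \<eta> k (q a)}"
proof -
  let ?w = "\<lambda>a. v a * \<eta> ^ (\<Sum>b<nb. if bit (q a) b then (if b < k then 1 * 2 ^ b else 0) else 0)"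
  have w: "0 \<le> ?w a \<and> ?w a \<le> M" if "a \<in> X" for a
    using v[OF that] \<eta> by (auto intro!: order_trans[OF mult_left_le] power_le_one)
  have 1: "computes X B G (nb * 3) {?w}" by (rule computes_pow[where M = M]) (use assms in auto)
  have "computes X B (G \<union> {?w}) (nb * 3) {\<lambda>a. ?w a * \<eta> ^ (\<Sum>b<nb. if \<not> bit (q a) b then (if k < b then 2 ^ b else 0) else 0)}"
    by (rule computes_pow[where M = M]) (use bits(2) w M \<eta> in auto)
  from computes_then[OF 1 this] show ?thesis
    by (rule computes_cong) (use sum_low_bits[of k nb _ 1] k in \<open>simp add: gw_def hi_def power_add mult.assoc\<close>)
qed

text \<open>Before COPY the clock \<open>q\<close> is the exact count \<open>cnt\<close>; from COPY
  on it is known through \<open>dst\<close> up to an error of 1/4. At COPY itself \<open>cnt\<close>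
  is the prompt length, emitted there for the second network.\<close>

lemma emission_program:
  fixes X :: "'a set" and q pp :: "'a \<Rightarrow> nat" and cp :: "'a \<Rightarrow> bool"
  assumes q: "\<And>a. a \<in> X \<Longrightarrow> Suc (q a) < 2 ^ nb"
    and pos: "\<And>a. a \<in> X \<Longrightarrow> \<not> cp a \<Longrightarrow> cnt a = real (q a) \<and> dst a = 0"
      "\<And>a. a \<in> X \<Longrightarrow> cp a \<Longrightarrow> 0 \<le> dst a \<and> real (q a) - 1 / 4 \<le> dst a \<and> dst a \<le> real (q a)"
      "\<And>a. a \<in> X \<Longrightarrow> cp a \<Longrightarrow> q a = 0 \<Longrightarrow> cnt a = real (pp a)"
    and bnd: "\<And>a. a \<in> X \<Longrightarrow> 0 \<le> cnt a \<and> cnt a \<le> M" "\<And>a. a \<in> X \<Longrightarrow> 0 \<le> A a \<and> A a \<le> M"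
      "\<And>a. a \<in> X \<Longrightarrow> 0 \<le> Bv a \<and> Bv a \<le> M"
    and M: "0 \<le> M" "M + 2 \<le> B" "4 * 2 ^ nb + 5 \<le> B" and \<eta>: "0 \<le> \<eta>" "\<eta> \<le> 1"
  shows "computes X B {A, Bv, cnt, \<lambda>a. of_bool (cp a), dst} (40 * (nb + 1) ^ 2)
    ((\<lambda>k a. if \<not> cp a \<and> bit (q a) k then \<eta> ^ q a * A a else 0) ` {..<nb} \<union>
     (\<lambda>k a. if \<not> cp a \<and> bit (Suc (q a)) k then \<eta> ^ Suc (q a) * Bv a else 0) ` {..<nb} \<union>
     (\<lambda>k a. if cp a \<and> bit (q a) k then gw nb \<eta> k (q a) * A a else 0) ` {..<nb} \<union>
     (\<lambda>k a. if cp a \<and> bit (Suc (q a)) k then gw nb \<eta> k (Suc (q a)) * Bv a else 0) ` {..<nb} \<union>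
     {\<lambda>a. if cp a then \<eta> ^ (2 ^ nb - 1 - Suc (q a)) * Bv a else 0,
      \<lambda>a. if cp a then Bv a else 0, \<lambda>a. if cp a \<and> q a \<noteq> 0 then A a else 0,
      \<lambda>a. of_bool (cp a), \<lambda>a. of_bool (\<not> cp a), \<lambda>a. if cp a \<and> q a = 0 then real (pp a) else 0})"
    (is "computes X B _ _ (?Pp ` _ \<union> ?Pm ` _ \<union> ?Qp ` _ \<union> ?Qm ` _ \<union> {?W, ?Fp, ?Fm, _, ?ncp, ?Vp})")
proof -
  define C where "C = (\<lambda>a. of_bool (cp a) :: real)"
  define G where "G = {A, Bv, cnt, C, dst}"
  define Pp Pm Qp Qm W Fp Fm ncp Vp where final: "Pp = ?Pp" "Pm = ?Pm" "Qp = ?Qp" "Qm = ?Qm"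
    "W = ?W" "Fp = ?Fp" "Fm = ?Fm" "ncp = ?ncp" "Vp = ?Vp"
  have "(2::real) ^ nb > 0" by simp
  then have B0: "0 \<le> B" "2 \<le> B" "3 \<le> B" "M + 1 \<le> B" "1 \<le> B" using M by linarith+
  have pw: "0 \<le> x * \<eta> ^ m \<and> x * \<eta> ^ m \<le> M" "0 \<le> \<eta> ^ m * x \<and> \<eta> ^ m * x \<le> M" if "0 \<le> x" "x \<le> M" for x m
    using that \<eta> by (auto simp: mult.commute[of _ x] intro: order_trans[OF mult_left_le] power_le_one)
  \<comment> \<open>Gating \<open>cnt\<close> leaves at each position only one source of the clock,
    so a plain sum serves both sides of COPY. \<open>rr\<close> and \<open>rr1\<close> represent
    \<open>q\<close> and \<open>q + 1\<close>; the negative parts of the summation by parts need the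
    latter.\<close>
  define oq where "oq = (\<lambda>a. if cp a then 0 else cnt a)"
  define rr where "rr = (\<lambda>a. max 0 (0 + 1 * oq a + 1 * dst a))"
  define rr1 where "rr1 = (\<lambda>a. max 0 (1 + 1 * oq a + 1 * dst a))"
  define c0 where "c0 = (\<lambda>a. of_bool (cp a \<and> q a = 0) :: real)"
  define bt bt1 nbt nbt1 where bt: "bt = (\<lambda>b a. of_bool (bit (q a) b) :: real)"
    "bt1 = (\<lambda>b a. of_bool (bit (Suc (q a)) b) :: real)" "nbt = (\<lambda>b a. of_bool (\<not> bit (q a) b) :: real)"
    "nbt1 = (\<lambda>b a. of_bool (\<not> bit (Suc (q a)) b) :: real)"
  have s1: "computes X B G (1 + (1 + 1)) ({oq} \<union> ({rr} \<union> {rr1}))"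
  proof (rule computes_comp)
    show "computes X B G 1 {oq}"
      by (rule computes_gate_not[where v = cnt and p = cp and M = M, folded C_def])
        (use bnd M B0 in \<open>auto simp: G_def oq_def\<close>)
    show "computes X B (G \<union> {oq}) (1 + 1) ({rr} \<union> {rr1})"
    proof (rule computes_Un)
      show "computes X B (G \<union> {oq}) 1 {rr}"
        by (rule computes_lin2[where ?h1.0 = oq and ?h2.0 = dst and b = 0 and ?q1.0 = 1 and ?q2.0 = 1])
          (use B0 in \<open>auto simp: G_def rr_def\<close>)
      show "computes X B (G \<union> {oq}) 1 {rr1}"
        by (rule computes_lin2[where ?h1.0 = oq and ?h2.0 = dst and b = 1 and ?q1.0 = 1 and ?q2.0 = 1])
          (use B0 in \<open>auto simp: G_def rr1_def\<close>)
    qed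
  qed
  have r: "real (q a) - 1 / 4 \<le> rr a \<and> rr a \<le> real (q a)"
    "real (Suc (q a)) - 1 / 4 \<le> rr1 a \<and> rr1 a \<le> real (Suc (q a))" if "a \<in> X" for a
    using pos(1,2)[OF that] by (cases "cp a"; auto simp: max_def oq_def rr_def rr1_def)+
  have qn: "q a < 2 ^ nb" if "a \<in> X" for a using q[OF that] by simp
  define H1 where "H1 = {oq} \<union> ({rr} \<union> {rr1})"
  have s2: "computes X B (G \<union> H1) (nb * 4 + nb * 4) (bt ` {..<nb} \<union> bt1 ` {..<nb})"
  proof (rule computes_Un)
    show "computes X B (G \<union> H1) (nb * 4) (bt ` {..<nb})"
      unfolding bt by (rule computes_bits[where \<rho> = rr and n = q]) (use r(1) qn M in \<open>auto simp: H1_def\<close>)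
    show "computes X B (G \<union> H1) (nb * 4) (bt1 ` {..<nb})"
      unfolding bt by (rule computes_bits[where \<rho> = rr1 and n = "\<lambda>a. Suc (q a)"]) (use r(2) q M in \<open>auto simp: H1_def\<close>)
  qed
  define H2 where "H2 = H1 \<union> (bt ` {..<nb} \<union> bt1 ` {..<nb})"
  have c2: "computes X B G (3 + nb * 8) H2"
    unfolding H2_def by (rule computes_mono[OF computes_comp[OF s1[folded H1_def] s2]]) auto
  have s3: "computes X B (G \<union> H2) (nb * 1 + nb * 1) (nbt ` {..<nb} \<union> nbt1 ` {..<nb})"
  proof (intro computes_Un computes_image)
    fix b assume b: "b < nb"
    show "computes X B (G \<union> H2) 1 {nbt b}" unfolding bt(3)
      by (rule computes_not) (use b B0 in \<open>auto simp: H2_def bt(1)[symmetric] fun_cong[OF bt(1), symmetric]\<close>)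
    show "computes X B (G \<union> H2) 1 {nbt1 b}" unfolding bt(4)
      by (rule computes_not) (use b B0 in \<open>auto simp: H2_def fun_cong[OF bt(2), symmetric]\<close>)
  qed
  define H3 where "H3 = H2 \<union> (nbt ` {..<nb} \<union> nbt1 ` {..<nb})"
  have c3: "computes X B G (3 + nb * 10) H3"
    unfolding H3_def by (rule computes_mono[OF computes_comp[OF c2 s3]]) auto
  define AP AQ BP where ABP: "AP = (\<lambda>a. if cp a then 0 else A a)" "AQ = (\<lambda>a. if cp a then A a else 0)"
    "BP = (\<lambda>a. if cp a then 0 else Bv a)"
  have bABP: "0 \<le> AP a \<and> AP a \<le> M" "0 \<le> AQ a \<and> AQ a \<le> M" "0 \<le> BP a \<and> BP a \<le> M" "0 \<le> Fp a \<and> Fp a \<le> M"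
    if "a \<in> X" for a using bnd[OF that] M by (auto simp: ABP final)
  have s4: "computes X B (G \<union> H3) (1 + (1 + (1 + (1 + (1 + 1)))))
      ({AP} \<union> ({AQ} \<union> ({BP} \<union> ({Fp} \<union> ({c0} \<union> {ncp})))))"
  proof (intro computes_Un)
    show "computes X B (G \<union> H3) 1 {AP}"
      by (rule computes_gate_not[where v = A and p = cp and M = M, folded C_def]) (use bnd M B0 in \<open>auto simp: G_def ABP\<close>)
    show "computes X B (G \<union> H3) 1 {AQ}"
      by (rule computes_gate[where v = A and p = cp and M = M, folded C_def]) (use bnd M B0 in \<open>auto simp: G_def ABP\<close>)
    show "computes X B (G \<union> H3) 1 {BP}"
      by (rule computes_gate_not[where v = Bv and p = cp and M = M, folded C_def]) (use bnd M B0 in \<open>auto simp: G_def ABP\<close>)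
    show "computes X B (G \<union> H3) 1 {Fp}"
      by (rule computes_gate[where v = Bv and p = cp and M = M, folded C_def]) (use bnd M B0 in \<open>auto simp: G_def final\<close>)
    show "computes X B (G \<union> H3) 1 {ncp}" unfolding final by (rule computes_not[folded C_def]) (use B0 in \<open>auto simp: G_def C_def\<close>)
    show "computes X B (G \<union> H3) 1 {c0}"
    \<comment> \<open>\<open>dst\<close> is 0 at COPY and at least 3/4 afterwards, so
      \<open>C - 2 * dst\<close> is 1 at COPY and negative after it.\<close>
    proof (rule computes_lin2[where ?h1.0 = C and ?h2.0 = dst and b = 0 and ?q1.0 = 1 and ?q2.0 = "-2"])
      fix a assume a: "a \<in> X"
      show "c0 a = max 0 (0 + 1 * C a + - 2 * dst a)"
      proof (cases "cp a")
        case True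
        show ?thesis
        proof (cases "q a")
          case 0
          then show ?thesis using pos(2)[OF a True] True by (simp add: c0_def C_def)
        next
          case (Suc n)
          then have "real (q a) \<ge> 1" by simp
          then show ?thesis using pos(2)[OF a True] True Suc by (simp add: max_def c0_def C_def)
        qed
      qed (use pos(1)[OF a] in \<open>auto simp: c0_def C_def\<close>)
    qed (use B0 in \<open>auto simp: G_def\<close>)
  qed
  define H4 where "H4 = H3 \<union> ({AP} \<union> ({AQ} \<union> ({BP} \<union> ({Fp} \<union> ({c0} \<union> {ncp})))))"
  have c4: "computes X B G (9 + nb * 10) H4"
    unfolding H4_def by (rule computes_mono[OF computes_comp[OF c3 s4]]) auto
  have bH4: "bt b \<in> H4" "bt1 b \<in> H4" "nbt b \<in> H4" "nbt1 b \<in> H4" if "b < nb" for b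
    using that by (auto simp: H4_def H3_def H2_def)
  define AP' BP' where AB': "AP' = (\<lambda>a. AP a * \<eta> ^ q a)" "BP' = (\<lambda>a. BP a * \<eta> ^ Suc (q a))"
  have lb: "(\<Sum>b<nb. if bit m b then (if b < nb then 1 * 2 ^ b else 0) else 0) = m" if "m < 2 ^ nb" for m :: nat
    using sum_low_bits[of nb nb m 1] that by simp
  have s5: "computes X B (G \<union> H4) (nb * 3 + (nb * 3 + (nb * 3 + (1 + 1)))) ({AP'} \<union> ({BP'} \<union> ({W} \<union> ({Fm} \<union> {Vp}))))"
  proof (intro computes_Un)
    have "computes X B (G \<union> H4) (nb * 3)
        {\<lambda>a. AP a * \<eta> ^ (\<Sum>b<nb. if bit (q a) b then (if b < nb then 1 * 2 ^ b else 0) else 0)}"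
      by (rule computes_pow[where M = M, OF _ _ bABP(1)])
        (use bH4(1) M \<eta> in \<open>auto simp: H4_def fun_cong[OF bt(1), symmetric]\<close>)
    then show "computes X B (G \<union> H4) (nb * 3) {AP'}"
      by (rule computes_cong) (use lb[OF qn] in \<open>simp add: AB'\<close>)
    have "computes X B (G \<union> H4) (nb * 3)
        {\<lambda>a. BP a * \<eta> ^ (\<Sum>b<nb. if bit (Suc (q a)) b then (if b < nb then 1 * 2 ^ b else 0) else 0)}"
      by (rule computes_pow[where M = M, OF _ _ bABP(3)])
        (use bH4(2) M \<eta> in \<open>auto simp: H4_def fun_cong[OF bt(2), symmetric]\<close>)
    then show "computes X B (G \<union> H4) (nb * 3) {BP'}"
      by (rule computes_cong) (use lb[OF q] in \<open>simp add: AB'\<close>)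
    have "computes X B (G \<union> H4) (nb * 3)
        {\<lambda>a. Fp a * \<eta> ^ (\<Sum>b<nb. if \<not> bit (Suc (q a)) b then 2 ^ b else 0)}"
      by (rule computes_pow[where M = M, OF _ _ bABP(4)])
        (use bH4(4) M \<eta> in \<open>auto simp: H4_def fun_cong[OF bt(4), symmetric]\<close>)
    then show "computes X B (G \<union> H4) (nb * 3) {W}"
      by (rule computes_cong) (use sum_compl_bits[OF q] in \<open>simp add: final\<close>)
    show "computes X B (G \<union> H4) 1 {Fm}"
      by (rule computes_gate_not[where v = AQ and p = "\<lambda>a. cp a \<and> q a = 0" and M = M, folded c0_def, OF _ _ bABP(2)])
        (use M B0 in \<open>auto simp: H4_def ABP final\<close>)
    show "computes X B (G \<union> H4) 1 {Vp}"
      by (rule computes_gate[where v = cnt and p = "\<lambda>a. cp a \<and> q a = 0" and M = M, folded c0_def, OF _ _ bnd(1)])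
        (use M B0 pos(3) in \<open>auto simp: H4_def G_def final\<close>)
  qed
  define H5 where "H5 = H4 \<union> ({AP'} \<union> ({BP'} \<union> ({W} \<union> ({Fm} \<union> {Vp}))))"
  have c5: "computes X B G (11 + nb * 19) H5"
    unfolding H5_def by (rule computes_mono[OF computes_comp[OF c4 s5]]) auto
  have bH5: "bt b \<in> H5" "bt1 b \<in> H5" "nbt b \<in> H5" "nbt1 b \<in> H5" if "b < nb" for b
    using bH4[OF that] by (auto simp: H5_def)
  have bAB': "0 \<le> AP' a \<and> AP' a \<le> M" "0 \<le> BP' a \<and> BP' a \<le> M" if "a \<in> X" for a
    using pw(1) bABP[OF that] unfolding AB' by blast+
  define AG BG where ABG: "AG = (\<lambda>k a. AQ a * gw nb \<eta> k (q a))" "BG = (\<lambda>k a. Fp a * gw nb \<eta> k (Suc (q a)))"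
  have bABG: "0 \<le> AG k a \<and> AG k a \<le> M" "0 \<le> BG k a \<and> BG k a \<le> M" if "a \<in> X" for a k
    using pw(1) bABP[OF that] unfolding ABG gw_def by blast+
  have bits: "(\<lambda>a. of_bool (bit (q a) b)) \<in> G \<union> H5" "(\<lambda>a. of_bool (\<not> bit (q a) b)) \<in> G \<union> H5"
    "(\<lambda>a. of_bool (bit (Suc (q a)) b)) \<in> G \<union> H5" "(\<lambda>a. of_bool (\<not> bit (Suc (q a)) b)) \<in> G \<union> H5"
    if "b < nb" for b
    using bH5[OF that] unfolding bt by blast+
  have AQ5: "AQ \<in> G \<union> H5" "Fp \<in> G \<union> H5" by (simp_all add: H5_def H4_def)
  have s6: "computes X B (G \<union> H5) (nb * 1 + (nb * 1 + (nb * (nb * 3 + nb * 3 + 1) + nb * (nb * 3 + nb * 3 + 1))))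
      (Pp ` {..<nb} \<union> (Pm ` {..<nb} \<union> (Qp ` {..<nb} \<union> Qm ` {..<nb})))"
  proof (intro computes_Un computes_image)
    fix k assume k: "k < nb"
    show "computes X B (G \<union> H5) 1 {Pp k}"
      by (rule computes_gate[where v = AP' and p = "\<lambda>a. bit (q a) k" and M = M, OF _ _ bAB'(1)])
        (use bH5(1)[OF k] M B0 in \<open>auto simp: H5_def fun_cong[OF bt(1), symmetric] final AB' ABP\<close>)
    show "computes X B (G \<union> H5) 1 {Pm k}"
      by (rule computes_gate[where v = BP' and p = "\<lambda>a. bit (Suc (q a)) k" and M = M, OF _ _ bAB'(2)])
        (use bH5(2)[OF k] M B0 in \<open>auto simp: H5_def fun_cong[OF bt(2), symmetric] final AB' ABP\<close>)
    have "computes X B (G \<union> H5) (nb * 3 + nb * 3) {AG k}"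
      unfolding ABG by (rule computes_gw[OF AQ5(1) bits(1) bits(2) bABP(2) M(1,2) \<eta> k])
    moreover have "computes X B ((G \<union> H5) \<union> {AG k}) 1 {Qp k}"
      by (rule computes_gate[where v = "AG k" and p = "\<lambda>a. bit (q a) k" and M = M, OF _ _ bABG(1)])
        (use bH5(1)[OF k] M B0 in \<open>auto simp: fun_cong[OF bt(1), symmetric] final ABG ABP\<close>)
    ultimately show "computes X B (G \<union> H5) (nb * 3 + nb * 3 + 1) {Qp k}" by (rule computes_then)
    have "computes X B (G \<union> H5) (nb * 3 + nb * 3) {BG k}"
      unfolding ABG by (rule computes_gw[OF AQ5(2) bits(3) bits(4) bABP(4) M(1,2) \<eta> k])
    moreover have "computes X B ((G \<union> H5) \<union> {BG k}) 1 {Qm k}"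
      by (rule computes_gate[where v = "BG k" and p = "\<lambda>a. bit (Suc (q a)) k" and M = M, OF _ _ bABG(2)])
        (use bH5(2)[OF k] M B0 in \<open>auto simp: fun_cong[OF bt(2), symmetric] final ABG\<close>)
    ultimately show "computes X B (G \<union> H5) (nb * 3 + nb * 3 + 1) {Qm k}" by (rule computes_then)
  qed
  define H6 where "H6 = H5 \<union> (Pp ` {..<nb} \<union> (Pm ` {..<nb} \<union> (Qp ` {..<nb} \<union> Qm ` {..<nb})))"
  have c6: "computes X B G (40 * (nb + 1) ^ 2) H6"
    unfolding H6_def
    by (rule computes_mono[OF computes_comp[OF c5 s6]]) (auto simp: power2_eq_square algebra_simps)
  have "computes X B (G \<union> H6) 0 (G \<union> H6)" by (rule computes_refl) auto
  from computes_then[OF c6 this] have "computes X B G (40 * (nb + 1) ^ 2) (G \<union> H6)" by simp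
  then have "computes X B G (40 * (nb + 1) ^ 2)
      (Pp ` {..<nb} \<union> Pm ` {..<nb} \<union> Qp ` {..<nb} \<union> Qm ` {..<nb} \<union> {W, Fp, Fm, C, ncp, Vp})"
    by (rule computes_mono) (auto simp: H6_def H5_def H4_def G_def)
  then show ?thesis unfolding final G_def C_def .
qed

section \<open>The second network\<close>

lemma computes_sum:
  assumes "\<And>k. k < m \<Longrightarrow> f k \<in> G" "real m \<le> B" "\<And>k a. k < m \<Longrightarrow> a \<in> X \<Longrightarrow> 0 \<le> f k a"
  shows "computes X B G 1 {\<lambda>a. \<Sum>k<m. f k a}"
proof (rule computes_step[where ps = "map (\<lambda>k. (1, f k)) [0..<m]" and b = 0])
  have "(\<Sum>(q, h)\<leftarrow>map (\<lambda>k. (1 :: real, f k)) [0..<m]. \<bar>q\<bar>) = real m" by (induction m) auto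
  then show "(\<Sum>(q, h)\<leftarrow>map (\<lambda>k. (1, f k)) [0..<m]. \<bar>q\<bar>) \<le> B" using assms(2) by simp
  fix a assume "a \<in> X"
  then have "0 \<le> (\<Sum>k<m. f k a)" using assms(3) by (intro sum_nonneg) auto
  moreover have "(\<Sum>(q, h)\<leftarrow>map (\<lambda>k. (1, f k)) [0..<m]. q * h a) = (\<Sum>k<m. f k a)"
    by (induction m) auto
  ultimately show "(\<Sum>k<m. f k a) = max 0 (0 + (\<Sum>(q, h)\<leftarrow>map (\<lambda>k. (1, f k)) [0..<m]. q * h a))"
    by simp
qed (use assms order_trans[of 0 "real m" B] in auto)

lemma div_pow_Suc: "q div 2 ^ k = 2 * (q div 2 ^ Suc k) + of_bool (bit q k)" for q :: nat
proof -
  have "q div 2 ^ Suc k = (q div 2 ^ k) div 2" by (simp only: power_Suc2 div_mult2_eq)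
  then show ?thesis by (simp add: bit_iff_odd del: power_Suc)
qed

text \<open>Scanning from the top, \<open>d k\<close> tells whether the digits from \<open>k\<close>
  on agree, starting with \<open>d nb = 1\<close>. Because \<open>e < I\<close>, the first
  disagreement must be 0 in \<open>e\<close> and 1 in \<open>I\<close>, so \<open>d k\<close> is
  \<open>d (Suc k)\<close> minus the splitting indicator.\<close>

lemma computes_splits:
  fixes e I :: "'a \<Rightarrow> nat"
  assumes bits: "\<And>b. b < nb \<Longrightarrow> (\<lambda>a. of_bool (bit (I a) b)) \<in> G" "\<And>b. b < nb \<Longrightarrow> (\<lambda>a. of_bool (bit (e a) b)) \<in> G"
    and I: "\<And>a. a \<in> X \<Longrightarrow> e a < I a \<and> I a < 2 ^ nb" and B: "3 \<le> B"
  shows "computes X B G (1 + nb * 2) ((\<lambda>k a. of_bool (splits k (e a) (I a))) ` {..<nb})"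
proof -
  define s d where sd: "s = (\<lambda>k a. of_bool (splits k (e a) (I a)) :: real)"
    "d = (\<lambda>k a. of_bool (e a div 2 ^ k = I a div 2 ^ k) :: real)"
  have "computes X B G (1 + m * 2) ({d (nb - m)} \<union> s ` {nb - m..<nb})" if "m \<le> nb" for m
    using that
  proof (induction m)
    case 0
    have "computes X B G 1 {d nb}"
      by (rule computes_step[where ps = "[]" and b = 1]) (use B I less_trans in \<open>fastforce simp: sd\<close>)+
    then show ?case by simp
  next
    case (Suc m)
    define k where "k = nb - Suc m"
    have k: "nb - m = Suc k" "k < nb" using Suc.prems by (auto simp: k_def)
    have le: "e a div 2 ^ k \<le> I a div 2 ^ k" if "a \<in> X" for a using I[OF that] by (simp add: div_le_mono)
    note dv = div_pow_Suc[of _ k]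
    let ?G = "G \<union> ({d (nb - m)} \<union> s ` {nb - m..<nb})"
    have "computes X B ?G 1 {s k}"
      by (rule computes_lin3[where ?h1.0 = "d (Suc k)" and ?h2.0 = "\<lambda>a. of_bool (bit (I a) k)"
          and ?h3.0 = "\<lambda>a. of_bool (bit (e a) k)" and b = "-1" and ?q1.0 = 1 and ?q2.0 = 1 and ?q3.0 = "-1"])
        (use bits k B in \<open>auto simp: sd splits_def\<close>)
    moreover have "computes X B (?G \<union> {s k}) 1 {d k}"
    proof (rule computes_lin2[where ?h1.0 = "d (Suc k)" and ?h2.0 = "s k" and b = 0 and ?q1.0 = 1 and ?q2.0 = "-1"])
      fix a assume a: "a \<in> X"
      show "d k a = max 0 (0 + 1 * d (Suc k) a + - 1 * s k a)"
      proof -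
        have "2 * x + of_bool u = 2 * y + of_bool v \<longleftrightarrow> x = y \<and> u = v" for x y :: nat and u v
          by (cases u; cases v; simp; presburger)
        then have eq: "e a div 2 ^ k = I a div 2 ^ k \<longleftrightarrow>
            e a div 2 ^ Suc k = I a div 2 ^ Suc k \<and> bit (e a) k = bit (I a) k"
          unfolding dv .
        have "e a div 2 ^ Suc k = I a div 2 ^ Suc k \<Longrightarrow> bit (e a) k \<Longrightarrow> bit (I a) k"
          using le[OF a] unfolding dv by (cases "bit (I a) k") auto
        then show ?thesis unfolding sd splits_def eq by auto
      qed
    qed (use k B in auto)
    ultimately have "computes X B ?G (1 + 1) ({s k} \<union> {d k})" by (rule computes_comp)
    then have "computes X B G (1 + m * 2 + (1 + 1)) (({d (nb - m)} \<union> s ` {nb - m..<nb}) \<union> ({s k} \<union> {d k}))"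
      by (rule computes_comp[OF Suc.IH[OF Suc_leD[OF Suc.prems]]])
    moreover have "{nb - Suc m..<nb} = insert k {nb - m..<nb}" using k unfolding k_def by auto
    ultimately show ?case by (elim computes_mono) (auto simp: k_def)
  qed
  from this[of nb] show ?thesis unfolding sd by (rule computes_mono) (auto simp: lessThan_atLeast0)
qed

text \<open>The splitting digit depends on the input, so the combination is formed for every
  \<open>k\<close>, gated by \<open>splits\<close>, and summed. \<open>E\<close> is recovered from
  the prompt length \<open>vp\<close> and the number \<open>cn\<close> of window positions up to the
  end of the prompt.\<close>

lemma decoding_program:
  fixes X :: "'a set" and I E :: "'a \<Rightarrow> nat" and Pp Pm Qp Qm :: "nat \<Rightarrow> 'a \<Rightarrow> real"
    and nb :: nat and \<eta> :: real
  defines "e \<equiv> \<lambda>a. E a - of_bool (E a = I a)"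
    and "z0 \<equiv> \<lambda>a. of_bool (E a = I a)" and "\<kappa> \<equiv> \<lambda>k. \<eta> ^ (2 ^ nb - 2 ^ k)"
  assumes int: "\<And>a. a \<in> X \<Longrightarrow> cI a = real (I a) \<and> vp a + 1 - cn a = real (E a)"
    and I: "\<And>a. a \<in> X \<Longrightarrow> E a \<le> I a \<and> 1 \<le> I a \<and> I a < 2 ^ nb"
    and bnd: "\<And>a k. a \<in> X \<Longrightarrow> k < nb \<Longrightarrow> (0 \<le> Pp k a \<and> Pp k a \<le> M) \<and> (0 \<le> Pm k a \<and> Pm k a \<le> M) \<and>
        (0 \<le> Qp k a \<and> Qp k a \<le> M) \<and> (0 \<le> Qm k a \<and> Qm k a \<le> M)"
      "\<And>a. a \<in> X \<Longrightarrow> (0 \<le> W a \<and> W a \<le> M) \<and> (0 \<le> Fp a \<and> Fp a \<le> M) \<and> (0 \<le> Fm a \<and> Fm a \<le> M)"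
    and M: "1 \<le> M" "M + 5 \<le> B" "4 * 2 ^ nb + 5 \<le> B" and \<eta>: "0 \<le> \<eta>" "\<eta> \<le> 1"
  shows "computes X B (Pp ` {..<nb} \<union> Pm ` {..<nb} \<union> Qp ` {..<nb} \<union> Qm ` {..<nb} \<union> {W, Fp, Fm, cI, cn, vp})
    (62 * (nb + 1) ^ 2)
    {\<lambda>a. \<Sum>k<nb. if splits k (e a) (I a) then \<eta> ^ (2 * hi nb k (I a)) * Pp k a + \<kappa> k * Qm k a
       + z0 a * (\<kappa> k * gw nb \<eta> k (I a) * Fp a) else 0,
     \<lambda>a. \<Sum>k<nb. if splits k (e a) (I a) then \<eta> ^ (2 * hi nb k (I a)) * Pm k a + \<kappa> k * Qp k a
       + (1 + z0 a) * (\<eta> ^ (2 * (I a mod 2 ^ k) + (2 ^ nb - 2 ^ Suc k + 1)) * W a)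
       + z0 a * (\<kappa> k * gw nb \<eta> k (I a) * Fm a) else 0,
     \<lambda>a. \<Sum>k<nb. if splits k (e a) (I a) then \<kappa> k * gw nb \<eta> k (I a) else 0}"
    (is "computes X B ?G _ {?rp, ?rm, ?ru}")
proof -
  define G where "G = ?G"
  define Rp Rm Ru where R: "Rp = (\<lambda>k a. if splits k (e a) (I a) then \<eta> ^ (2 * hi nb k (I a)) * Pp k a + \<kappa> k * Qm k a
       + z0 a * (\<kappa> k * gw nb \<eta> k (I a) * Fp a) else 0)"
    "Rm = (\<lambda>k a. if splits k (e a) (I a) then \<eta> ^ (2 * hi nb k (I a)) * Pm k a + \<kappa> k * Qp k a
       + (1 + z0 a) * (\<eta> ^ (2 * (I a mod 2 ^ k) + (2 ^ nb - 2 ^ Suc k + 1)) * W a)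
       + z0 a * (\<kappa> k * gw nb \<eta> k (I a) * Fm a) else 0)"
    "Ru = (\<lambda>k a. if splits k (e a) (I a) then \<kappa> k * gw nb \<eta> k (I a) else 0)"
  have nbB: "real nb \<le> B"
  proof -
    have "real nb \<le> real (2 ^ nb)" by (intro of_nat_mono) (simp add: less_imp_le)
    then have "real nb \<le> 2 ^ nb" by simp
    moreover have "(0::real) < 2 ^ nb" by simp
    ultimately show ?thesis using M(3) by linarith
  qed
  have B0: "0 \<le> B" "1 \<le> B" "2 \<le> B" "3 \<le> B" "5 \<le> B" "M + 1 \<le> B" "M + 2 \<le> B" "0 \<le> M" using M by linarith+
  have pw: "0 \<le> x * \<eta> ^ m \<and> x * \<eta> ^ m \<le> M" if "0 \<le> x" "x \<le> M" for x m
    using that \<eta> by (auto intro: order_trans[OF mult_left_le] power_le_one)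
  have \<kappa>: "0 \<le> \<kappa> k" "\<kappa> k \<le> 1" for k using \<eta> by (auto simp: \<kappa>_def power_le_one)
  have gw0: "0 \<le> gw nb \<eta> k m" for k m using \<eta> by (simp add: gw_def)
  have eI: "e a < I a \<and> I a < 2 ^ nb" "real (e a) = real (E a) - z0 a" if "a \<in> X" for a
    using I[OF that] by (auto simp: e_def z0_def)
  define rE where "rE = (\<lambda>a. real (E a))"
  define re where "re = (\<lambda>a. real (e a))"
  have "computes X B G 1 {rE}"
    by (rule computes_lin2[where ?h1.0 = vp and ?h2.0 = cn and b = 1 and ?q1.0 = 1 and ?q2.0 = "-1"])
      (use int B0 in \<open>fastforce simp: G_def rE_def\<close>)+
  moreover have "computes X B (G \<union> {rE}) 1 {z0}"
  proof (rule computes_lin2[where ?h1.0 = rE and ?h2.0 = cI and b = 1 and ?q1.0 = 1 and ?q2.0 = "-1"])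
    fix a assume a: "a \<in> X"
    show "z0 a = max 0 (1 + 1 * rE a + - 1 * cI a)"
    proof (cases "E a = I a")
      case False
      then have "real (E a) + 1 \<le> real (I a)" using I[OF a] by linarith
      then show ?thesis using int[OF a] False by (simp add: z0_def rE_def)
    qed (use int[OF a] in \<open>simp add: z0_def rE_def\<close>)
  qed (use B0 in \<open>auto simp: G_def\<close>)
  ultimately have c0: "computes X B G (1 + 1) ({rE} \<union> {z0})" by (rule computes_comp)
  have re: "re a = max 0 (0 + 1 * rE a + - 1 * z0 a)" if "a \<in> X" for a
    using eI(2)[OF that] of_nat_0_le_iff[of "e a", where ?'a = real] unfolding re_def rE_def by (simp add: max_def)
  have "computes X B (G \<union> ({rE} \<union> {z0})) 1 {re}"
    by (rule computes_lin2[where ?h1.0 = rE and ?h2.0 = z0 and b = 0 and ?q1.0 = 1 and ?q2.0 = "-1"])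
      (use re B0 in auto)
  from computes_comp[OF c0 this] have c1: "computes X B G (1 + 1 + 1) ({rE} \<union> {z0} \<union> {re})" .
  define H1 where "H1 = {rE} \<union> {z0} \<union> {re}"
  define bI be nbI sl where b: "bI = (\<lambda>b a. of_bool (bit (I a) b) :: real)"
    "be = (\<lambda>b a. of_bool (bit (e a) b) :: real)" "nbI = (\<lambda>b a. of_bool (\<not> bit (I a) b) :: real)"
    "sl = (\<lambda>k a. of_bool (splits k (e a) (I a)) :: real)"
  have "computes X B (G \<union> H1) (nb * 4 + nb * 4) (bI ` {..<nb} \<union> be ` {..<nb})"
  proof (rule computes_Un)
    show "computes X B (G \<union> H1) (nb * 4) (bI ` {..<nb})" unfolding b
      by (rule computes_bits[where \<rho> = cI and n = I]) (use int eI M in \<open>auto simp: G_def\<close>)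
    show "computes X B (G \<union> H1) (nb * 4) (be ` {..<nb})" unfolding b
      by (rule computes_bits[where \<rho> = re and n = e]) (use eI M in \<open>force simp: H1_def re_def\<close>)+
  qed
  from computes_comp[OF c1[folded H1_def] this]
  have c2: "computes X B G (1 + 1 + 1 + (nb * 4 + nb * 4)) (H1 \<union> (bI ` {..<nb} \<union> be ` {..<nb}))" .
  define H2 where "H2 = H1 \<union> (bI ` {..<nb} \<union> be ` {..<nb})"
  have bH2: "(\<lambda>a. of_bool (bit (I a) b)) \<in> G \<union> H2" "(\<lambda>a. of_bool (bit (e a) b)) \<in> G \<union> H2" if "b < nb" for b
    using that imageI[of b "{..<nb}" bI] imageI[of b "{..<nb}" be] unfolding H2_def b by blast+
  have "computes X B (G \<union> H2) (nb * 1 + (1 + nb * 2)) (nbI ` {..<nb} \<union> sl ` {..<nb})"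
  proof (intro computes_Un computes_image)
    fix k assume "k < nb"
    then show "computes X B (G \<union> H2) 1 {nbI k}" unfolding b by (intro computes_not bH2 B0)
  next
    show "computes X B (G \<union> H2) (1 + nb * 2) (sl ` {..<nb})"
      unfolding b by (rule computes_splits[OF bH2 eI(1) B0(4)])
  qed
  from computes_comp[OF c2[folded H2_def] this]
  have c3: "computes X B G (1 + 1 + 1 + (nb * 4 + nb * 4) + (nb * 1 + (1 + nb * 2))) (H2 \<union> (nbI ` {..<nb} \<union> sl ` {..<nb}))" .
  define H3 where "H3 = H2 \<union> (nbI ` {..<nb} \<union> sl ` {..<nb})"
  have bits: "(\<lambda>a. of_bool (bit (I a) b)) \<in> G \<union> H3" "(\<lambda>a. of_bool (\<not> bit (I a) b)) \<in> G \<union> H3"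
    "(\<lambda>a. of_bool (splits b (e a) (I a))) \<in> G \<union> H3" if "b < nb" for b
    using bH2[OF that] imageI[of b "{..<nb}" nbI] imageI[of b "{..<nb}" sl] that unfolding H3_def b by blast+
  have z03: "(\<lambda>a. of_bool (E a = I a)) \<in> G \<union> H3" unfolding H3_def H2_def H1_def z0_def by blast
  have mem: "W \<in> G \<union> H3" "Fp \<in> G \<union> H3" "Fm \<in> G \<union> H3" by (auto simp: G_def)
  have sel: "computes X B (G \<union> H3) 1 {\<lambda>a. if splits k (e a) (I a) then v a else 0}"
    if "k < nb" "v \<in> G \<union> H3" "\<And>a. a \<in> X \<Longrightarrow> 0 \<le> v a \<and> v a \<le> M" for k v
    by (rule computes_gate[OF that(2) bits(3)[OF that(1)] that(3) B0(8,6)]) auto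
  have hi_step: "computes X B (G \<union> H3) (1 + nb * 3) {\<lambda>a. if splits k (e a) (I a) then \<eta> ^ (2 * hi nb k (I a)) * v a else 0}"
    if k: "k < nb" and v: "v \<in> G \<union> H3" "\<And>a. a \<in> X \<Longrightarrow> 0 \<le> v a \<and> v a \<le> M" for k v
  proof -
    let ?s = "\<lambda>a. if splits k (e a) (I a) then v a else 0"
    have "computes X B ((G \<union> H3) \<union> {?s}) (nb * 3)
        {\<lambda>a. ?s a * \<eta> ^ (\<Sum>b<nb. if \<not> bit (I a) b then (if k < b then 2 * 2 ^ b else 0) else 0)}"
      by (rule computes_pow[where M = M]) (use bits(2) v(2) B0 \<eta> in auto)
    from computes_then[OF sel[OF k v] this] show ?thesis
    proof (rule computes_cong)
      fix a
      have "(\<Sum>b<nb. if \<not> bit (I a) b then (if k < b then 2 * 2 ^ b else 0) else 0) = 2 * hi nb k (I a)"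
        unfolding hi_def sum_distrib_left by (intro sum.cong) auto
      then show "?s a * \<eta> ^ (\<Sum>b<nb. if \<not> bit (I a) b then (if k < b then 2 * 2 ^ b else 0) else 0)
          = (if splits k (e a) (I a) then \<eta> ^ (2 * hi nb k (I a)) * v a else 0)" by simp
    qed
  qed
  have gw_step: "computes X B (G \<union> H3) (1 + 1 + (nb * 3 + nb * 3)) {\<lambda>a. if splits k (e a) (I a) then z0 a * (gw nb \<eta> k (I a) * v a) else 0}"
    if k: "k < nb" and v: "v \<in> G \<union> H3" "\<And>a. a \<in> X \<Longrightarrow> 0 \<le> v a \<and> v a \<le> M" for k v
  proof -
    let ?s = "\<lambda>a. if splits k (e a) (I a) then v a else 0"
    let ?w = "\<lambda>a. if E a = I a then ?s a else 0"
    have "computes X B ((G \<union> H3) \<union> {?s}) 1 {?w}"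
      by (rule computes_gate[where v = ?s and p = "\<lambda>a. E a = I a" and M = M]) (use z03 v(2) B0 in auto)
    from computes_then[OF sel[OF k v] this] have w: "computes X B (G \<union> H3) (1 + 1) {?w}" .
    have "computes X B ((G \<union> H3) \<union> {?w}) (nb * 3 + nb * 3) {\<lambda>a. ?w a * gw nb \<eta> k (I a)}"
      by (rule computes_gw[where M = M]) (use bits(1,2) v(2) B0 \<eta> k in auto)
    from computes_then[OF w this] show ?thesis by (rule computes_cong) (simp add: z0_def)
  qed
  have unit_step: "computes X B (G \<union> H3) (nb * 3 + nb * 3) {\<lambda>a. if splits k (e a) (I a) then gw nb \<eta> k (I a) else 0}"
    if k: "k < nb" for k
  proof -
    have "computes X B (G \<union> H3) (nb * 3 + nb * 3) {\<lambda>a. of_bool (splits k (e a) (I a)) * gw nb \<eta> k (I a)}"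
      by (rule computes_gw[where M = M]) (use bits k B0 M \<eta> in auto)
    then show ?thesis by (rule computes_cong) simp
  qed
  have W_step: "computes X B (G \<union> H3) (1 + nb * 3) {\<lambda>a. if splits k (e a) (I a) then \<eta> ^ (2 * (I a mod 2 ^ k)) * W a else 0}"
    if k: "k < nb" for k
  proof -
    let ?s = "\<lambda>a. if splits k (e a) (I a) then W a else 0"
    have "computes X B ((G \<union> H3) \<union> {?s}) (nb * 3)
        {\<lambda>a. ?s a * \<eta> ^ (\<Sum>b<nb. if bit (I a) b then (if b < k then 2 * 2 ^ b else 0) else 0)}"
      by (rule computes_pow[where M = M]) (use bits(1) bnd(2) B0 \<eta> in auto)
    from computes_then[OF sel[OF k mem(1)] this] bnd(2)
    have "computes X B (G \<union> H3) (1 + nb * 3) {\<lambda>a. ?s a * \<eta> ^ (\<Sum>b<nb. if bit (I a) b then (if b < k then 2 * 2 ^ b else 0) else 0)}"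
      by blast
    then show ?thesis by (rule computes_cong) (use sum_low_bits[of k nb _ 2] k in simp)
  qed
  have Rp_step: "computes X B (G \<union> H3) ((1 + nb * 3) + (1 + (1 + 1 + (nb * 3 + nb * 3))) + 1) {Rp k}" if k: "k < nb" for k
  proof -
    let ?p = "\<lambda>a. if splits k (e a) (I a) then \<eta> ^ (2 * hi nb k (I a)) * Pp k a else 0"
    let ?q = "\<lambda>a. if splits k (e a) (I a) then Qm k a else 0"
    let ?f = "\<lambda>a. if splits k (e a) (I a) then z0 a * (gw nb \<eta> k (I a) * Fp a) else 0"
    have c: "computes X B (G \<union> H3) ((1 + nb * 3) + (1 + (1 + 1 + (nb * 3 + nb * 3)))) ({?p} \<union> ({?q} \<union> {?f}))"
      by (intro computes_Un hi_step sel gw_step k) (use bnd k in \<open>auto simp: G_def\<close>)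
    show ?thesis
    proof (rule computes_then[OF c], rule computes_lin3[where ?h1.0 = ?p and ?h2.0 = ?q and ?h3.0 = ?f and b = 0
          and ?q1.0 = 1 and ?q2.0 = "\<kappa> k" and ?q3.0 = "\<kappa> k"])
      fix a assume a: "a \<in> X"
      have "0 \<le> Rp k a" unfolding R using bnd[OF a] k \<kappa> gw0 \<eta> by (simp add: z0_def)
      moreover have "Rp k a = 0 + 1 * ?p a + \<kappa> k * ?q a + \<kappa> k * ?f a"
        unfolding R by (simp add: algebra_simps)
      ultimately show "Rp k a = max 0 (0 + 1 * ?p a + \<kappa> k * ?q a + \<kappa> k * ?f a)" by simp
    qed (use \<kappa>[of k] B0 in auto)
  qed
  have Rm_step: "computes X B (G \<union> H3)
      ((1 + nb * 3) + (1 + (1 + 1 + (nb * 3 + nb * 3)) + ((1 + nb * 3) + 1)) + 1) {Rm k}" if k: "k < nb" for k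
  proof -
    let ?p = "\<lambda>a. if splits k (e a) (I a) then \<eta> ^ (2 * hi nb k (I a)) * Pm k a else 0"
    let ?q = "\<lambda>a. if splits k (e a) (I a) then Qp k a else 0"
    let ?f = "\<lambda>a. if splits k (e a) (I a) then z0 a * (gw nb \<eta> k (I a) * Fm a) else 0"
    let ?w = "\<lambda>a. if splits k (e a) (I a) then \<eta> ^ (2 * (I a mod 2 ^ k)) * W a else 0"
    \<comment> \<open>The factor \<open>1 + z0\<close> is realized by adding \<open>?w\<close> and
      its copy gated by \<open>E a = I a\<close>.\<close>
    let ?v = "\<lambda>a. if E a = I a then ?w a else 0"
    define c where "c = \<eta> ^ (2 ^ nb - 2 ^ Suc k + 1)"
    have c01: "0 \<le> c" "c \<le> 1" using \<eta> by (auto simp: c_def intro!: power_le_one mult_le_one)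
    have w: "0 \<le> ?w a \<and> ?w a \<le> M" if "a \<in> X" for a
      using pw[of "W a"] bnd(2)[OF that] B0 by (auto simp: mult.commute)
    have "computes X B ((G \<union> H3) \<union> {?w}) 1 {?v}"
      by (rule computes_gate[where v = ?w and p = "\<lambda>a. E a = I a" and M = M, OF _ _ w]) (use z03 B0 in auto)
    then have w2: "computes X B (G \<union> H3) ((1 + nb * 3) + 1) ({?w} \<union> {?v})"
      by (intro computes_comp[OF W_step[OF k]])
    have c: "computes X B (G \<union> H3) ((1 + nb * 3) + (1 + (1 + 1 + (nb * 3 + nb * 3)) + ((1 + nb * 3) + 1)))
        ({?p} \<union> (({?q} \<union> {?f}) \<union> ({?w} \<union> {?v})))"
      by (intro computes_Un[OF _ computes_Un[OF computes_Un w2]] hi_step sel gw_step k) (use bnd k in \<open>auto simp: G_def\<close>)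
    show ?thesis
    proof (rule computes_then[OF c], rule computes_step[where ps = "[(1, ?p), (\<kappa> k, ?q), (\<kappa> k, ?f), (c, ?w), (c, ?v)]" and b = 0])
      fix a assume a: "a \<in> X"
      have "0 \<le> Rm k a" unfolding R using bnd[OF a] k \<kappa> gw0 \<eta> by (simp add: z0_def)
      moreover have "Rm k a = 1 * ?p a + (\<kappa> k * ?q a + (\<kappa> k * ?f a + (c * ?w a + c * ?v a)))"
        unfolding R by (simp add: z0_def c_def power_add algebra_simps)
      ultimately show "Rm k a = max 0 (0 + (\<Sum>(q, h)\<leftarrow>[(1, ?p), (\<kappa> k, ?q), (\<kappa> k, ?f), (c, ?w), (c, ?v)]. q * h a))"
        by simp
    qed (use \<kappa>[of k] c01 B0 in auto)
  qed
  have Ru_step: "computes X B (G \<union> H3) ((nb * 3 + nb * 3) + 1) {Ru k}" if k: "k < nb" for k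
    by (rule computes_then[OF unit_step[OF k]],
        rule computes_lin1[where ?h1.0 = "\<lambda>a. if splits k (e a) (I a) then gw nb \<eta> k (I a) else 0" and b = 0 and ?q1.0 = "\<kappa> k"])
      (use \<kappa>[of k] B0 gw0 in \<open>auto simp: R\<close>)
  let ?H4 = "Rp ` {..<nb} \<union> (Rm ` {..<nb} \<union> Ru ` {..<nb})"
  have "computes X B (G \<union> H3) (nb * ((1 + nb * 3) + (1 + (1 + 1 + (nb * 3 + nb * 3))) + 1) +
      (nb * ((1 + nb * 3) + (1 + (1 + 1 + (nb * 3 + nb * 3)) + ((1 + nb * 3) + 1)) + 1) + nb * ((nb * 3 + nb * 3) + 1))) ?H4"
    by (intro computes_Un computes_image Rp_step Rm_step Ru_step)
  from computes_comp[OF c3[folded H3_def] this]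
  have c4: "computes X B G (59 * (nb + 1) ^ 2) (H3 \<union> ?H4)"
    by (rule computes_mono) (auto simp: power2_eq_square algebra_simps)
  have pos: "0 \<le> Rp k a" "0 \<le> Rm k a" "0 \<le> Ru k a" if "k < nb" "a \<in> X" for k a
    using bnd[OF that(2)] that(1) \<kappa> gw0 \<eta> unfolding R by (auto simp: z0_def intro!: add_nonneg_nonneg mult_nonneg_nonneg)
  have "computes X B (G \<union> (H3 \<union> ?H4)) (1 + (1 + 1))
      ({\<lambda>a. \<Sum>k<nb. Rp k a} \<union> ({\<lambda>a. \<Sum>k<nb. Rm k a} \<union> {\<lambda>a. \<Sum>k<nb. Ru k a}))"
    by (intro computes_Un computes_sum nbB) (use pos in auto)
  from computes_then[OF c4 this] have "computes X B G (62 * (nb + 1) ^ 2)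
      ({\<lambda>a. \<Sum>k<nb. Rp k a} \<union> ({\<lambda>a. \<Sum>k<nb. Rm k a} \<union> {\<lambda>a. \<Sum>k<nb. Ru k a}))"
    by (rule computes_mono) (simp_all add: power2_eq_square)
  then show ?thesis unfolding R G_def by (simp add: insert_commute Un_commute)
qed

section \<open>Assembly of the two layers\<close>

text \<open>Allows a required function to be replaced by one that equals it only on
  \<open>X\<close>, such as the windowed count of COPY in place of the indicator of the positions
  from COPY on.\<close>

lemma computes_base:
  assumes "computes X B G n H" "\<And>g. g \<in> G \<Longrightarrow> \<exists>g'\<in>G'. \<forall>a\<in>X. g' a = g a"
  shows "computes X B G' n H"
  unfolding computes_def
proof (intro allI impI)
  fix gs assume G': "\<forall>g\<in>G'. agrees X gs g"
  have "agrees X gs g" if "g \<in> G" for g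
    using assms(2)[OF that] G' unfolding agrees_def by (metis (no_types, lifting))
  then show "\<exists>gs'. slp X B gs gs' \<and> length gs' \<le> length gs + n \<and> (\<forall>h\<in>H. agrees X gs' h)"
    using assms(1) unfolding computes_def by blast
qed

text \<open>Parameters of the constant kernel, of \<open>ck V l\<close>, of \<open>ck V (l + 1)\<close>, and of a kernel that is
  nearly \<open>l\<close>, since \<open>c * sin (l / c)\<close> tends to \<open>l\<close> for large \<open>c\<close>. The last one measures the
  distance to COPY with an error of at most 1/4, which the extraction of bits tolerates.\<close>

definition "kC = (1 :: real, 0 :: real, 0 :: real, 0 :: real)"
definition "kA = (1 :: real, 0 :: real, 1 / 4 :: real, 0 :: real)"
definition kB :: "nat \<Rightarrow> real \<times> real \<times> real \<times> real" where
  "kB V = (cos (pi / (2 * real (V + 1))), - sin (pi / (2 * real (V + 1))), 1 / 4, 1 / 4)"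
definition kD :: "nat \<Rightarrow> real \<times> real \<times> real \<times> real" where
  "kD V = (0, real (V + 1) ^ 2, 0, 1 / (2 * pi * real (V + 1)))"

lemma kern_kC: "kern V kC = (\<lambda>_. 1)"
  by (simp add: fun_eq_iff kC_def)

lemma kern_kA: "kern V kA = ck V"
proof
  fix l
  have "2 * pi * real l * (1 / 4) / real (V + 1) = pi * real l / (2 * real (V + 1))" by (simp add: field_simps)
  then show "kern V kA l = ck V l" by (simp only: kA_def kern.simps ck_def)
qed

text \<open>The shifted cosine lies in the filter family by the addition theorem; its cosine and
  sine coefficients are those of the angle of one step.\<close>

lemma kern_kB: "kern V (kB V) = (\<lambda>l. ck V (Suc l))"
proof
  fix l
  have e: "2 * pi * real l * (1 / 4) / real (V + 1) = pi * real l / (2 * real (V + 1))" by (simp add: field_simps)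
  have "pi * real (Suc l) / (2 * real (V + 1)) = pi * real l / (2 * real (V + 1)) + pi / (2 * real (V + 1))"
    by (simp add: add_divide_distrib distrib_left)
  then show "kern V (kB V) l = ck V (Suc l)"
    unfolding kB_def kern.simps ck_def e by (simp only: cos_add) simp
qed

lemma kern_kD: "kern V (kD V) l = real (V + 1) ^ 2 * sin (real l / real (V + 1) ^ 2)"
proof -
  have "2 * pi * real l * (1 / (2 * pi * real (V + 1))) / real (V + 1) = real l / real (V + 1) ^ 2"
    by (simp add: power2_eq_square)
  then show ?thesis by (simp only: kD_def kern.simps)
qed

text \<open>With \<open>c = (V + 1)^2\<close> and \<open>y = l / c\<close>, the Taylor bound
  \<open>y - y ^ 3 / 6 \<le> sin y\<close> gives an error of at most
  \<open>c * y ^ 3 / 6\<close>.\<close>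

lemma kern_kD_bounds:
  assumes "l \<le> V"
  shows "0 \<le> kern V (kD V) l" "real l - 1 / 4 \<le> kern V (kD V) l" "kern V (kD V) l \<le> real l"
proof -
  define c where "c = real (V + 1) ^ 2"
  define y where "y = real l / c"
  have c: "0 < c" "1 \<le> real (V + 1)" by (auto simp: c_def)
  have l: "real l = c * y" using c by (simp add: y_def)
  have "real (V + 1) * 1 \<le> c" unfolding c_def power2_eq_square using c by (intro mult_left_mono) auto
  then have y: "0 \<le> y" "y \<le> 1" using c assms by (auto simp: y_def field_simps)
  have k: "kern V (kD V) l = c * sin y" by (simp add: kern_kD c_def y_def)
  show "kern V (kD V) l \<le> real l" unfolding k l using c sin_x_le_x[OF y(1)] by simp
  have "0 \<le> sin y" using y pi_gt3 by (intro sin_ge_zero) auto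
  then show "0 \<le> kern V (kD V) l" unfolding k using c by simp
  have "\<bar>sin y - (\<Sum>m<3. sin_coeff m * y ^ m)\<bar> \<le> inverse (fact 3) * \<bar>y\<bar> ^ 3" by (rule Maclaurin_sin_bound)
  moreover have "(\<Sum>m<3. sin_coeff m * y ^ m) = y" by (simp add: numeral_eq_Suc sin_coeff_def)
  moreover have "fact 3 = (6 :: real)" by (simp add: numeral_eq_Suc)
  ultimately have "\<bar>sin y - y\<bar> \<le> y ^ 3 / 6" using y by simp
  then have "y - y ^ 3 / 6 \<le> sin y" by linarith
  then have "c * (y - y ^ 3 / 6) \<le> c * sin y" using c by (intro mult_left_mono) auto
  \<comment> \<open>The left side is \<open>l ^ 3 / c ^ 2\<close> with \<open>l \<le> V\<close>, so
    the error is at most 1/6.\<close>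
  moreover have "c * y ^ 3 \<le> 1"
  proof -
    have "real l * real l ^ 2 \<le> real (V + 1) ^ 2 * real (V + 1) ^ 2"
      unfolding power2_eq_square using assms c
      by (intro mult_mono) (auto intro: order_trans[of _ "real V"] order_trans[of _ "real (V + 1) * 1"] mult_left_mono)
    then have "real l ^ 3 \<le> c ^ 2" by (simp add: c_def power2_eq_square power3_eq_cube mult_ac)
    then show ?thesis using c by (simp add: y_def power_divide power2_eq_square power3_eq_cube field_simps)
  qed
  ultimately show "real l - 1 / 4 \<le> kern V (kD V) l" unfolding k l by (simp add: right_diff_distrib)
qed

text \<open>The score of \<open>w\<close> is proportional to \<open>w R - w\<^sup>2 u / 2\<close>, which among integers is largest for the
  \<open>w\<close> closest to \<open>R / u\<close>.\<close>

definition score_weights :: "nat \<Rightarrow> nat \<Rightarrow> nat \<Rightarrow> nat \<Rightarrow> nat \<Rightarrow> real mat" where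
  "score_weights D N r1 r2 r3 = mat D N (\<lambda>(r, w). (of_bool (r = r1) * real w - of_bool (r = r2) * real w
     - of_bool (r = r3) * (real w ^ 2 / 2)) / (4 * real N ^ 2))"

text \<open>The common divisor \<open>4 * N ^ 2\<close> keeps the entries in [-1, 1] and does not
  affect the order of the scores.\<close>

lemma score_weights_norm: "mat_inf_norm (score_weights D N r1 r2 r3) \<le> 1"
proof (rule mat_inf_norm_le[of _ D N])
  fix r w assume rw: "r < D" "w < N"
  then have N: "1 \<le> real N" "real w \<le> real N" by auto
  have w: "real w ^ 2 \<le> real N ^ 2" using N by (intro power_mono) auto
  have N2: "real N \<le> real N ^ 2" unfolding power2_eq_square using mult_left_mono[OF N(1), of "real N"] by simp
  have "\<bar>of_bool (r = r1) * real w - of_bool (r = r2) * real w - of_bool (r = r3) * (real w ^ 2 / 2)\<bar>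
      \<le> real w + real w + real w ^ 2 / 2"
  proof -
    have "0 \<le> of_bool b * c \<and> of_bool b * c \<le> c" if "0 \<le> c" for b and c :: real using that by simp
    from this[of "real w" "r = r1"] this[of "real w" "r = r2"] this[of "real w ^ 2 / 2" "r = r3"]
    show ?thesis using of_nat_0_le_iff[of w] zero_le_power2[of "real w"] by linarith
  qed
  also have "\<dots> \<le> 1 * (4 * real N ^ 2)" using N w N2 by linarith
  finally show "\<bar>score_weights D N r1 r2 r3 $$ (r, w)\<bar> \<le> 1"
    using rw N by (simp add: score_weights_def abs_divide divide_le_eq)
qed (auto simp: score_weights_def)

lemma score_weights_eval:
  assumes "r1 < D" "r2 < D" "r3 < D" "w < N" "y \<in> carrier_vec D"
  shows "(transpose_mat (score_weights D N r1 r2 r3) *\<^sub>v y) $ w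
    = (real w * (y $ r1 - y $ r2) - real w ^ 2 / 2 * y $ r3) / (4 * real N ^ 2)"
proof -
  let ?c = "4 * real N ^ 2"
  have "(transpose_mat (score_weights D N r1 r2 r3) *\<^sub>v y) $ w
      = (\<Sum>r\<in>{0..<D}. score_weights D N r1 r2 r3 $$ (r, w) * y $ r)"
    using assms(4,5) by (simp add: score_weights_def scalar_prod_def)
  also have "\<dots> = (\<Sum>r\<in>{0..<D}. (if r = r1 then real w * y $ r / ?c else 0)
      - (if r = r2 then real w * y $ r / ?c else 0) - (if r = r3 then real w ^ 2 / 2 * y $ r / ?c else 0))"
  proof (intro sum.cong refl)
    fix r assume "r \<in> {0..<D}"
    then have s: "score_weights D N r1 r2 r3 $$ (r, w) = of_bool (r = r1) * (real w / ?c)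
        - of_bool (r = r2) * (real w / ?c) - of_bool (r = r3) * (real w ^ 2 / 2 / ?c)"
      using assms(4) by (simp add: score_weights_def diff_divide_distrib)
    show "score_weights D N r1 r2 r3 $$ (r, w) * y $ r = (if r = r1 then real w * y $ r / ?c else 0)
      - (if r = r2 then real w * y $ r / ?c else 0) - (if r = r3 then real w ^ 2 / 2 * y $ r / ?c else 0)"
      unfolding s left_diff_distrib by (intro arg_cong2[of _ _ _ _ "(-)"]) simp_all
  qed
  also have "\<dots> = real w * y $ r1 / ?c - real w * y $ r2 / ?c - real w ^ 2 / 2 * y $ r3 / ?c"
    using assms(1-3) by (simp add: sum_subtractf)
  finally show ?thesis by (simp add: diff_divide_distrib right_diff_distrib)
qed

text \<open>With \<open>n = x - w\<close> and \<open>d = R - u * x\<close>, the scores differ by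
  \<open>n ^ 2 * u / 2 + n * d\<close> before division by \<open>c\<close>, which is positive as
  \<open>\<bar>d\<bar> < u / 2\<close> and \<open>\<bar>n\<bar> \<ge> 1\<close>. The maximum is
  strict, so ties need no care.\<close>

lemma arg_max_score:
  fixes R u c :: real
  assumes "0 < u" "0 < c" "\<bar>R - u * real x\<bar> < u / 2" "x < N"
    and f: "\<And>w. w < N \<Longrightarrow> f w = (real w * R - real w ^ 2 / 2 * u) / c"
  shows "arg_max f (\<lambda>w. w < N) = x"
proof -
  have less: "f w < f x" if "w < N" "w \<noteq> x" for w
  proof -
    define n where "n = real x - real w"
    define d where "d = R - u * real x"
    have "1 \<le> \<bar>int x - int w\<bar>" using that by linarith
    then have "real_of_int 1 \<le> real_of_int \<bar>int x - int w\<bar>" by (rule of_int_le_iff[THEN iffD2])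
    then have n1: "1 \<le> \<bar>n\<bar>" by (simp add: n_def)
    have "(real x * R - real x ^ 2 / 2 * u) - (real w * R - real w ^ 2 / 2 * u) = n ^ 2 * u / 2 + n * d"
      unfolding n_def d_def by (simp add: power2_eq_square field_simps)
    moreover have "- (n * d) \<le> \<bar>n\<bar> * \<bar>d\<bar>" by (metis abs_ge_minus_self abs_mult)
    moreover have "\<bar>n\<bar> * \<bar>d\<bar> < \<bar>n\<bar> * (u / 2)" using n1 assms(3) by (intro mult_strict_left_mono) (auto simp: d_def)
    moreover have "\<bar>n\<bar> * (u / 2) \<le> \<bar>n\<bar> * \<bar>n\<bar> * (u / 2)"
    proof (rule mult_right_mono)
      show "\<bar>n\<bar> \<le> \<bar>n\<bar> * \<bar>n\<bar>" using mult_right_mono[OF n1, of "\<bar>n\<bar>"] by simp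
    qed (use assms(1) in simp)
    moreover have "\<bar>n\<bar> * \<bar>n\<bar> * (u / 2) = n ^ 2 * u / 2" by (simp add: power2_eq_square)
    ultimately have "real w * R - real w ^ 2 / 2 * u < real x * R - real x ^ 2 / 2 * u" by linarith
    then show ?thesis unfolding f[OF that(1)] f[OF assms(4)] using assms(2) by (rule divide_strict_right_mono)
  qed
  show ?thesis unfolding arg_max_def
  proof (rule some_equality)
    show "is_arg_max f (\<lambda>w. w < N) x" using less assms(4) by (force simp: is_arg_max_linorder)
    fix w assume "is_arg_max f (\<lambda>w. w < N) w"
    then show "w = x" using less assms(4) by (force simp: is_arg_max_linorder)
  qed
qed

section \<open>Concrete parameters and the first layer\<close>

locale copier =
  fixes N BOS COPY V nb :: nat
  assumes words: "BOS < N" "COPY < N" "BOS \<noteq> COPY"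
    and V: "1 \<le> V" and nb: "V + 2 \<le> 2 ^ nb" "2 ^ nb \<le> 2 * (V + 2)"
begin

text \<open>The factor 16 makes the product required in \<open>copy_seq\<close> equal to 3/4.
  \<open>M\<close> bounds the window sums of the second layer, where up to \<open>V + 1\<close>
  values of size at most \<open>(V + 1) * N\<close> are added. \<open>Bd\<close> dominates
  \<open>M + 5\<close> and \<open>4 * 2 ^ nb + 5\<close>, and \<open>D\<close> leaves room for the
  channels and assignments of either program.\<close>

definition "\<eta> = 1 / (16 * real (V + 1) ^ 2 * real N)"
definition "M = real (V + 1) ^ 2 * real N"
definition "Bd = 30 * real (V + 2) ^ 2 * real N"
definition "D = 80 * (nb + 1) ^ 2"

text \<open>The pair \<open>(x, i)\<close> stands for the input after \<open>i\<close> correct predictions for the prompt words \<open>x\<close>.\<close>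

definition S :: "(nat list \<times> nat) set" where
  "S = {(x, i). set x \<subseteq> {..<N} - {BOS, COPY} \<and> length x \<le> V \<and> i < length x}"
definition ws :: "nat list \<times> nat \<Rightarrow> nat list" where
  "ws a = BOS # fst a @ COPY # take (snd a) (fst a)"
definition pp :: "nat list \<times> nat \<Rightarrow> nat" where "pp a = length (fst a)"
definition tt :: "nat list \<times> nat \<Rightarrow> nat" where "tt a = pp a + 1 + snd a"
text \<open>BOS occupies position 0, so the prompt word with index \<open>j\<close> is at
  \<open>j + 1\<close> and its copy at \<open>pp a + 2 + j\<close>. Zeros past the last token make
  the function total.\<close>

definition zz :: "nat list \<times> nat \<Rightarrow> nat \<Rightarrow> real" where
  "zz a s = (if s = 0 \<or> s = pp a + 1 then 0 else if s \<le> pp a then real (fst a ! (s - 1))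
     else if s - pp a - 2 < snd a then real (fst a ! (s - pp a - 2)) else 0)"

lemma N1: "1 \<le> real N" using words by simp

lemma V1: "real (V + 1) \<le> real (V + 1) ^ 2" "1 \<le> real (V + 1) ^ 2"
proof -
  have "1 \<le> real (V + 1)" by simp
  then show "real (V + 1) \<le> real (V + 1) ^ 2" "1 \<le> real (V + 1) ^ 2"
    unfolding power2_eq_square
    using mult_left_mono[of 1 "real (V + 1)" "real (V + 1)"] mult_mono[of 1 "real (V + 1)" 1 "real (V + 1)"]
    by (simp_all only: mult_1_right)
qed

lemma \<eta>: "0 < \<eta>" "\<eta> \<le> 1" "\<eta> * (12 * real (V + 1) ^ 2 * real N) < 1"
proof -
  define c where "c = real (V + 1) ^ 2 * real N"
  have c: "1 \<le> c" unfolding c_def using mult_mono[OF V1(2) N1] by simp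
  have e: "\<eta> = 1 / (16 * c)" by (simp add: \<eta>_def c_def mult.assoc)
  show "0 < \<eta>" "\<eta> \<le> 1" unfolding e using c by auto
  have "\<eta> * (12 * c) < 1" unfolding e using c by simp
  then show "\<eta> * (12 * real (V + 1) ^ 2 * real N) < 1" by (simp add: c_def mult.assoc)
qed

lemma M: "1 \<le> M" "M + 5 \<le> Bd" "4 * 2 ^ nb + 5 \<le> Bd" "real (V + 1) ^ 2 \<le> Bd" "real N \<le> Bd" "real (V + 1) \<le> M"
  "real (V + 1) * real N \<le> M"
proof -
  show 1: "1 \<le> M" unfolding M_def using mult_mono[OF V1(2) N1] by simp
  show 2: "real (V + 1) \<le> M" unfolding M_def using mult_mono[OF V1(1) N1] by simp
  show "real (V + 1) * real N \<le> M" unfolding M_def using V1(1) by (intro mult_right_mono) auto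
  have "real (V + 1) ^ 2 \<le> real (V + 2) ^ 2" by (intro power_mono) auto
  then have "M \<le> real (V + 2) ^ 2 * real N" unfolding M_def by (intro mult_right_mono) auto
  then have MB: "30 * M \<le> Bd" by (simp add: Bd_def)
  show "M + 5 \<le> Bd" using MB 1 by linarith
  have "real (2 ^ nb) \<le> real (2 * (V + 2))" using nb(2) by (rule of_nat_mono)
  then have "(2::real) ^ nb \<le> 2 * real (V + 1) + 2" by simp
  then have "4 * 2 ^ nb + 5 \<le> 8 * real (V + 1) + 13" by simp
  also have "\<dots> \<le> 8 * M + 13 * M" using 1 mult_left_mono[OF 2, of 8] by (intro add_mono) auto
  also have "\<dots> \<le> Bd" using MB 1 by linarith
  finally show "4 * 2 ^ nb + 5 \<le> Bd" .
  have "real (V + 1) ^ 2 \<le> M" unfolding M_def using mult_left_mono[OF N1, of "real (V + 1) ^ 2"] by simp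
  then show "real (V + 1) ^ 2 \<le> Bd" using MB 1 by linarith
  have "real N \<le> M" unfolding M_def using mult_right_mono[OF V1(2), of "real N"] by simp
  then show "real N \<le> Bd" using MB 1 by linarith
qed

lemma Bd1: "1 \<le> Bd" "0 \<le> M" "M + 2 \<le> Bd" using M by linarith+

lemma S_D: "a \<in> S \<Longrightarrow> snd a < pp a" "a \<in> S \<Longrightarrow> pp a \<le> V" "a \<in> S \<Longrightarrow> j < pp a \<Longrightarrow> fst a ! j < N"
  "a \<in> S \<Longrightarrow> j < pp a \<Longrightarrow> fst a ! j \<noteq> BOS" "a \<in> S \<Longrightarrow> j < pp a \<Longrightarrow> fst a ! j \<noteq> COPY"
proof -
  assume a: "a \<in> S"
  show "snd a < pp a" "pp a \<le> V" using a by (auto simp: S_def pp_def)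
  assume j: "j < pp a"
  have "set (fst a) \<subseteq> {..<N} - {BOS, COPY}" using a by (cases a) (simp add: S_def)
  then have "fst a ! j \<in> {..<N} - {BOS, COPY}" using j nth_mem[of j "fst a"] by (auto simp: pp_def simp del: nth_mem)
  then show "fst a ! j < N" "fst a ! j \<noteq> BOS" "fst a ! j \<noteq> COPY" by auto
qed

lemma ws_props:
  assumes "a \<in> S"
  shows "length (ws a) = Suc (tt a)" "set (ws a) \<subseteq> {..<N}"
    "s < Suc (tt a) \<Longrightarrow> ws a ! s = (if s = 0 then BOS else if s = pp a + 1 then COPY
       else if s \<le> pp a then fst a ! (s - 1) else fst a ! (s - pp a - 2))"
proof -
  show "length (ws a) = Suc (tt a)" using S_D(1)[OF assms] by (simp add: ws_def tt_def pp_def)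
  show "set (ws a) \<subseteq> {..<N}"
  proof -
    have "set (fst a) \<subseteq> {..<N}" using assms by (cases a) (auto simp: S_def)
    then show ?thesis using words set_take_subset[of "snd a" "fst a"] unfolding ws_def by auto
  qed
  assume s: "s < Suc (tt a)"
  show "ws a ! s = (if s = 0 then BOS else if s = pp a + 1 then COPY
       else if s \<le> pp a then fst a ! (s - 1) else fst a ! (s - pp a - 2))"
    using s S_D(1)[OF assms]
    by (auto simp: ws_def nth_Cons nth_append pp_def tt_def split: nat.splits
        intro!: arg_cong[where f = "(!) (fst a)"])
qed

lemma seq: "a \<in> S \<Longrightarrow> copy_seq V (pp a) (snd a) nb (real N) \<eta> (zz a)"
proof
  assume a: "a \<in> S"
  note D = S_D(1,2,3)[OF a]
  show "snd a < pp a" "pp a \<le> V" by fact+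
  show "zz a 0 = 0" by (simp add: zz_def)
  show "0 \<le> zz a s \<and> zz a s \<le> real N" for s
    using D(1) less_imp_le[OF D(3)[of "s - 1"]] less_imp_le[OF D(3)[of "s - pp a - 2"]] by (auto simp: zz_def)
  show "zz a (pp a + 1 + j) = zz a j" if "j \<le> snd a" for j
    using that D(1) by (cases j) (auto simp: zz_def)
qed (use N1 nb \<eta> in auto)

text \<open>The three coordinates carry the number of an ordinary word, the indicator of an ordinary
  word, and the indicator of COPY. The test \<open>w < N\<close> makes the weight bound hold for
  every argument.\<close>

definition emb_coeff :: "nat \<Rightarrow> nat \<Rightarrow> real" where
  "emb_coeff k w = (if k = 0 then (if w < N \<and> w \<noteq> BOS \<and> w \<noteq> COPY then real w else 0)
     else if k = 1 then of_bool (w \<noteq> BOS \<and> w \<noteq> COPY) else of_bool (k = 2 \<and> w = COPY))"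

lemma emb_coeff_le: "\<bar>emb_coeff k w\<bar> \<le> Bd"
  using M(5) Bd1(1) by (auto simp: emb_coeff_def intro: order_trans[of _ "real N"])

definition "hz = (\<lambda>(a, s). zz a s)"
definition "ho = (\<lambda>(a, s). of_bool (0 < s \<and> s \<noteq> pp a + 1) :: real)"
definition "hc = (\<lambda>(a, s). of_bool (s = pp a + 1) :: real)"

lemma emb_values:
  assumes "a \<in> S" "s < Suc (tt a)"
  shows "emb_coeff 0 (ws a ! s) = hz (a, s)" "emb_coeff 1 (ws a ! s) = ho (a, s)" "emb_coeff 2 (ws a ! s) = hc (a, s)"
proof -
  have "s - 1 < pp a" if "s \<le> pp a" "s \<noteq> 0" using that by simp
  moreover have "s - pp a - 2 < snd a" "s - pp a - 2 < pp a" if "\<not> s \<le> pp a" "s \<noteq> pp a + 1"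
    using that assms(2) S_D(1)[OF assms(1)] by (auto simp: tt_def)
  ultimately show "emb_coeff 0 (ws a ! s) = hz (a, s)" "emb_coeff 1 (ws a ! s) = ho (a, s)"
    "emb_coeff 2 (ws a ! s) = hc (a, s)"
    using S_D(3-5)[OF assms(1)] words unfolding ws_props(3)[OF assms]
    by (auto simp: emb_coeff_def hz_def ho_def hc_def zz_def)
qed

definition "Z1 = {(a, s). a \<in> S \<and> s < Suc (tt a)}"
definition "Z2 = {(a, s). a \<in> S \<and> s = tt a}"

definition chan :: "((nat list \<times> nat) \<times> nat \<Rightarrow> real) \<times> (real \<times> real \<times> real \<times> real) \<Rightarrow> (nat list \<times> nat) \<times> nat \<Rightarrow> real" where
  "chan = (\<lambda>(h, p) (a, s). wsum V (kern V p) (\<lambda>s'. h (a, s')) s)"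

definition "AA a = wsum V (ck V) (zz a)"
definition "BB a = wsum V (\<lambda>l. ck V (Suc l)) (zz a)"

definition "ePp k = (\<lambda>(a, s). emPp (pp a) \<eta> k (AA a) s)"
definition "ePm k = (\<lambda>(a, s). emPm (pp a) \<eta> k (BB a) s)"
definition "eQp k = (\<lambda>(a, s). emQp nb (pp a) \<eta> k (AA a) s)"
definition "eQm k = (\<lambda>(a, s). emQm nb (pp a) \<eta> k (BB a) s)"
definition "eW = (\<lambda>(a, s). emW nb (pp a) \<eta> (BB a) s)"
definition "eFp = (\<lambda>(a, s). emFp (pp a) (BB a) s)"
definition "eFm = (\<lambda>(a, s). emFm (pp a) (AA a) s)"
definition "ecp = (\<lambda>(a, s). of_bool (pp a < s) :: real)"
definition "encp = (\<lambda>(a, s). of_bool (\<not> pp a < s) :: real)"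
definition "eVp = (\<lambda>(a, s). if s = pp a + 1 then real (pp a) else 0)"

definition "chs1 = [(hz, kA), (hz, kB V), (ho, kC), (hc, kC), (hc, kD V)]"
definition "emitted = ePp ` {..<nb} \<union> ePm ` {..<nb} \<union> eQp ` {..<nb} \<union> eQm ` {..<nb} \<union> {eW, eFp, eFm, ecp, encp, eVp}"

lemma AB_bounds:
  assumes "a \<in> S"
  shows "0 \<le> AA a s \<and> AA a s \<le> real (V + 1) * real N" "0 \<le> BB a s \<and> BB a s \<le> real (V + 1) * real N"
proof -
  interpret copy_seq V "pp a" "snd a" nb "real N" \<eta> "zz a" by (rule seq[OF assms])
  show "0 \<le> AA a s \<and> AA a s \<le> real (V + 1) * real N" "0 \<le> BB a s \<and> BB a s \<le> real (V + 1) * real N"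
    using AB_bounds unfolding AA_def BB_def A_def B_def by auto
qed

text \<open>Up to COPY the window can miss at most position 0, which holds BOS and is not counted,
  so the count of ordinary words is exact. COPY never leaves the window, so its filtered indicator
  reports its presence and its distance.\<close>

lemma counts:
  assumes "a \<in> S" "s < Suc (tt a)"
  shows "s \<le> pp a \<Longrightarrow> chan (ho, kC) (a, s) = real s"
    "s = pp a + 1 \<Longrightarrow> chan (ho, kC) (a, s) = real (pp a)"
    "0 \<le> chan (ho, kC) (a, s) \<and> chan (ho, kC) (a, s) \<le> M"
    "chan (hc, kC) (a, s) = of_bool (pp a < s)"
    "chan (hc, kD V) (a, s) = (if pp a < s then kern V (kD V) (s - pp a - 1) else 0)"
proof -
  have le: "s - V \<le> pp a + 1" "s - V \<le> 1 \<or> pp a + 1 < s" using assms S_D(1,2)[OF assms(1)] by (auto simp: tt_def)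
  have w: "chan (h, kC) (a, s) = (\<Sum>s' = s - V..s. h (a, s'))" for h
    by (simp add: chan_def kern_kC wsum_window)
  have c: "chan (ho, kC) (a, s) = real (card ({s - V..s} \<inter> {s'. 0 < s' \<and> s' \<noteq> pp a + 1}))"
    unfolding w by (simp add: ho_def)
  show "chan (ho, kC) (a, s) = real s" if s: "s \<le> pp a"
  proof -
    have "{s - V..s} \<inter> {s'. 0 < s' \<and> s' \<noteq> pp a + 1} = {1..s}"
      using s S_D(2)[OF assms(1)] by auto
    then show ?thesis unfolding c by simp
  qed
  show "chan (ho, kC) (a, s) = real (pp a)" if s: "s = pp a + 1"
  proof -
    have "{s - V..s} \<inter> {s'. 0 < s' \<and> s' \<noteq> pp a + 1} = {1..pp a}"
      using s S_D(2)[OF assms(1)] by auto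
    then show ?thesis unfolding c by simp
  qed
  have "0 \<le> wsum V (\<lambda>_. 1) (\<lambda>s'. ho (a, s')) s \<and> wsum V (\<lambda>_. 1) (\<lambda>s'. ho (a, s')) s \<le> real (V + 1) * 1"
    by (rule wsum_bounds) (auto simp: ho_def)
  then show "0 \<le> chan (ho, kC) (a, s) \<and> chan (ho, kC) (a, s) \<le> M"
    using M(6) by (simp add: chan_def kern_kC)
  have "{s - V..s} \<inter> {s'. s' = pp a + 1} = (if pp a < s then {pp a + 1} else {})" using le(1) by auto
  then show "chan (hc, kC) (a, s) = of_bool (pp a < s)" unfolding w by (simp add: hc_def)
  have "chan (hc, kD V) (a, s) = (\<Sum>s' = s - V..s. kern V (kD V) (s - s') * of_bool (s' = pp a + 1))"
    by (simp add: chan_def wsum_window hc_def)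
  also have "\<dots> = (\<Sum>s' = s - V..s. if s' = pp a + 1 then kern V (kD V) (s - s') else 0)"
    by (intro sum.cong) auto
  also have "\<dots> = (if pp a < s then kern V (kD V) (s - pp a - 1) else 0)"
    using le(1) by (auto simp: sum.delta)
  finally show "chan (hc, kD V) (a, s) = (if pp a < s then kern V (kD V) (s - pp a - 1) else 0)" .
qed

lemma layer1_computes: "computes Z1 Bd (chan ` set chs1) (40 * (nb + 1) ^ 2) emitted"
proof -
  let ?A = "chan (hz, kA)" and ?B = "chan (hz, kB V)" and ?c = "chan (ho, kC)" and ?d = "chan (hc, kD V)"
  let ?q = "\<lambda>(a, s). if s \<le> pp a then s else s - pp a - 1" and ?cp = "\<lambda>(a, s). pp a < s" and ?p = "\<lambda>(a, s). pp a"
  have AB: "?A (a, s) = AA a s" "?B (a, s) = BB a s" for a s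
    by (simp_all add: chan_def kern_kA kern_kB AA_def BB_def hz_def)
  have NM: "x \<le> real (V + 1) * real N \<Longrightarrow> x \<le> M" for x using M(7) by linarith
  have "computes Z1 Bd {?A, ?B, ?c, \<lambda>a. of_bool (?cp a), ?d} (40 * (nb + 1) ^ 2)
    ((\<lambda>k a. if \<not> ?cp a \<and> bit (?q a) k then \<eta> ^ ?q a * ?A a else 0) ` {..<nb} \<union>
     (\<lambda>k a. if \<not> ?cp a \<and> bit (Suc (?q a)) k then \<eta> ^ Suc (?q a) * ?B a else 0) ` {..<nb} \<union>
     (\<lambda>k a. if ?cp a \<and> bit (?q a) k then gw nb \<eta> k (?q a) * ?A a else 0) ` {..<nb} \<union>
     (\<lambda>k a. if ?cp a \<and> bit (Suc (?q a)) k then gw nb \<eta> k (Suc (?q a)) * ?B a else 0) ` {..<nb} \<union>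
     {\<lambda>a. if ?cp a then \<eta> ^ (2 ^ nb - 1 - Suc (?q a)) * ?B a else 0,
      \<lambda>a. if ?cp a then ?B a else 0, \<lambda>a. if ?cp a \<and> ?q a \<noteq> 0 then ?A a else 0,
      \<lambda>a. of_bool (?cp a), \<lambda>a. of_bool (\<not> ?cp a), \<lambda>a. if ?cp a \<and> ?q a = 0 then real (?p a) else 0})"
    (is "computes _ _ ?G _ ?H")
  proof (rule emission_program[where M = M])
    fix z assume "z \<in> Z1"
    then obtain a s where z: "z = (a, s)" "a \<in> S" "s < Suc (tt a)" by (auto simp: Z1_def)
    note D = S_D(1,2)[OF z(2)]
    note c = counts[OF z(2,3)]
    have l: "s - pp a - 1 \<le> V" using D z(3) by (simp add: tt_def)
    show "Suc (?q z) < 2 ^ nb" using D z nb by (auto simp: tt_def)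
    show "?c z = real (?q z) \<and> ?d z = 0" if "\<not> ?cp z" using c that by (simp add: z)
    show "0 \<le> ?d z \<and> real (?q z) - 1 / 4 \<le> ?d z \<and> ?d z \<le> real (?q z)" if "?cp z"
      using c(5) kern_kD_bounds[OF l] that by (simp add: z)
    show "?c z = real (?p z)" if "?cp z" "?q z = 0"
      using c(2) that by (cases "s = pp a + 1") (auto simp: z split: if_splits)
    show "0 \<le> ?c z \<and> ?c z \<le> M" using c(3) by (simp add: z)
    show "0 \<le> ?A z \<and> ?A z \<le> M" "0 \<le> ?B z \<and> ?B z \<le> M"
      using AB_bounds[OF z(2)] NM by (auto simp: z AB)
  qed (use Bd1 M \<eta> in auto)
  then have "computes Z1 Bd (chan ` set chs1) (40 * (nb + 1) ^ 2) ?H"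
  proof (rule computes_base)
    fix g assume "g \<in> ?G"
    then consider "g \<in> {?A, ?B, ?c, ?d}" | "g = (\<lambda>a. of_bool (?cp a))" by blast
    then show "\<exists>g'\<in>chan ` set chs1. \<forall>a\<in>Z1. g' a = g a"
    proof cases
      case 1
      then have "g \<in> chan ` set chs1" by (auto simp: chs1_def)
      then show ?thesis by blast
    next
      case 2
      then show ?thesis using counts(4) by (intro bexI[of _ "chan (hc, kC)"]) (auto simp: chs1_def Z1_def)
    qed
  qed
  then show ?thesis
  proof (rule computes_mono)
    have "ePp = (\<lambda>k a. if \<not> ?cp a \<and> bit (?q a) k then \<eta> ^ ?q a * ?A a else 0)"
      by (auto simp: fun_eq_iff ePp_def emPp_def AB)
    moreover have "ePm = (\<lambda>k a. if \<not> ?cp a \<and> bit (Suc (?q a)) k then \<eta> ^ Suc (?q a) * ?B a else 0)"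
      by (auto simp: fun_eq_iff ePm_def emPm_def AB)
    moreover have "eQp = (\<lambda>k a. if ?cp a \<and> bit (?q a) k then gw nb \<eta> k (?q a) * ?A a else 0)"
      by (auto simp: fun_eq_iff eQp_def emQp_def AB)
    moreover have "eQm = (\<lambda>k a. if ?cp a \<and> bit (Suc (?q a)) k then gw nb \<eta> k (Suc (?q a)) * ?B a else 0)"
      by (auto simp: fun_eq_iff eQm_def emQm_def AB Suc_diff_Suc)
    moreover have "eW = (\<lambda>a. if ?cp a then \<eta> ^ (2 ^ nb - 1 - Suc (?q a)) * ?B a else 0)"
      by (auto simp: fun_eq_iff eW_def emW_def AB Suc_diff_Suc)
    moreover have "eFp = (\<lambda>a. if ?cp a then ?B a else 0)" by (auto simp: fun_eq_iff eFp_def emFp_def AB)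
    moreover have "eFm = (\<lambda>a. if ?cp a \<and> ?q a \<noteq> 0 then ?A a else 0)" by (auto simp: fun_eq_iff eFm_def emFm_def AB)
    moreover have "ecp = (\<lambda>a. of_bool (?cp a))" "encp = (\<lambda>a. of_bool (\<not> ?cp a))"
      by (auto simp: fun_eq_iff ecp_def encp_def)
    moreover have "eVp = (\<lambda>a. if ?cp a \<and> ?q a = 0 then real (?p a) else 0)" by (auto simp: fun_eq_iff eVp_def)
    ultimately show "emitted \<subseteq> ?H" unfolding emitted_def by simp
  qed auto
qed

end

section \<open>The second layer and the complete model\<close>

context copier
begin

definition "chs2 = map (\<lambda>k. (ePp k, kC)) [0..<nb] @ map (\<lambda>k. (ePm k, kC)) [0..<nb]
  @ map (\<lambda>k. (eQp k, kC)) [0..<nb] @ map (\<lambda>k. (eQm k, kC)) [0..<nb]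
  @ [(eW, kC), (eFp, kA), (eFm, kB V), (ecp, kC), (encp, kC), (eVp, kC)]"

definition I2 :: "(nat list \<times> nat) \<times> nat \<Rightarrow> nat" where "I2 = (\<lambda>(a, s). Suc (snd a))"
definition E2 :: "(nat list \<times> nat) \<times> nat \<Rightarrow> nat" where "E2 = (\<lambda>(a, s). s - V)"

definition "rp = (\<lambda>z. \<Sum>k<nb. if splits k (E2 z - of_bool (E2 z = I2 z)) (I2 z)
  then \<eta> ^ (2 * hi nb k (I2 z)) * chan (ePp k, kC) z + \<eta> ^ (2 ^ nb - 2 ^ k) * chan (eQm k, kC) z
    + of_bool (E2 z = I2 z) * (\<eta> ^ (2 ^ nb - 2 ^ k) * gw nb \<eta> k (I2 z) * chan (eFp, kA) z) else 0)"
definition "rm = (\<lambda>z. \<Sum>k<nb. if splits k (E2 z - of_bool (E2 z = I2 z)) (I2 z)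
  then \<eta> ^ (2 * hi nb k (I2 z)) * chan (ePm k, kC) z + \<eta> ^ (2 ^ nb - 2 ^ k) * chan (eQp k, kC) z
    + (1 + of_bool (E2 z = I2 z)) * (\<eta> ^ (2 * (I2 z mod 2 ^ k) + (2 ^ nb - 2 ^ Suc k + 1)) * chan (eW, kC) z)
    + of_bool (E2 z = I2 z) * (\<eta> ^ (2 ^ nb - 2 ^ k) * gw nb \<eta> k (I2 z) * chan (eFm, kB V) z) else 0)"
definition "ru = (\<lambda>z. \<Sum>k<nb. if splits k (E2 z - of_bool (E2 z = I2 z)) (I2 z)
  then \<eta> ^ (2 ^ nb - 2 ^ k) * gw nb \<eta> k (I2 z) else 0)"

lemma emitted_bounds:
  assumes "a \<in> S"
  shows "0 \<le> ePp k (a, s) \<and> ePp k (a, s) \<le> real (V + 1) * real N"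
    "0 \<le> ePm k (a, s) \<and> ePm k (a, s) \<le> real (V + 1) * real N"
    "0 \<le> eQp k (a, s) \<and> eQp k (a, s) \<le> real (V + 1) * real N"
    "0 \<le> eQm k (a, s) \<and> eQm k (a, s) \<le> real (V + 1) * real N"
    "0 \<le> eW (a, s) \<and> eW (a, s) \<le> real (V + 1) * real N"
    "0 \<le> eFp (a, s) \<and> eFp (a, s) \<le> real (V + 1) * real N"
    "0 \<le> eFm (a, s) \<and> eFm (a, s) \<le> real (V + 1) * real N"
proof -
  have sc: "0 \<le> \<eta> ^ m * x \<and> \<eta> ^ m * x \<le> y" if "0 \<le> x \<and> x \<le> y" for m x y
    using that \<eta> mult_right_mono[of "\<eta> ^ m" 1 x] by (auto simp: power_le_one)
  have 0: "0 \<le> real (V + 1) * real N" by simp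
  note A = AB_bounds(1)[OF assms] and B = AB_bounds(2)[OF assms]
  show "0 \<le> ePp k (a, s) \<and> ePp k (a, s) \<le> real (V + 1) * real N"
    unfolding ePp_def emPp_def using sc[OF A] 0 by simp
  show "0 \<le> ePm k (a, s) \<and> ePm k (a, s) \<le> real (V + 1) * real N"
    unfolding ePm_def emPm_def using sc[OF B, of "Suc s"] 0 by simp
  show "0 \<le> eQp k (a, s) \<and> eQp k (a, s) \<le> real (V + 1) * real N"
    unfolding eQp_def emQp_def gw_def using sc[OF A] 0 by simp
  show "0 \<le> eQm k (a, s) \<and> eQm k (a, s) \<le> real (V + 1) * real N"
    unfolding eQm_def emQm_def gw_def using sc[OF B] 0 by simp
  show "0 \<le> eW (a, s) \<and> eW (a, s) \<le> real (V + 1) * real N"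
    unfolding eW_def emW_def using sc[OF B] 0 by simp
  show "0 \<le> eFp (a, s) \<and> eFp (a, s) \<le> real (V + 1) * real N"
    unfolding eFp_def emFp_def using B 0 by simp
  show "0 \<le> eFm (a, s) \<and> eFm (a, s) \<le> real (V + 1) * real N"
    unfolding eFm_def emFm_def using A 0 by simp
qed

lemma chan_bounds:
  assumes "\<And>l. l \<le> V \<Longrightarrow> 0 \<le> kern V q l \<and> kern V q l \<le> 1"
    and "\<And>s. 0 \<le> h (a, s) \<and> h (a, s) \<le> real (V + 1) * real N"
  shows "0 \<le> chan (h, q) (a, s) \<and> chan (h, q) (a, s) \<le> M"
proof -
  have "0 \<le> wsum V (kern V q) (\<lambda>s'. h (a, s')) s \<and>
      wsum V (kern V q) (\<lambda>s'. h (a, s')) s \<le> real (V + 1) * (real (V + 1) * real N)"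
    by (rule wsum_bounds) (use assms in auto)
  moreover have "real (V + 1) * (real (V + 1) * real N) = M" by (simp only: M_def power2_eq_square mult.assoc)
  ultimately show ?thesis by (simp add: chan_def)
qed

lemma kern_01: "l \<le> V \<Longrightarrow> 0 \<le> kern V kC l \<and> kern V kC l \<le> 1"
  "l \<le> V \<Longrightarrow> 0 \<le> kern V kA l \<and> kern V kA l \<le> 1"
  "l \<le> V \<Longrightarrow> 0 \<le> kern V (kB V) l \<and> kern V (kB V) l \<le> 1"
  unfolding kern_kC kern_kA kern_kB using ck_bounds[of l V] ck_bounds[of "Suc l" V] by auto

text \<open>Positions from COPY on number \<open>snd a + 1\<close>, and window positions before COPY
  number \<open>pp a + 1 - E\<close>. The prompt length is emitted only at COPY, so its plain window
  sum returns it once.\<close>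

lemma clock2:
  assumes "a \<in> S"
  shows "chan (ecp, kC) (a, tt a) = real (I2 (a, tt a))"
    "chan (eVp, kC) (a, tt a) + 1 - chan (encp, kC) (a, tt a) = real (E2 (a, tt a))"
proof -
  interpret copy_seq V "pp a" "snd a" nb "real N" \<eta> "zz a" by (rule seq[OF assms])
  have t: "tt a = t" by (simp add: tt_def t_def)
  have w: "chan (h, kC) (a, tt a) = (\<Sum>s = E..pp a. h (a, s)) + (\<Sum>j = 0..snd a. h (a, pp a + 1 + j))" for h
    using split_window[of "\<lambda>_. 1" "\<lambda>s'. h (a, s')"] by (simp add: t chan_def kern_kC)
  show "chan (ecp, kC) (a, tt a) = real (I2 (a, tt a))"
    unfolding w by (simp add: ecp_def I2_def)
  have "(\<Sum>s = E..pp a. eVp (a, s)) = 0" by (simp add: eVp_def)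
  moreover have "(\<Sum>j = 0..snd a. eVp (a, pp a + 1 + j)) = (\<Sum>j = 0..snd a. if j = 0 then real (pp a) else 0)"
    by (intro sum.cong) (auto simp: eVp_def)
  ultimately have "chan (eVp, kC) (a, tt a) = real (pp a)" unfolding w by simp
  moreover have "chan (encp, kC) (a, tt a) = real (pp a + 1 - E)" unfolding w by (simp add: encp_def)
  ultimately show "chan (eVp, kC) (a, tt a) + 1 - chan (encp, kC) (a, tt a) = real (E2 (a, tt a))"
    using E_le by (simp add: E2_def E_def t of_nat_diff)
qed

lemma layer2_computes: "computes Z2 Bd (chan ` set chs2) (62 * (nb + 1) ^ 2) {rp, rm, ru}"
proof -
  note e = \<eta>
  let ?P = "\<lambda>e k. chan (e k, kC)"
  have "computes Z2 Bd (?P ePp ` {..<nb} \<union> ?P ePm ` {..<nb} \<union> ?P eQp ` {..<nb} \<union> ?P eQm ` {..<nb}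
      \<union> {chan (eW, kC), chan (eFp, kA), chan (eFm, kB V), chan (ecp, kC), chan (encp, kC), chan (eVp, kC)})
    (62 * (nb + 1) ^ 2) {rp, rm, ru}"
    unfolding rp_def rm_def ru_def
  proof (rule decoding_program[where M = M])
    fix z assume "z \<in> Z2"
    then obtain a where za: "z = (a, tt a)" "a \<in> S" by (auto simp: Z2_def)
    interpret copy_seq V "pp a" "snd a" nb "real N" \<eta> "zz a" by (rule seq[OF za(2)])
    have EI: "E2 z = E" "I2 z = I" by (simp_all add: za(1) E2_def I2_def E_def I_def t_def tt_def)
    show "chan (ecp, kC) z = real (I2 z) \<and> chan (eVp, kC) z + 1 - chan (encp, kC) z = real (E2 z)"
      using clock2[OF za(2)] by (simp add: za(1))
    show "E2 z \<le> I2 z \<and> 1 \<le> I2 z \<and> I2 z < 2 ^ nb"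
      using E_le I_less unfolding EI by (simp add: I_def)
    show "(0 \<le> ?P ePp k z \<and> ?P ePp k z \<le> M) \<and> (0 \<le> ?P ePm k z \<and> ?P ePm k z \<le> M) \<and>
        (0 \<le> ?P eQp k z \<and> ?P eQp k z \<le> M) \<and> (0 \<le> ?P eQm k z \<and> ?P eQm k z \<le> M)" for k
      unfolding za(1) by (intro conjI[OF chan_bounds] conjI[OF chan_bounds] chan_bounds kern_01 emitted_bounds za(2))
    show "(0 \<le> chan (eW, kC) z \<and> chan (eW, kC) z \<le> M) \<and> (0 \<le> chan (eFp, kA) z \<and> chan (eFp, kA) z \<le> M) \<and>
        (0 \<le> chan (eFm, kB V) z \<and> chan (eFm, kB V) z \<le> M)"
      unfolding za(1) by (intro conjI[OF chan_bounds] conjI[OF chan_bounds] chan_bounds kern_01 emitted_bounds za(2))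
  qed (use M e in auto)
  then show ?thesis by (rule computes_mono) (auto simp: chs2_def)
qed

text \<open>Exactly one splitting digit exists, so each sum over \<open>k\<close> reduces to a
  single term, namely \<open>Rpos\<close>, \<open>Rneg\<close> or \<open>unit\<close> of
  \<open>copy_seq\<close>. Position \<open>I\<close> holds the prompt word with index
  \<open>snd a\<close> because of BOS.\<close>

lemma decoded:
  assumes "a \<in> S"
  defines "z \<equiv> (a, tt a)"
  shows "0 < ru z" "\<bar>rp z - rm z - ru z * real (fst a ! snd a)\<bar> < ru z / 2"
proof -
  interpret copy_seq V "pp a" "snd a" nb "real N" \<eta> "zz a" by (rule seq[OF assms(1)])
  have t: "tt a = t" by (simp add: tt_def t_def)
  have EI: "E2 z = E" "I2 z = I" "E2 z - of_bool (E2 z = I2 z) = E'"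
    by (simp_all add: z_def E2_def I2_def E_def I_def t_def tt_def E'_def)
  obtain k where k: "k < nb" "splits k E' I" using splits_ex[OF E'_less(1) I_less] by blast
  have sum1: "(\<Sum>k'<nb. if splits k' E' I then f k' else 0) = f k" for f :: "nat \<Rightarrow> real"
  proof -
    have "splits k' E' I \<longleftrightarrow> k' = k" for k' using splits_unique[OF _ k(2)] k(2) by blast
    then show ?thesis using k(1) by (simp only:) simp
  qed
  have AB: "AA a = A" "BB a = B" by (simp_all add: AA_def BB_def A_def B_def)
  have ch: "chan (h, q) z = wsum V (kern V q) (\<lambda>s. h (a, s)) t" for h q by (simp add: chan_def z_def t)
  have ev: "(\<lambda>s. ePp k (a, s)) = emPp (pp a) \<eta> k A" "(\<lambda>s. ePm k (a, s)) = emPm (pp a) \<eta> k B"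
    "(\<lambda>s. eQp k (a, s)) = emQp nb (pp a) \<eta> k A" "(\<lambda>s. eQm k (a, s)) = emQm nb (pp a) \<eta> k B"
    "(\<lambda>s. eW (a, s)) = emW nb (pp a) \<eta> B" "(\<lambda>s. eFp (a, s)) = emFp (pp a) B" "(\<lambda>s. eFm (a, s)) = emFm (pp a) A"
    by (simp_all add: ePp_def ePm_def eQp_def eQm_def eW_def eFp_def eFm_def AB)
  have u: "ru z = unit k" unfolding ru_def EI(3) unfolding EI(2) sum1 using unit_gw(1)[OF k] by (simp add: \<kappa>w_def[OF k])
  have p: "rp z = Rpos k"
    unfolding rp_def EI(3) unfolding EI(2) sum1 unfolding EI ch ev kern_kC kern_kA kern_kB Rpos_def[OF k] \<kappa>w_def[OF k] unit_gw(1)[OF k, symmetric]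
    by simp
  have m: "rm z = Rneg k"
    unfolding rm_def EI(3) unfolding EI(2) sum1 unfolding EI ch ev kern_kC kern_kA kern_kB Rneg_def[OF k] \<kappa>w_def[OF k] \<mu>w_def[OF k] unit_gw(1)[OF k, symmetric]
    by simp
  have x: "zz a I = real (fst a ! snd a)" using S_D(1)[OF assms(1)] by (simp add: zz_def I_def)
  show "0 < ru z" unfolding u by (rule unit_pos[OF k])
  show "\<bar>rp z - rm z - ru z * real (fst a ! snd a)\<bar> < ru z / 2"
    using decode[OF k] unfolding u p m x .
qed

lemma ssm_copies:
  "\<exists>F\<in>ssm_class N 2 V D (D + 2) D ((D + 2) * (D * D + D)) Bd. \<exists>Wdec\<in>carrier_mat D N.
    mat_inf_norm Wdec \<le> 1 \<and> (\<forall>a\<in>S. next_word N F Wdec (ws a) = fst a ! snd a)"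
proof -
  have D: "5 + 40 * (nb + 1) ^ 2 \<le> D" "4 * nb + 6 + 62 * (nb + 1) ^ 2 \<le> D" "3 \<le> D" "1 \<le> D"
    unfolding D_def by (auto simp: power2_eq_square algebra_simps)
  have "0 \<le> Bd" using Bd1(1) by simp
  then obtain emb where emb: "emb \<in> emb_class N D Bd"
    "\<And>ws. set ws \<subseteq> {..<N} \<Longrightarrow> length (emb (map (unit_vec N) ws)) = length ws"
    "\<And>ws s. \<lbrakk>set ws \<subseteq> {..<N}; s < length ws\<rbrakk> \<Longrightarrow> emb (map (unit_vec N) ws) ! s \<in> carrier_vec D"
    "\<And>ws s k. \<lbrakk>set ws \<subseteq> {..<N}; s < length ws; k < D\<rbrakk> \<Longrightarrow> emb (map (unit_vec N) ws) ! s $ k = emb_coeff k (ws ! s)"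
    using emb_channels[of Bd emb_coeff N D, OF _ emb_coeff_le] by blast
  define X1 where "X1 a = emb (map (unit_vec N) (ws a))" for a
  have X1: "length (X1 a) = Suc (tt a)" "s < Suc (tt a) \<Longrightarrow> X1 a ! s \<in> carrier_vec D"
    "s < Suc (tt a) \<Longrightarrow> k < D \<Longrightarrow> X1 a ! s $ k = emb_coeff k (ws a ! s)" if "a \<in> S" for a s k
    using emb(2-4)[OF ws_props(2)[OF that]] ws_props(1)[OF that] by (simp_all add: X1_def)
  have fb: "filter_bound Bd kC" "filter_bound Bd kA" "filter_bound Bd (kB V)" "filter_bound Bd (kD V)"
  proof -
    show "filter_bound Bd kC" "filter_bound Bd kA" using Bd1(1) by (simp_all add: kC_def kA_def)
    show "filter_bound Bd (kB V)" unfolding kB_def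
      using Bd1(1) by (auto intro: order_trans[OF abs_cos_le_one] order_trans[OF abs_sin_le_one])
    have "1 * 1 \<le> 2 * pi * real (V + 1)" using pi_gt3 by (intro mult_mono) auto
    then have "\<bar>1 / (2 * pi * real (V + 1))\<bar> \<le> 1" by (simp add: divide_le_eq)
    then have 1: "\<bar>1 / (2 * pi * real (V + 1))\<bar> \<le> Bd" using Bd1(1) by linarith
    have 2: "\<bar>real (V + 1) ^ 2\<bar> \<le> Bd" "\<bar>0 :: real\<bar> \<le> Bd" using M(4) Bd1(1) by simp_all
    show "filter_bound Bd (kD V)" unfolding kD_def filter_bound.simps using 1 2 by blast
  qed
  have "\<exists>g\<in>conv_class V D Bd. \<exists>f\<in>fnn_class D D (D + 2) D ((D + 2) * (D * D + D)) Bd.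
    (\<forall>a\<in>S. length (map f (g (X1 a))) = Suc (tt a) \<and> (\<forall>s<Suc (tt a). map f (g (X1 a)) ! s \<in> carrier_vec D)) \<and>
    (\<forall>h\<in>emitted. \<exists>r<D. \<forall>(a, s)\<in>Z1. map f (g (X1 a)) ! s $ r = h (a, s))"
  proof (rule ssm_layer[where chs = chs1 and n = "40 * (nb + 1) ^ 2"])
    show "computes Z1 Bd ((\<lambda>(h, p) (a, s). wsum V (kern V p) (\<lambda>s'. h (a, s')) s) ` set chs1) (40 * (nb + 1) ^ 2) emitted"
      using layer1_computes unfolding chan_def .
    show "length chs1 + 40 * (nb + 1) ^ 2 \<le> D" using D(1) by (simp add: chs1_def)
    fix h p assume hp: "(h, p) \<in> set chs1"
    have "\<exists>r<D. \<forall>a\<in>S. \<forall>s<Suc (tt a). X1 a ! s $ r = h (a, s)" if "h = hz \<or> h = ho \<or> h = hc"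
      using that
    proof (elim disjE)
      assume "h = hz" then show ?thesis using X1(3) emb_values(1) D(3) by (intro exI[of _ 0]) auto
    next
      assume "h = ho" then show ?thesis using X1(3) emb_values(2) D(3) by (intro exI[of _ 1]) auto
    next
      assume "h = hc" then show ?thesis using X1(3) emb_values(3) D(3) by (intro exI[of _ 2]) auto
    qed
    then show "filter_bound Bd p \<and> (\<exists>r<D. \<forall>a\<in>S. \<forall>s<Suc (tt a). X1 a ! s $ r = h (a, s))"
      using hp fb by (auto simp: chs1_def)
    fix a s assume as: "(a, s) \<in> Z1"
    then have as': "a \<in> S" "s < Suc (tt a)" by (auto simp: Z1_def)
    have "0 \<le> chan (hz, kA) (a, s)" "0 \<le> chan (hz, kB V) (a, s)"
      using AB_bounds[OF as'(1)] by (simp_all add: chan_def kern_kA kern_kB AA_def BB_def hz_def)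
    moreover have "s - pp a - 1 \<le> V" using as' S_D(1,2)[OF as'(1)] by (simp add: tt_def)
    then have "0 \<le> chan (hc, kD V) (a, s)" unfolding counts(5)[OF as'] using kern_kD_bounds(1) by simp
    moreover have "0 \<le> chan (hc, kC) (a, s)" "0 \<le> chan (ho, kC) (a, s)" using counts(3,4)[OF as'] by auto
    ultimately have "0 \<le> chan (h, p) (a, s)" using hp by (auto simp: chs1_def)
    then show "0 \<le> wsum V (kern V p) (\<lambda>s'. h (a, s')) s" by (simp add: chan_def)
  qed (use Bd1 D X1 in \<open>auto simp: Z1_def\<close>)
  then obtain g1 f1 where gf1: "g1 \<in> conv_class V D Bd" "f1 \<in> fnn_class D D (D + 2) D ((D + 2) * (D * D + D)) Bd"
    and X2: "\<forall>a\<in>S. length (map f1 (g1 (X1 a))) = Suc (tt a) \<and> (\<forall>s<Suc (tt a). map f1 (g1 (X1 a)) ! s \<in> carrier_vec D)"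
    and em: "\<forall>h\<in>emitted. \<exists>r<D. \<forall>(a, s)\<in>Z1. map f1 (g1 (X1 a)) ! s $ r = h (a, s)"
    by (elim bexE conjE) (rule that)
  define X2 where "X2 a = map f1 (g1 (X1 a))" for a
  have "\<exists>g\<in>conv_class V D Bd. \<exists>f\<in>fnn_class D D (D + 2) D ((D + 2) * (D * D + D)) Bd.
    (\<forall>a\<in>S. length (map f (g (X2 a))) = Suc (tt a) \<and> (\<forall>s<Suc (tt a). map f (g (X2 a)) ! s \<in> carrier_vec D)) \<and>
    (\<forall>h\<in>{rp, rm, ru}. \<exists>r<D. \<forall>(a, s)\<in>Z2. map f (g (X2 a)) ! s $ r = h (a, s))"
  proof (rule ssm_layer[where chs = chs2 and n = "62 * (nb + 1) ^ 2"])
    show "computes Z2 Bd ((\<lambda>(h, p) (a, s). wsum V (kern V p) (\<lambda>s'. h (a, s')) s) ` set chs2) (62 * (nb + 1) ^ 2) {rp, rm, ru}"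
      using layer2_computes unfolding chan_def .
    show "length chs2 + 62 * (nb + 1) ^ 2 \<le> D" using D(2) by (simp add: chs2_def)
    show "length (X2 a) = Suc (tt a)" if "a \<in> S" for a using bspec[OF X2 that] unfolding X2_def by blast
    show "X2 a ! s \<in> carrier_vec D" if "a \<in> S" "s < Suc (tt a)" for a s
      using bspec[OF X2 that(1)] that(2) unfolding X2_def by blast
    fix h p assume hp: "(h, p) \<in> set chs2"
    then have "h \<in> emitted" "filter_bound Bd p" using fb by (auto simp: chs2_def emitted_def)
    moreover from bspec[OF em this(1)] obtain r where "r < D" "\<forall>(a, s)\<in>Z1. X2 a ! s $ r = h (a, s)"
      unfolding X2_def by blast
    then have "\<exists>r<D. \<forall>a\<in>S. \<forall>s<Suc (tt a). X2 a ! s $ r = h (a, s)"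
      by (intro exI[of _ r]) (auto simp: Z1_def)
    ultimately show "filter_bound Bd p \<and> (\<exists>r<D. \<forall>a\<in>S. \<forall>s<Suc (tt a). X2 a ! s $ r = h (a, s))" by blast
    fix a s assume "(a, s) \<in> Z2"
    then have a: "a \<in> S" by (simp add: Z2_def)
    have "0 \<le> h (a, s')" for s'
      using hp emitted_bounds[OF a] by (auto simp: chs2_def ecp_def encp_def eVp_def)
    moreover have "0 \<le> kern V p l" if "l \<le> V" for l
      using hp kern_01[OF that] by (auto simp: chs2_def)
    ultimately show "0 \<le> wsum V (kern V p) (\<lambda>s'. h (a, s')) s"
      unfolding wsum_def by (intro sum_nonneg mult_nonneg_nonneg) auto
  qed (use Bd1 D in \<open>auto simp: Z2_def\<close>)
  then obtain g2 f2 where gf2: "g2 \<in> conv_class V D Bd" "f2 \<in> fnn_class D D (D + 2) D ((D + 2) * (D * D + D)) Bd"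
    and X3: "\<forall>a\<in>S. length (map f2 (g2 (X2 a))) = Suc (tt a) \<and> (\<forall>s<Suc (tt a). map f2 (g2 (X2 a)) ! s \<in> carrier_vec D)"
    and dec: "\<forall>h\<in>{rp, rm, ru}. \<exists>r<D. \<forall>(a, s)\<in>Z2. map f2 (g2 (X2 a)) ! s $ r = h (a, s)"
    by (elim bexE conjE) (rule that)
  define F where "F X = foldl (\<lambda>Y (g, f). map f (g Y)) (emb X) [(g1, f1), (g2, f2)]" for X
  have F: "F \<in> ssm_class N 2 V D (D + 2) D ((D + 2) * (D * D + D)) Bd"
    unfolding ssm_class_def F_def using emb(1) gf1 gf2
    by (intro CollectI exI[of _ emb] exI[of _ "[(g1, f1), (g2, f2)]"]) auto
  have FX: "F (map (unit_vec N) (ws a)) = map f2 (g2 (X2 a))" for a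
    by (simp add: F_def X2_def X1_def)
  obtain r1 where r1: "r1 < D" "\<forall>(a, s)\<in>Z2. map f2 (g2 (X2 a)) ! s $ r1 = rp (a, s)" using bspec[OF dec, of rp] by blast
  obtain r2 where r2: "r2 < D" "\<forall>(a, s)\<in>Z2. map f2 (g2 (X2 a)) ! s $ r2 = rm (a, s)" using bspec[OF dec, of rm] by blast
  obtain r3 where r3: "r3 < D" "\<forall>(a, s)\<in>Z2. map f2 (g2 (X2 a)) ! s $ r3 = ru (a, s)" using bspec[OF dec, of ru] by blast
  let ?W = "score_weights D N r1 r2 r3"
  have "next_word N F ?W (ws a) = fst a ! snd a" if a: "a \<in> S" for a
  proof -
    define y where "y = map f2 (g2 (X2 a)) ! tt a"
    have len: "length (map f2 (g2 (X2 a))) = Suc (tt a)" and y: "y \<in> carrier_vec D"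
      using bspec[OF X3 a] by (auto simp: y_def)
    have last: "last (F (map (unit_vec N) (ws a))) = y"
      unfolding FX y_def using len by (subst last_conv_nth) auto
    have z: "(a, tt a) \<in> Z2" using a by (simp add: Z2_def)
    have v: "y $ r1 = rp (a, tt a)" "y $ r2 = rm (a, tt a)" "y $ r3 = ru (a, tt a)"
      using bspec[OF r1(2) z] bspec[OF r2(2) z] bspec[OF r3(2) z] unfolding y_def by simp_all
    show ?thesis unfolding next_word_def last
    proof (rule arg_max_score[where R = "rp (a, tt a) - rm (a, tt a)" and u = "ru (a, tt a)" and c = "4 * real N ^ 2"])
      show "0 < 4 * real N ^ 2" using N1 by simp
      show "fst a ! snd a < N" using S_D(1,3)[OF a] by blast
      show "(transpose_mat ?W *\<^sub>v y) $ w = (real w * (rp (a, tt a) - rm (a, tt a)) - real w ^ 2 / 2 * ru (a, tt a)) / (4 * real N ^ 2)"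
        if "w < N" for w using score_weights_eval[OF r1(1) r2(1) r3(1) that y] unfolding v .
    qed (use decoded[OF a] in auto)
  qed
  moreover have "?W \<in> carrier_mat D N" by (simp add: score_weights_def)
  ultimately show ?thesis using F score_weights_norm by blast
qed

end

section \<open>Generation and size bounds\<close>

text \<open>Generalized over the number \<open>m\<close> of words already copied: as long as all
  predictions are right, the sequence fed in keeps the form for which the hypothesis determines the
  next word.\<close>

lemma generate_copy:
  assumes "\<And>i. i < length x \<Longrightarrow> predict (BOS # x @ COPY # take i x) = x ! i" "m + n = length x"
  shows "generate predict n (BOS # x @ COPY # take m x) = drop m x"
  using assms(2)
proof (induction n arbitrary: m)
  case (Suc n)
  then have m: "m < length x" by simp
  have "generate predict n ((BOS # x @ COPY # take m x) @ [x ! m]) = drop (Suc m) x"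
    using Suc.IH[of "Suc m"] Suc.prems m by (simp add: take_Suc_conv_app_nth)
  then show ?case using m assms(1)[OF m] by (simp add: Cons_nth_drop_Suc)
qed simp

lemma copy_err_zero:
  assumes "\<And>x i. \<lbrakk>set x \<subseteq> {..<N} - {BOS, COPY}; length x = V'; i < length x\<rbrakk> \<Longrightarrow>
      predict (BOS # x @ COPY # take i x) = x ! i"
    and "{..<N} - {BOS, COPY} \<noteq> {}"
  shows "copy_err N BOS COPY predict V' = 0"
proof -
  have "generate predict V' (BOS # x @ [COPY]) = x"
    if "x \<in> set_pmf (replicate_pmf V' (pmf_of_set ({..<N} - {BOS, COPY})))" for x
  proof -
    have "set x \<subseteq> {..<N} - {BOS, COPY}" "length x = V'"
      using that assms(2) by (auto simp: set_replicate_pmf lists_eq_set)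
    then show ?thesis using generate_copy[of x predict BOS COPY 0 V'] assms(1) by simp
  qed
  then show ?thesis unfolding copy_err_def by (auto simp: measure_pmf_zero_iff)
qed

text \<open>Bracket \<open>V + 1\<close> between \<open>2 ^ n\<close> and \<open>2 ^ (n + 1)\<close>
  and take \<open>nb = n + 1\<close>. From \<open>2 ^ n \<le> 2 * V\<close> and
  \<open>ln 2 \<ge> 1 / 2\<close> follows \<open>n \<le> 1 + 2 * ln V\<close>.\<close>

lemma bit_length_exists:
  assumes "1 \<le> V"
  shows "\<exists>nb. V + 2 \<le> 2 ^ nb \<and> 2 ^ nb \<le> 2 * (V + 2) \<and> real (nb + 1) \<le> 5 * log1 (real V)"
proof -
  obtain n where n: "2 ^ n \<le> V + 1" "V + 1 < 2 ^ (n + 1)"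
    using ex_power_ivl1[of 2 "V + 1"] by auto
  have "(2::nat) ^ n \<le> 2 * V" using n(1) assms by simp
  then have "real (2 ^ n) \<le> real (2 * V)" by (rule of_nat_mono)
  then have "ln ((2::real) ^ n) \<le> ln (2 * real V)" using assms by (subst ln_le_cancel_iff) auto
  then have "real n * ln 2 \<le> ln 2 + ln (real V)" using assms by (simp add: ln_realpow ln_mult)
  moreover have "ln (exp (1 / 2)) \<le> ln (2::real)"
    using exp_half_le2 by (subst ln_le_cancel_iff) auto
  then have "1 / 2 \<le> ln (2::real)" by (simp only: ln_exp)
  moreover have "0 \<le> ln (real V)" using assms by simp
  ultimately have "real n \<le> 1 + 2 * ln (real V)"
  proof -
    assume a: "real n * ln 2 \<le> ln 2 + ln (real V)" "1 / 2 \<le> ln (2::real)" "0 \<le> ln (real V)"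
    have "ln (real V) \<le> (2 * ln (real V)) * ln 2" using mult_left_mono[OF a(2), of "2 * ln (real V)"] a(3) by simp
    then have "real n * ln 2 \<le> (1 + 2 * ln (real V)) * ln 2" using a(1) by (simp add: algebra_simps)
    then show ?thesis using a(2) by (simp add: mult_le_cancel_right)
  qed
  moreover have "1 \<le> log1 (real V)" "ln (real V) \<le> log1 (real V)" by (auto simp: log1_def)
  ultimately have "real (n + 1 + 1) \<le> 5 * log1 (real V)" by simp
  then show ?thesis using n by (intro exI[of _ "n + 1"]) auto
qed

text \<open>The width is at most \<open>80 * 25 = 2000\<close> times the squared logarithm of
  \<open>V\<close>. The number of nonzero parameters is at most \<open>6 * D ^ 3\<close>, which
  leads to the sixth power and to the constant \<open>10 ^ 11\<close>.\<close>

lemma (in copier) size_bounds: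
  assumes "real (nb + 1) \<le> 5 * log1 (real V)"
  shows "real D \<le> 10 ^ 11 * log1 (real V) ^ 6" "real (D + 2) \<le> 10 ^ 11 * log1 (real V) ^ 6"
    "real ((D + 2) * (D * D + D)) \<le> 10 ^ 11 * log1 (real V) ^ 6"
    "log1 Bd \<le> 10 ^ 11 * (log1 (real V) * log1 (real N))"
proof -
  define l where "l = log1 (real V)"
  define m where "m = log1 (real N)"
  have l: "1 \<le> l" "ln (real V) \<le> l" and m: "1 \<le> m" "ln (real N) \<le> m" by (auto simp: l_def m_def log1_def)
  have "real (nb + 1) ^ 2 \<le> (5 * l) ^ 2" using assms by (intro power_mono) (auto simp: l_def)
  then have D: "real D \<le> 2000 * l ^ 2" by (simp add: D_def power_mult_distrib)
  have "1 \<le> D" by (simp add: D_def)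
  then have D1: "1 \<le> real D" by simp
  have l26: "l ^ 2 \<le> l ^ 6" using l by (intro power_increasing) auto
  have l6: "1 \<le> l ^ 6" using l by simp
  show "real D \<le> 10 ^ 11 * log1 (real V) ^ 6" unfolding l_def[symmetric] using D l26 l6 by simp
  show "real (D + 2) \<le> 10 ^ 11 * log1 (real V) ^ 6" unfolding l_def[symmetric] using D l26 l6 by simp
  have "real ((D + 2) * (D * D + D)) = (real D + 2) * (real D * real D + real D)" by (simp add: algebra_simps)
  also have "\<dots> \<le> (3 * real D) * (real D * real D + real D * real D)"
    using D1 mult_left_mono[OF D1, of "real D"] by (intro mult_mono add_mono) auto
  also have "\<dots> = 6 * real D ^ 3" by (simp add: power3_eq_cube)
  also have "\<dots> \<le> 6 * (2000 * l ^ 2) ^ 3" using D by (intro mult_left_mono power_mono) auto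
  also have "\<dots> = 48000000000 * l ^ 6" by (simp add: power_mult_distrib flip: power_mult)
  also have "\<dots> \<le> 10 ^ 11 * l ^ 6" using l6 by simp
  finally show "real ((D + 2) * (D * D + D)) \<le> 10 ^ 11 * log1 (real V) ^ 6" by (simp add: l_def)
  have pos: "0 < real V" "0 < real N" using V words by auto
  have "ln Bd \<le> ln (270 * real V ^ 2 * real N)"
  proof -
    have "real (V + 2) ^ 2 \<le> (3 * real V) ^ 2" using V by (intro power_mono) auto
    then have "Bd \<le> 270 * real V ^ 2 * real N"
      unfolding Bd_def by (intro mult_right_mono) (auto simp: power_mult_distrib)
    then show ?thesis using Bd1(1) pos by (subst ln_le_cancel_iff) auto
  qed
  also have "\<dots> = ln 270 + 2 * ln (real V) + ln (real N)" using pos by (simp add: ln_mult ln_realpow)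
  also have "\<dots> \<le> 270 + 2 * l + m" using l m ln_add_one_self_le_self[of 269] by simp
  also have "\<dots> \<le> 10 ^ 11 * (l * m)"
  proof -
    have "l \<le> l * m" "m \<le> l * m" "1 \<le> l * m" using l m mult_mono[of 1 l 1 m] by auto
    then show ?thesis by simp
  qed
  finally have "ln Bd \<le> 10 ^ 11 * (l * m)" .
  moreover have "1 \<le> 10 ^ 11 * (l * m)" using l m mult_mono[of 1 l 1 m] by simp
  ultimately show "log1 Bd \<le> 10 ^ 11 * (log1 (real V) * log1 (real N))" by (simp add: log1_def[of Bd] l_def m_def)
qed

theorem theorem3p1:
  shows "\<exists>C::real. C > 0 \<and>
    (\<forall>(N::nat) (BOS::nat) (COPY::nat) (V::nat) (\<epsilon>::real).
      BOS < N \<and> COPY < N \<and> BOS \<noteq> COPY \<and> {..<N} - {BOS, COPY} \<noteq> {} \<and> V \<ge> 1 \<and> \<epsilon> > 0 \<longrightarrow>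
      (\<exists>(D::nat) (L::nat) (W::nat) (S::nat) (B::real) F Wdec.
        (let K = C * log1 (inverse \<epsilon>) ^ 37 * log1 (real V) ^ 42 * log1 (real N) ^ 8 in
          real D \<le> K \<and> real L \<le> K \<and> real W \<le> K \<and> real S \<le> K \<and> B > 0 \<and> log1 B \<le> K) \<and>
        F \<in> ssm_class N 2 V D L W S B \<and>
        Wdec \<in> carrier_mat D N \<and> mat_inf_norm Wdec \<le> 1 \<and>
        (SUP V'\<in>{1..V}. copy_err N BOS COPY (next_word N F Wdec) V') \<le> \<epsilon>))"
proof (intro exI[of _ "10 ^ 11 :: real"] conjI allI impI)
  fix N BOS COPY V :: nat and \<epsilon> :: real
  assume asm: "BOS < N \<and> COPY < N \<and> BOS \<noteq> COPY \<and> {..<N} - {BOS, COPY} \<noteq> {} \<and> V \<ge> 1 \<and> \<epsilon> > 0"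
  then obtain nb where nb: "V + 2 \<le> 2 ^ nb" "2 ^ nb \<le> 2 * (V + 2)" "real (nb + 1) \<le> 5 * log1 (real V)"
    using bit_length_exists by blast
  note len = nb(3)
  interpret copier N BOS COPY V nb by standard (use asm nb in auto)
  obtain F Wdec where F: "F \<in> ssm_class N 2 V D (D + 2) D ((D + 2) * (D * D + D)) Bd"
    and Wdec: "Wdec \<in> carrier_mat D N" "mat_inf_norm Wdec \<le> 1"
    and copies: "\<forall>a\<in>S. next_word N F Wdec (ws a) = fst a ! snd a"
    using ssm_copies by blast
  define K where "K = 10 ^ 11 * log1 (inverse \<epsilon>) ^ 37 * log1 (real V) ^ 42 * log1 (real N) ^ 8"
  have log1: "1 \<le> log1 y" for y by (simp add: log1_def)
  \<comment> \<open>Every \<open>log1\<close> is at least 1, so further factors and larger exponents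
    only increase the bound.\<close>
  have K: "10 ^ 11 * (x * y) \<le> K" if "0 \<le> x" "x \<le> log1 (real V) ^ 42" "0 \<le> y" "y \<le> log1 (real N) ^ 8" for x y
  proof -
    have "x * y \<le> log1 (real V) ^ 42 * log1 (real N) ^ 8" using that by (intro mult_mono) auto
    also have "\<dots> \<le> log1 (inverse \<epsilon>) ^ 37 * (log1 (real V) ^ 42 * log1 (real N) ^ 8)"
      using mult_right_mono[of 1 "log1 (inverse \<epsilon>) ^ 37" "log1 (real V) ^ 42 * log1 (real N) ^ 8"] log1
        order_trans[OF zero_le_one log1] by simp
    finally show ?thesis by (simp add: K_def mult.assoc)
  qed
  have log0: "0 \<le> log1 y" for y using log1[of y] by simp
  have K6: "10 ^ 11 * log1 (real V) ^ 6 \<le> K"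
    using K[of "log1 (real V) ^ 6" 1] log0 log1 by (simp add: power_increasing)
  have KB: "10 ^ 11 * (log1 (real V) * log1 (real N)) \<le> K"
    using log0 log1 power_increasing[of 1 42 "log1 (real V)"] power_increasing[of 1 8 "log1 (real N)"]
    by (intro K) auto
  have "copy_err N BOS COPY (next_word N F Wdec) V' = 0" if "V' \<in> {1..V}" for V'
  proof (rule copy_err_zero)
    fix x i assume "set x \<subseteq> {..<N} - {BOS, COPY}" "length x = V'" "i < length x"
    then have "(x, i) \<in> S" using that by (simp add: S_def)
    then show "next_word N F Wdec (BOS # x @ COPY # take i x) = x ! i"
      using bspec[OF copies] by (fastforce simp: ws_def)
  qed (use asm in blast)
  \<comment> \<open>The index set is nonempty because \<open>V \<ge> 1\<close>, and every error in
    it is 0.\<close>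
  then have "(SUP V'\<in>{1..V}. copy_err N BOS COPY (next_word N F Wdec) V') \<le> \<epsilon>"
    using asm by (intro cSUP_least) auto
  moreover have "real D \<le> K \<and> real (D + 2) \<le> K \<and> real D \<le> K \<and> real ((D + 2) * (D * D + D)) \<le> K \<and> Bd > 0 \<and> log1 Bd \<le> K"
    using size_bounds[OF len] K6 KB Bd1(1) by (smt (verit))
  ultimately show "\<exists>D L W S B F Wdec.
        (let K = 10 ^ 11 * log1 (inverse \<epsilon>) ^ 37 * log1 (real V) ^ 42 * log1 (real N) ^ 8 in
          real D \<le> K \<and> real L \<le> K \<and> real W \<le> K \<and> real S \<le> K \<and> B > 0 \<and> log1 B \<le> K) \<and>
        F \<in> ssm_class N 2 V D L W S B \<and>
        Wdec \<in> carrier_mat D N \<and> mat_inf_norm Wdec \<le> 1 \<and>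
        (SUP V'\<in>{1..V}. copy_err N BOS COPY (next_word N F Wdec) V') \<le> \<epsilon>"
    unfolding Let_def K_def[symmetric] using F Wdec by blast
qed simp

end
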